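(* Fix $R\ge1$. In the setting and notation of the context (Banach lattice $\mathcal X$ with weights $\gamma$, logarithmic gradient $b$ built from $A$, $F_k^0$, $G_k$; coercivity functionals $L_k(x_k)=(F_k^0(x_k),x_k)_H$), let $\mathcal J=\{\mathcal J_{k,j}\}_{k,j\in\mathbb Z}$ be an infinite symmetric matrix with entries $\mathcal J_{k,j}=\mathcal J_{j,k}\ge0$ such that $$|||\mathcal J|||:=\sup_{k\in\mathbb Z}\sum_{j\in\mathbb Z}\mathcal J_{k,j}\gamma_{k-j}^R<\infty .$$ Suppose there are constants $\mathcal K_0,\mathcal K_1,\mathcal K_2,\mathcal K_3,\mathcal M_1,\mathcal M_2>0$ and $\mathcal L_0,\mathcal L_1,\mathcal L_2,\mathcal L_3,\mathcal N_1,\mathcal N_2\ge0$ such that uniformly for all $x\in\mathcal X$ and $i=(k,n)\in\mathbb Z\times\mathbb N$: ($\mathbb F_0$) $|\partial_nF_k^0(x_k)|_{B^*}\le\mathcal K_0(|F_k^0(x_k)|_{B^*}+|x_k|_B^R)+\mathcal L_0$; ($\mathbb G_1$) $|(G_k(x),\varphi_n)_H|+|(\partial_iG_k(x),\varphi_n)_H|\le\mathcal M_1\sum_{j}\mathcal J_{k,j}|x_j|_B^R+\mathcal N_1$; ($\mathbb G_2$) $|G_k(x)|_{B^*}+|(G_k(x),x_k)_H|+|(\partial_iG_k(x),x_k)_H|\le\mathcal M_2\sum_{j}\mathcal J_{k,j}|x_j|_B^R+\mathcal N_2$; ($\mathbb L_1$) $|(F_k^0(x_k),\varphi_n)_H|+|(\partial_nF_k^0(x_k),\varphi_n)_H|\le\mathcal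 K_1L_k(x_k)+\mathcal L_1$; ($\mathbb L_2$) $|(\partial_nF_k^0(x_k),x_k)_H|\le\mathcal K_2L_k(x_k)+\mathcal L_2$; ($\mathbb L_3$) $|x_k|_B^R\le\mathcal K_3L_k(x_k)+\mathcal L_3$. Suppose in addition that $$\Xi_0:=\mathcal K_1\,\mathrm{Tr}_HA^{-1}<1,\qquad\Theta_0:=|||\mathcal J|||\cdot\mathcal K_3\,\frac{\mathcal M_2+\mathcal M_1\mathrm{Tr}_HA^{-1}}{1-\mathcal K_1\mathrm{Tr}_HA^{-1}}<1 .$$ Then $$\sup_{\mu\in\mathcal M^b(\mathcal X)}\sup_{k\in\mathbb Z}\int_{\mathcal X}|L_k(x_k)|\,d\mu(x)<\infty,$$ and for all $Q\ge1$ $$\sup_{\mu\in\mathcal M^b(\mathcal X)}\sup_{k\in\mathbb Z}\int_{\mathcal X}|x_k|_B^Q\,d\mu(x)<\infty,\qquad\sup_{\mu\in\mathcal M^b(\mathcal X)}\sup_{k\in\mathbb Z}\int_{\mathcal X}\Big(\sum_{j\in\mathbb Z}\mathcal J_{k,j}|x_j|_B^R\Big)^Qd\mu(x)<\infty .$$ If, in addition, for some $Q\ge1$ $$\Xi_{Q-1}:=\mathrm{Tr}_HA^{-1}\,\mathcal K_1[1+(Q-1)\mathcal K_2]<1,$$ then $$\sup_{\mu\in\mathcal M^b(\mathcal X)}\sup_{k\in\mathbb Z}\int_{\mathcal X}|L_k(x_k)|^Q\,d\mu(x)<\infty .$$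
   Context: Single-site spaces. $H$ is a separable real Hilbert space with inner product $(\cdot,\cdot)_H$; $X\subset B\subset H\subset B^*$ are dense continuous embeddings, where $X$ is a locally convex (e.g. Banach) space, $B$ a reflexive Banach space, $B^*$ its dual, the duality between $B$ and $B^*$ being given by (the extension of) $(\cdot,\cdot)_H$; the norms $|\cdot|_B$, $|\cdot|_{B^*}$ are differentiable outside zero. $A$ is a positive self-adjoint operator in $H$ with discrete spectrum $\{\lambda_n\}_{n\in\mathbb N}$ and complete orthonormal system of eigenvectors $A\varphi_n=\lambda_n\varphi_n$, $\mathrm{Tr}_HA^{-1}=\sum_n\lambda_n^{-1}<\infty$. All $\varphi_n\in X$, $\{\varphi_n\}$ is a Schauder basis of $B$, and there are finite constants $\kappa,\varsigma$ with $\sup_n|\varphi_n|_B\le\kappa$ and $|\mathbb P_Kx|_B\le\varsigma|x|_B$ for $x\in B$, $K\in\mathbb N$, where $\mathbb P_Kx=\sum_{n\le K}(x,\varphi_n)_H\varphi_n$. Lattice. $\mathbb Z$ denotes a countable index set with an abelian group structure (e.g. $\mathbb Z^d$). $\gamma=\{\gamma_k\}_{k\in\mathbb Z}$ is a weight system with $\gamma_k\ge1$, $\sum_k\gamma_k^{-1}\le1$, and $\gamma_{k-j}=\gamma_{j-k}\le\gamma_k\gamma_j$ for all $k,j$. $\mathcal B=l^2(\mathbb Z\to B;\gamma^{-1})=\{x\in B^{\mathbb Z}:\|x\|_{\mathcal B}^2=\sum_k\gamma_k^{-1}|x_k|_B^2<\infty\}$. $\mathcal X=\mathcal B\cap X^{\mathbb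 Z}$, a locally convex Polish space with metric $\rho_{\mathcal X}(x,x')=\big[\sum_k\gamma_k^{-1}\big(|x_k-x_k'|_B^2+\frac{|x_k-x_k'|_X^2}{1+|x_k-x_k'|_X^2}\big)\big]^{1/2}$. For $i=(k,n)\in\mathbb Z\times\mathbb N$, $h_i=(\delta_{k,j}\varphi_n)_{j\in\mathbb Z}$, and $\partial_i=\partial_{(k,n)}$ is the partial derivative along $h_i$; $\partial_n$ is the partial derivative along $\varphi_n$ on $X$. Logarithmic gradient. For each $k\in\mathbb Z$, $F_k^0:X\to B^*$ and $G_k:\mathcal X\to B^*$ are (nonlinear) mappings which are continuous and locally bounded together with their partial derivatives in all directions $\varphi_n$, respectively $h_{(k,n)}$, $n\in\mathbb N$. Put $F_k(x)=F_k^0(x_k)+G_k(x)$ and $b_{(k,n)}(x)=-(A\varphi_n,x_k)_H-(F_k(x),\varphi_n)_H$, $x\in\mathcal X$. $C^1_b(\mathcal X;h)$ is the set of $f:\mathcal X\to\mathbb R$ continuous and bounded together with $\partial_hf$. $\mathcal M^b(\mathcal X)$ is the family of all Borel probability measures $\mu$ on $\mathcal X$ such that for every $i=(k,n)$ $$\int_{\mathcal X}\partial_{(k,n)}f\,d\mu=-\int_{\mathcal X}f\,b_{(k,n)}\,d\mu$$ for all $f\in C_b^1(\mathcal X;h_i)$ with $\sup_{x\in\mathcal X}|f(x)|(1+|x_k|_{B^*}+|F_k(x)|_{B^*})<\infty$. The coercivity functionals are $L_k:X\to\mathbb R$, $L_k(x_k)=(F_k^0(x_k),x_k)_H$. (Suprema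 over $\mathcal M^b(\mathcal X)$ are of interest when $\mathcal M^b(\mathcal X)\ne\emptyset$.) *)

theory Defs
  imports "HOL-Analysis.Analysis"
begin

section \<open>Single-site spaces\<close>

text \<open>
  The inclusions of X in B and of B in H are written as injective continuous linear maps with dense
  range, \<open>iXB :: 'x \<Rightarrow> 'b\<close> and \<open>iBH :: 'b \<Rightarrow>\<^sub>L 'h\<close>. The dual of B is the type \<open>'b \<Rightarrow>\<^sub>L real\<close> with the
  operator norm, and H is included in it by \<open>dual_embed\<close>. The duality between B and its dual thereby
  extends the inner product of H: for a functional \<open>F\<close>, the number \<open>(F, v)\<^sub>H\<close> is \<open>blinfun_apply F v\<close>.
\<close>

definition dual_embed :: "('b::banach \<Rightarrow>\<^sub>L 'h::real_inner) \<Rightarrow> 'h \<Rightarrow> ('b \<Rightarrow>\<^sub>L real)" where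
  "dual_embed iBH u = blinfun_inner_right u o\<^sub>L iBH"

definition reflexive :: "'b::banach itself \<Rightarrow> bool" where
  "reflexive _ \<longleftrightarrow>
    (\<forall>\<Phi> :: ('b \<Rightarrow>\<^sub>L real) \<Rightarrow>\<^sub>L real. \<exists>v :: 'b. \<forall>f. blinfun_apply \<Phi> f = blinfun_apply f v)"

definition norm_differentiable :: "'b::real_normed_vector itself \<Rightarrow> bool" where
  "norm_differentiable _ \<longleftrightarrow> (\<forall>v :: 'b. v \<noteq> 0 \<longrightarrow> norm differentiable (at v))"

definition schauder_basis :: "(nat \<Rightarrow> 'b::real_normed_vector) \<Rightarrow> bool" where
  "schauder_basis e \<longleftrightarrow> (\<forall>v. \<exists>!c :: nat \<Rightarrow> real. (\<lambda>n. c n *\<^sub>R e n) sums v)"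

text \<open>
  An unbounded operator is a pair of a domain \<open>D\<close> and a function \<open>A\<close> that matters on \<open>D\<close> only. The
  last conjunct says that the graph of the adjoint is the graph of \<open>A\<close> (equality of domains included).
\<close>

definition self_adjoint_op :: "'h::real_inner set \<Rightarrow> ('h \<Rightarrow> 'h) \<Rightarrow> bool" where
  "self_adjoint_op D A \<longleftrightarrow>
    subspace D \<and> closure D = UNIV \<and>
    (\<forall>u\<in>D. \<forall>v\<in>D. A (u + v) = A u + A v) \<and> (\<forall>a. \<forall>u\<in>D. A (a *\<^sub>R u) = a *\<^sub>R A u) \<and>
    {(v, w). \<forall>u\<in>D. inner (A u) v = inner u w} = {(v, A v) | v. v \<in> D}"

definition positive_op :: "'h::real_inner set \<Rightarrow> ('h \<Rightarrow> 'h) \<Rightarrow> bool" where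
  "positive_op D A \<longleftrightarrow> (\<forall>u\<in>D. u \<noteq> 0 \<longrightarrow> 0 < inner (A u) u)"

text \<open>
  \<open>\<bar>y\<bar>\<^sub>X\<close> is \<open>dist y 0\<close> and \<open>\<bar>y - y'\<bar>\<^sub>X\<close> is \<open>dist y y'\<close>, for a translation invariant metric defining the
  locally convex topology of X: the norm distance if X is Banach, an F-norm distance in general. X has
  to be complete and separable for the lattice configuration space to be Polish.
\<close>

definition locally_convex_space :: "'x::{real_vector, metric_space} itself \<Rightarrow> bool" where
  "locally_convex_space _ \<longleftrightarrow>
    (\<forall>x y z :: 'x. dist (x + z) (y + z) = dist x y) \<and>
    continuous_on UNIV (\<lambda>(a :: real, x :: 'x). a *\<^sub>R x) \<and>
    (\<forall>\<epsilon>>0. \<exists>C :: 'x set. open C \<and> convex C \<and> 0 \<in> C \<and> C \<subseteq> ball 0 \<epsilon>)"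

text \<open>
  The spectrum of \<open>A\<close> is automatically discrete and equal to the set of the \<open>lam n\<close>: the eigenvectors are
  complete and \<open>lam n\<close> tends to infinity by the trace condition.
\<close>

locale single_site =
  fixes iXB :: "'x::{real_vector, polish_space} \<Rightarrow> 'b::banach"
    and iBH :: "'b \<Rightarrow>\<^sub>L 'h::{real_inner, polish_space}"
    and D :: "'h set" and A :: "'h \<Rightarrow> 'h"
    and lam :: "nat \<Rightarrow> real" and \<phi> :: "nat \<Rightarrow> 'x"
  assumes X_locally_convex: "locally_convex_space TYPE('x)"
    and B_reflexive: "reflexive TYPE('b)"
    and B_norm_differentiable: "norm_differentiable TYPE('b)"
    and dual_norm_differentiable: "norm_differentiable TYPE('b \<Rightarrow>\<^sub>L real)"
    and XB_embedding: "linear iXB" "inj iXB" "continuous_on UNIV iXB" "closure (range iXB) = UNIV"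
    and BH_embedding: "inj (blinfun_apply iBH)" "closure (range (blinfun_apply iBH)) = UNIV"
    and HBdual_dense: "closure (range (dual_embed iBH)) = UNIV"
    and A_self_adjoint: "self_adjoint_op D A"
    and A_positive: "positive_op D A"
    and eigenvectors: "\<And>n. iBH (iXB (\<phi> n)) \<in> D"
      "\<And>n. A (iBH (iXB (\<phi> n))) = lam n *\<^sub>R iBH (iXB (\<phi> n))"
    and orthonormal: "\<And>m n. inner (iBH (iXB (\<phi> m))) (iBH (iXB (\<phi> n))) = (if m = n then 1 else 0)"
    and eigenvectors_complete: "closure (span (range (\<lambda>n. iBH (iXB (\<phi> n))))) = UNIV"
    and trace_class: "summable (\<lambda>n. inverse (lam n))"
    and schauder: "schauder_basis (\<lambda>n. iXB (\<phi> n))"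
    and eigenvectors_bounded: "\<exists>\<kappa>. \<forall>n. norm (iXB (\<phi> n)) \<le> \<kappa>"
    and projections_bounded: "\<exists>\<sigma>. \<forall>K v.
      norm (\<Sum>n\<le>K. inner (iBH v) (iBH (iXB (\<phi> n))) *\<^sub>R iXB (\<phi> n)) \<le> \<sigma> * norm v"

definition trace_inv :: "(nat \<Rightarrow> real) \<Rightarrow> real" where
  "trace_inv lam = (\<Sum>n. inverse (lam n))"


section \<open>The lattice\<close>

locale weight_system =
  fixes \<gamma> :: "'k::{countable, ab_group_add} \<Rightarrow> real"
  assumes weight_ge_1: "\<And>k. 1 \<le> \<gamma> k"
    and weight_summable: "(\<lambda>k. inverse (\<gamma> k)) summable_on UNIV"
    and weight_sum: "(\<Sum>\<^sub>\<infinity>k. inverse (\<gamma> k)) \<le> 1"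
    and weight_sym: "\<And>k j. \<gamma> (k - j) = \<gamma> (j - k)"
    and weight_mult: "\<And>k j. \<gamma> (k - j) \<le> \<gamma> k * \<gamma> j"

definition config :: "('x \<Rightarrow> 'b::real_normed_vector) \<Rightarrow> ('k \<Rightarrow> real) \<Rightarrow> ('k \<Rightarrow> 'x) set" where
  "config iXB \<gamma> = {x. (\<lambda>k. inverse (\<gamma> k) * (norm (iXB (x k)))\<^sup>2) summable_on UNIV}"

definition config_dist ::
    "('x::metric_space \<Rightarrow> 'b::real_normed_vector) \<Rightarrow> ('k \<Rightarrow> real) \<Rightarrow> ('k \<Rightarrow> 'x) \<Rightarrow> ('k \<Rightarrow> 'x) \<Rightarrow> real" where
  "config_dist iXB \<gamma> x x' = sqrt (\<Sum>\<^sub>\<infinity>k. inverse (\<gamma> k) *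
     ((norm (iXB (x k) - iXB (x' k)))\<^sup>2 + (dist (x k) (x' k))\<^sup>2 / (1 + (dist (x k) (x' k))\<^sup>2)))"

definition config_topology ::
    "('x::metric_space \<Rightarrow> 'b::real_normed_vector) \<Rightarrow> ('k \<Rightarrow> real) \<Rightarrow> ('k \<Rightarrow> 'x) topology" where
  "config_topology iXB \<gamma> = Metric_space.mtopology (config iXB \<gamma>) (config_dist iXB \<gamma>)"

definition basis_dir :: "(nat \<Rightarrow> 'x::zero) \<Rightarrow> 'k \<Rightarrow> nat \<Rightarrow> ('k \<Rightarrow> 'x)" where
  "basis_dir \<phi> k n = (\<lambda>j. if k = j then \<phi> n else 0)"

definition site_line :: "'x::real_vector \<Rightarrow> 'x \<Rightarrow> real \<Rightarrow> 'x" where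
  "site_line v y t = y + t *\<^sub>R v"

definition config_line :: "('k \<Rightarrow> 'x::real_vector) \<Rightarrow> ('k \<Rightarrow> 'x) \<Rightarrow> real \<Rightarrow> ('k \<Rightarrow> 'x)" where
  "config_line h x t = (\<lambda>j. x j + t *\<^sub>R h j)"

text \<open>
  \<open>line x t\<close> is the point \<open>x + t h\<close>, with \<open>line = site_line v\<close> on X and \<open>line = config_line h\<close> on
  the configuration space.
\<close>

definition partial_deriv :: "('s \<Rightarrow> real \<Rightarrow> 's) \<Rightarrow> ('s \<Rightarrow> 'e::real_normed_vector) \<Rightarrow> 's \<Rightarrow> 'e" where
  "partial_deriv line f x = vector_derivative (\<lambda>t. f (line x t)) (at 0)"

definition has_partial_on :: "'s set \<Rightarrow> ('s \<Rightarrow> real \<Rightarrow> 's) \<Rightarrow> ('s \<Rightarrow> 'e::real_normed_vector) \<Rightarrow> bool" where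
  "has_partial_on S line f \<longleftrightarrow> (\<forall>x\<in>S. (\<lambda>t. f (line x t)) differentiable (at 0))"

definition cont_loc_bounded :: "'s topology \<Rightarrow> ('s \<Rightarrow> 'e::real_normed_vector) \<Rightarrow> bool" where
  "cont_loc_bounded T f \<longleftrightarrow> continuous_map T euclidean f \<and>
    (\<forall>x\<in>topspace T. \<exists>U. openin T U \<and> x \<in> U \<and> bounded (f ` U))"


section \<open>Logarithmic gradient and symmetrizing measures\<close>

locale log_gradient = single_site iXB iBH D A lam \<phi> + weight_system \<gamma>
  for iXB :: "'x::{real_vector, polish_space} \<Rightarrow> 'b::banach"
    and iBH :: "'b \<Rightarrow>\<^sub>L 'h::{real_inner, polish_space}"
    and D :: "'h set" and A :: "'h \<Rightarrow> 'h"
    and lam :: "nat \<Rightarrow> real" and \<phi> :: "nat \<Rightarrow> 'x"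
    and \<gamma> :: "'k::{countable, ab_group_add} \<Rightarrow> real" +
  fixes F0 :: "'k \<Rightarrow> 'x \<Rightarrow> ('b \<Rightarrow>\<^sub>L real)"
    and G :: "'k \<Rightarrow> ('k \<Rightarrow> 'x) \<Rightarrow> ('b \<Rightarrow>\<^sub>L real)"
  assumes F0_regular: "\<And>k. cont_loc_bounded euclidean (F0 k)"
    and F0_partial: "\<And>k n. has_partial_on UNIV (site_line (\<phi> n)) (F0 k)"
    and F0_partial_regular:
      "\<And>k n. cont_loc_bounded euclidean (partial_deriv (site_line (\<phi> n)) (F0 k))"
    and G_regular: "\<And>k. cont_loc_bounded (config_topology iXB \<gamma>) (G k)"
    and G_partial: "\<And>k n. has_partial_on (config iXB \<gamma>) (config_line (basis_dir \<phi> k n)) (G k)"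
    and G_partial_regular: "\<And>k n. cont_loc_bounded (config_topology iXB \<gamma>)
      (partial_deriv (config_line (basis_dir \<phi> k n)) (G k))"

definition full_drift ::
    "('k \<Rightarrow> 'x \<Rightarrow> ('b::banach \<Rightarrow>\<^sub>L real)) \<Rightarrow> ('k \<Rightarrow> ('k \<Rightarrow> 'x) \<Rightarrow> ('b \<Rightarrow>\<^sub>L real)) \<Rightarrow>
     'k \<Rightarrow> ('k \<Rightarrow> 'x) \<Rightarrow> ('b \<Rightarrow>\<^sub>L real)" where
  "full_drift F0 G k x = F0 k (x k) + G k x"

definition log_grad ::
    "('x \<Rightarrow> 'b::banach) \<Rightarrow> ('b \<Rightarrow>\<^sub>L 'h::real_inner) \<Rightarrow> ('h \<Rightarrow> 'h) \<Rightarrow> (nat \<Rightarrow> 'x) \<Rightarrow>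
     ('k \<Rightarrow> ('k \<Rightarrow> 'x) \<Rightarrow> ('b \<Rightarrow>\<^sub>L real)) \<Rightarrow> 'k \<Rightarrow> nat \<Rightarrow> ('k \<Rightarrow> 'x) \<Rightarrow> real" where
  "log_grad iXB iBH A \<phi> F k n x =
     - inner (A (iBH (iXB (\<phi> n)))) (iBH (iXB (x k))) - F k x (iXB (\<phi> n))"

definition C1b ::
    "('x::{real_vector, metric_space} \<Rightarrow> 'b::real_normed_vector) \<Rightarrow> ('k \<Rightarrow> real) \<Rightarrow> ('k \<Rightarrow> 'x) \<Rightarrow>
     (('k \<Rightarrow> 'x) \<Rightarrow> real) set" where
  "C1b iXB \<gamma> h = {f.
     continuous_map (config_topology iXB \<gamma>) euclidean f \<and> bounded (f ` config iXB \<gamma>) \<and>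
     has_partial_on (config iXB \<gamma>) (config_line h) f \<and>
     continuous_map (config_topology iXB \<gamma>) euclidean (partial_deriv (config_line h) f) \<and>
     bounded (partial_deriv (config_line h) f ` config iXB \<gamma>)}"

definition borel_prob ::
    "('x::metric_space \<Rightarrow> 'b::real_normed_vector) \<Rightarrow> ('k \<Rightarrow> real) \<Rightarrow> ('k \<Rightarrow> 'x) measure \<Rightarrow> bool" where
  "borel_prob iXB \<gamma> \<mu> \<longleftrightarrow> space \<mu> = config iXB \<gamma> \<and>
     sets \<mu> = sigma_sets (config iXB \<gamma>) {U. openin (config_topology iXB \<gamma>) U} \<and>
     emeasure \<mu> (config iXB \<gamma>) = 1"

definition symmetrizing_measures ::
    "('x::{real_vector, metric_space} \<Rightarrow> 'b::banach) \<Rightarrow> ('b \<Rightarrow>\<^sub>L 'h::real_inner) \<Rightarrow> ('h \<Rightarrow> 'h) \<Rightarrow>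
     (nat \<Rightarrow> 'x) \<Rightarrow> ('k \<Rightarrow> real) \<Rightarrow> ('k \<Rightarrow> ('k \<Rightarrow> 'x) \<Rightarrow> ('b \<Rightarrow>\<^sub>L real)) \<Rightarrow> ('k \<Rightarrow> 'x) measure set" where
  "symmetrizing_measures iXB iBH A \<phi> \<gamma> F = {\<mu>. borel_prob iXB \<gamma> \<mu> \<and>
     (\<forall>k n. \<forall>f \<in> C1b iXB \<gamma> (basis_dir \<phi> k n).
        bdd_above ((\<lambda>x. \<bar>f x\<bar> * (1 + norm (dual_embed iBH (iBH (iXB (x k)))) + norm (F k x)))
          ` config iXB \<gamma>) \<longrightarrow>
        (\<integral>x. partial_deriv (config_line (basis_dir \<phi> k n)) f x \<partial>\<mu>) =
          - (\<integral>x. f x * log_grad iXB iBH A \<phi> F k n x \<partial>\<mu>))}"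

definition coercivity ::
    "('x \<Rightarrow> 'b::banach) \<Rightarrow> ('k \<Rightarrow> 'x \<Rightarrow> ('b \<Rightarrow>\<^sub>L real)) \<Rightarrow> 'k \<Rightarrow> 'x \<Rightarrow> real" where
  "coercivity iXB F0 k y = F0 k y (iXB y)"

definition interaction_norm :: "('k::group_add \<Rightarrow> real) \<Rightarrow> real \<Rightarrow> ('k \<Rightarrow> 'k \<Rightarrow> real) \<Rightarrow> real" where
  "interaction_norm \<gamma> R J = (SUP k. \<Sum>\<^sub>\<infinity>j. J k j * \<gamma> (k - j) powr R)"

text \<open>
  Without this condition \<open>interaction_norm\<close> is a junk value, as are divergent real sums and suprema
  of unbounded sets in general.
\<close>

definition interaction_norm_finite :: "('k::group_add \<Rightarrow> real) \<Rightarrow> real \<Rightarrow> ('k \<Rightarrow> 'k \<Rightarrow> real) \<Rightarrow> bool" where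
  "interaction_norm_finite \<gamma> R J \<longleftrightarrow>
     (\<forall>k. (\<lambda>j. J k j * \<gamma> (k - j) powr R) summable_on UNIV) \<and>
     bdd_above (range (\<lambda>k. \<Sum>\<^sub>\<infinity>j. J k j * \<gamma> (k - j) powr R))"

text \<open>
  The real sum below converges on the configuration space if \<open>interaction_norm_finite \<gamma> R J\<close>: there
  \<open>\<bar>x\<^sub>j\<bar>\<^sub>B\<close> is at most a constant times \<open>\<gamma>\<^sub>j\<close> to the power 1/2, and \<open>\<gamma>\<^sub>j\<close> is at most the product of
  \<open>\<gamma>\<^sub>k\<close> and \<open>\<gamma>\<close> at \<open>k - j\<close>.
\<close>

definition interaction_sum ::
    "('x \<Rightarrow> 'b::real_normed_vector) \<Rightarrow> real \<Rightarrow> ('k \<Rightarrow> 'k \<Rightarrow> real) \<Rightarrow> 'k \<Rightarrow> ('k \<Rightarrow> 'x) \<Rightarrow> real" where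
  "interaction_sum iXB R J k x = (\<Sum>\<^sub>\<infinity>j. J k j * norm (iXB (x j)) powr R)"

end

theory Submission
  imports Defs
begin

text \<open>
  Test the integration by parts formula with \<open>(F\<^sub>k, \<phi>\<^sub>n) \<Psi> / \<lambda>\<^sub>n\<close>, where \<open>\<Psi>\<close> is a bounded weight with
  \<open>\<bar>\<partial>\<^sub>n \<Psi>\<bar> \<le> C \<Psi>\<close>, and sum over \<open>n\<close>. The term \<open>(F\<^sub>k, \<phi>\<^sub>n)\<^sup>2 \<Psi> / \<lambda>\<^sub>n\<close> produced by the logarithmic gradient
  absorbs everything in which \<open>\<Psi>\<close> is differentiated, so that
  \<open>(1 - K1 Tr) \<integral> L\<^sub>k \<Psi> \<le> (M2 + M1 Tr) \<integral> S\<^sub>k \<Psi> + const \<integral> \<Psi>\<close> with a constant that depends on \<open>C\<close> only.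
  Take for \<open>\<Psi>\<close> the power \<open>\<ell>\<^sub>k\<^sup>m\<close> of \<open>\<ell>\<^sub>k = L\<^sub>k + const \<ge> 1\<close>, divided by a high power of
  \<open>1 + \<epsilon> \<parallel>x\<parallel>\<^sup>2 + \<delta> (\<bar>F\<^sub>k\<^sup>0\<bar>\<^sup>2 + \<ell>\<^sub>k\<^sup>2)\<close>; its logarithmic derivatives are bounded uniformly in \<open>\<epsilon>\<close>, \<open>\<delta>\<close>, \<open>k\<close>.
  After \<open>\<delta> \<rightarrow> 0\<close> the weight no longer depends on the site \<open>k\<close>, apart from \<open>\<ell>\<^sub>k\<^sup>m\<close>, and
  the inequalities for different sites can be combined: for a fixed site \<open>a\<close>, by
  \<open>\<bar>x\<^sub>j\<bar>\<^sup>R \<le> K3 \<ell>\<^sub>j\<close> and Young's inequality, the supremum over \<open>k\<close> of the moments of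
  \<open>\<gamma> (k - a) powr (- R) * \<ell>\<^sub>k\<close>, which is finite for fixed \<open>\<epsilon>\<close>, is at most \<open>\<Theta>\<^sub>0 < 1\<close> times itself plus lower
  order terms. Finally \<open>\<epsilon> \<rightarrow> 0\<close>.
\<close>

section \<open>The squared norm\<close>

text \<open>Two obstacles shape the proof. A test function has to stay bounded after multiplication
  with the drift, but no hypothesis bounds \<open>F0\<close> from above by the norm of the
  configuration. Hence the second cutoff \<open>\<delta>\<close>, made of the drift itself; it
  depends on the site and has to disappear before sites are compared. The second obstacle is that a
  term can be absorbed only if it is known to be finite. Under the \<open>\<epsilon>\<close> cutoff
  alone, the interaction at site \<open>k\<close> is bounded merely by a multiple of
  \<open>\<gamma> k powr R\<close>, so that an unweighted supremum over the sites might be infinite.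
  The weight centred at a fixed site compensates this growth, and by submultiplicativity of
  \<open>\<gamma>\<close> it costs a factor \<open>\<gamma> (k - j) powr R\<close> per interaction,
  which is the factor built into the norm of \<open>J\<close>. The square of the drift component has
  a favourable sign because the logarithmic gradient contains minus the drift. Thanks to this square
  the constant C enters lower order terms only, and the leading coefficients are the same for every
  power m. Differentiability of the norms is what makes cutoffs built from squared norms
  admissible.\<close>

definition sqnorm_deriv :: "'e::real_normed_vector \<Rightarrow> 'e \<Rightarrow> real" where
  "sqnorm_deriv v = frechet_derivative (\<lambda>v. (norm v)\<^sup>2) (at v)"

text \<open>The hypothesis excludes the origin. There the square has derivative zero, being of
  second order in the increment; elsewhere it is a power of a differentiable function.\<close>

lemma sqnorm_has_derivative:
  fixes v :: "'e::real_normed_vector"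
  assumes "norm_differentiable TYPE('e)"
  shows "((\<lambda>v. (norm v)\<^sup>2) has_derivative sqnorm_deriv v) (at v)"
proof -
  have "(\<lambda>v::'e. (norm v)\<^sup>2) differentiable (at v)"
  proof (cases "v = 0")
    case True
    have "((\<lambda>h::'e. norm h) \<longlongrightarrow> 0) (at 0)"
      using tendsto_norm_zero[OF tendsto_ident_at] .
    moreover have "\<forall>\<^sub>F h::'e in at 0. norm h = norm ((norm (0 + h))\<^sup>2 - (norm (0::'e))\<^sup>2 - 0) / norm h"
      by (auto simp: eventually_at_filter power2_eq_square)
    ultimately have "((\<lambda>h::'e. norm ((norm (0 + h))\<^sup>2 - (norm (0::'e))\<^sup>2 - 0) / norm h) \<longlongrightarrow> 0) (at 0)"
      by (rule Lim_transform_eventually)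
    then have "((\<lambda>v::'e. (norm v)\<^sup>2) has_derivative (\<lambda>_. 0)) (at 0)"
      unfolding has_derivative_at by simp
    then show ?thesis
      using True by (auto simp: differentiable_def)
  next
    case False
    then have "norm differentiable (at v)"
      using assms by (simp add: norm_differentiable_def)
    then show ?thesis
      by (rule differentiable_power)
  qed
  then show ?thesis
    by (simp add: sqnorm_deriv_def frechet_derivative_works)
qed

lemma convex_sqnorm_line:
  "convex_on UNIV (\<lambda>t::real. (norm (v + t *\<^sub>R w))\<^sup>2)"
proof (rule convex_onI)
  fix t x y :: real
  assume t: "0 < t" "t < 1"
  have "v + ((1 - t) *\<^sub>R x + t *\<^sub>R y) *\<^sub>R w = (1 - t) *\<^sub>R (v + x *\<^sub>R w) + t *\<^sub>R (v + y *\<^sub>R w)"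
    by (simp add: algebra_simps)
  then have "norm (v + ((1 - t) *\<^sub>R x + t *\<^sub>R y) *\<^sub>R w)
      \<le> (1 - t) * norm (v + x *\<^sub>R w) + t * norm (v + y *\<^sub>R w)"
    using t norm_triangle_ineq[of "(1 - t) *\<^sub>R (v + x *\<^sub>R w)" "t *\<^sub>R (v + y *\<^sub>R w)"] by simp
  then have "(norm (v + ((1 - t) *\<^sub>R x + t *\<^sub>R y) *\<^sub>R w))\<^sup>2
      \<le> ((1 - t) * norm (v + x *\<^sub>R w) + t * norm (v + y *\<^sub>R w))\<^sup>2"
    by (intro power_mono) auto
  also have "\<dots> \<le> (1 - t) * (norm (v + x *\<^sub>R w))\<^sup>2 + t * (norm (v + y *\<^sub>R w))\<^sup>2"
    using convex_onD[OF convex_power2, of t "norm (v + x *\<^sub>R w)" "norm (v + y *\<^sub>R w)"] t by simp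
  finally show "(norm (v + ((1 - t) *\<^sub>R x + t *\<^sub>R y) *\<^sub>R w))\<^sup>2
      \<le> (1 - t) * (norm (v + x *\<^sub>R w))\<^sup>2 + t * (norm (v + y *\<^sub>R w))\<^sup>2" .
qed simp

context
  fixes e_type :: "'e::real_normed_vector itself"
  assumes smooth: "norm_differentiable TYPE('e)"
begin

lemma sqnorm_line_deriv:
  fixes v w :: 'e
  shows "((\<lambda>t. (norm (v + t *\<^sub>R w))\<^sup>2) has_real_derivative sqnorm_deriv v w) (at 0)"
proof -
  have line: "((\<lambda>t::real. v + t *\<^sub>R w) has_derivative (\<lambda>t. t *\<^sub>R w)) (at 0)"
    by (auto intro!: derivative_eq_intros)
  have sq: "((\<lambda>v::'e. (norm v)\<^sup>2) has_derivative sqnorm_deriv v) (at (v + 0 *\<^sub>R w))"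
    using sqnorm_has_derivative[OF smooth, of v] by simp
  have "((\<lambda>t. (norm (v + t *\<^sub>R w))\<^sup>2) has_derivative (\<lambda>t. sqnorm_deriv v (t *\<^sub>R w))) (at 0)"
    using has_derivative_compose[OF line sq] by simp
  moreover have "linear (sqnorm_deriv v)"
    using sqnorm_has_derivative[OF smooth, of v] has_derivative_linear by blast
  then have "(\<lambda>t. sqnorm_deriv v (t *\<^sub>R w)) = (*) (sqnorm_deriv v w)"
    by (simp add: fun_eq_iff linear_cmul)
  ultimately show ?thesis
    by (simp add: has_field_derivative_def)
qed

lemma sqnorm_deriv_minus:
  fixes v w :: 'e
  shows "sqnorm_deriv v (- w) = - sqnorm_deriv v w"
  using sqnorm_has_derivative[OF smooth, of v] has_derivative_linear linear_neg by blast

text \<open>The tangent of a convex function lies below its graph. Only differentiability of the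
  norm is given, so this inequality is the source of both the size and the continuity of the
  derivative.\<close>

lemma sqnorm_deriv_le:
  fixes v w :: 'e
  assumes "0 < t"
  shows "sqnorm_deriv v w \<le> ((norm (v + t *\<^sub>R w))\<^sup>2 - (norm v)\<^sup>2) / t"
  using convex_on_imp_above_tangent[OF convex_sqnorm_line, of 0 t v w "sqnorm_deriv v w"]
    sqnorm_line_deriv[of v w] assms
  by (simp add: field_simps)

text \<open>The triangle inequality bounds the difference quotients for positive t, and t tends to
  0. Oddness in the direction turns the one-sided estimate into a two-sided one.\<close>

lemma abs_sqnorm_deriv_le:
  fixes v w :: 'e
  shows "\<bar>sqnorm_deriv v w\<bar> \<le> 2 * norm v * norm w"
proof -
  have one: "sqnorm_deriv v w \<le> 2 * norm v * norm w" for w :: 'e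
  proof (rule tendsto_lowerbound)
    have "((\<lambda>t. 2 * norm v * norm w + t * (norm w)\<^sup>2) \<longlongrightarrow> 2 * norm v * norm w + 0 * (norm w)\<^sup>2)
        (at_right (0::real))"
      by (intro tendsto_intros)
    then show "((\<lambda>t. 2 * norm v * norm w + t * (norm w)\<^sup>2) \<longlongrightarrow> 2 * norm v * norm w) (at_right (0::real))"
      by simp
    have "sqnorm_deriv v w \<le> 2 * norm v * norm w + t * (norm w)\<^sup>2" if "0 < t" for t
    proof -
      have "(norm (v + t *\<^sub>R w))\<^sup>2 \<le> (norm v + t * norm w)\<^sup>2"
        using norm_triangle_ineq[of v "t *\<^sub>R w"] that by (intro power_mono) auto
      then have "((norm (v + t *\<^sub>R w))\<^sup>2 - (norm v)\<^sup>2) / t \<le> 2 * norm v * norm w + t * (norm w)\<^sup>2"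
        using that by (simp add: field_simps power2_eq_square)
      then show ?thesis
        using sqnorm_deriv_le[OF that, of v w] by linarith
    qed
    then show "\<forall>\<^sub>F t in at_right 0. sqnorm_deriv v w \<le> 2 * norm v * norm w + t * (norm w)\<^sup>2"
      by (simp add: eventually_at_filter)
  qed simp
  show ?thesis
    using one[of w] one[of "- w"] by (simp add: sqnorm_deriv_minus)
qed

text \<open>
  The directional derivative of a convex function is an infimum of difference quotients, hence upper
  semicontinuous; as it is odd in the direction, it is also lower semicontinuous.
\<close>

lemma tendsto_sqnorm_deriv:
  fixes v w :: 'e and F :: "'z filter"
  assumes "(a \<longlongrightarrow> v) F" and "(b \<longlongrightarrow> w) F"
  shows "((\<lambda>x. sqnorm_deriv (a x) (b x)) \<longlongrightarrow> sqnorm_deriv v w) F"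
proof -
  have upper: "\<forall>\<^sub>F x in F. sqnorm_deriv (a x) (b x) < c"
    if ab: "(a \<longlongrightarrow> v) F" "(b \<longlongrightarrow> w) F" and c: "sqnorm_deriv v w < c"
    for a b :: "'z \<Rightarrow> 'e" and v w c
  proof -
    have "((\<lambda>t. ((norm (v + t *\<^sub>R w))\<^sup>2 - (norm v)\<^sup>2) / t) \<longlongrightarrow> sqnorm_deriv v w) (at 0)"
      using sqnorm_line_deriv[of v w] by (simp add: has_field_derivative_iff)
    then have "((\<lambda>t. ((norm (v + t *\<^sub>R w))\<^sup>2 - (norm v)\<^sup>2) / t) \<longlongrightarrow> sqnorm_deriv v w) (at_right 0)"
      by (simp add: filterlim_at_split)
    then have "\<forall>\<^sub>F t in at_right 0. ((norm (v + t *\<^sub>R w))\<^sup>2 - (norm v)\<^sup>2) / t < c \<and> 0 < t"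
      using c by (intro eventually_conj order_tendstoD(2) eventually_at_right_less)
    then obtain t where t: "((norm (v + t *\<^sub>R w))\<^sup>2 - (norm v)\<^sup>2) / t < c" "0 < t"
      using eventually_happens'[OF trivial_limit_at_right_real] by blast
    have "((\<lambda>x. ((norm (a x + t *\<^sub>R b x))\<^sup>2 - (norm (a x))\<^sup>2) / t)
        \<longlongrightarrow> ((norm (v + t *\<^sub>R w))\<^sup>2 - (norm v)\<^sup>2) / t) F"
      using ab t(2) by (intro tendsto_intros) auto
    then have "\<forall>\<^sub>F x in F. ((norm (a x + t *\<^sub>R b x))\<^sup>2 - (norm (a x))\<^sup>2) / t < c"
      using t(1) by (rule order_tendstoD)
    then show ?thesis
      by (rule eventually_mono) (use sqnorm_deriv_le[OF t(2)] in \<open>auto intro: le_less_trans\<close>)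
  qed
  show ?thesis
  proof (rule order_tendstoI)
    fix c assume "c < sqnorm_deriv v w"
    then have "sqnorm_deriv v (- w) < - c"
      by (simp add: sqnorm_deriv_minus)
    from upper[OF assms(1) tendsto_minus[OF assms(2)] this]
    show "\<forall>\<^sub>F x in F. c < sqnorm_deriv (a x) (b x)"
      by (simp add: sqnorm_deriv_minus)
  qed (use upper assms in blast)
qed

end

section \<open>The configuration space is a metric space\<close>

text \<open>Minkowski's inequality, carried over from finite index sets. With a dominated sequence
  \<open>c\<close> in place of \<open>a + b\<close> it serves both for the metric and for the
  Lipschitz estimate of the norm.\<close>

lemma l2_triangle:
  fixes a b c :: "'i \<Rightarrow> real"
  assumes "(\<lambda>i. (a i)\<^sup>2) summable_on UNIV" and "(\<lambda>i. (b i)\<^sup>2) summable_on UNIV"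
    and "\<And>i. 0 \<le> c i" and "\<And>i. c i \<le> a i + b i"
  shows "(\<lambda>i. (c i)\<^sup>2) summable_on UNIV"
    and "sqrt (\<Sum>\<^sub>\<infinity>i. (c i)\<^sup>2) \<le> sqrt (\<Sum>\<^sub>\<infinity>i. (a i)\<^sup>2) + sqrt (\<Sum>\<^sub>\<infinity>i. (b i)\<^sup>2)"
proof -
  let ?r = "sqrt (\<Sum>\<^sub>\<infinity>i. (a i)\<^sup>2) + sqrt (\<Sum>\<^sub>\<infinity>i. (b i)\<^sup>2)"
  have r: "0 \<le> ?r"
    by (simp add: infsum_nonneg)
  have fin: "(\<Sum>i\<in>I. (c i)\<^sup>2) \<le> ?r\<^sup>2" if "finite I" for I
  proof -
    have "L2_set c I \<le> L2_set (\<lambda>i. a i + b i) I"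
      using assms by (intro L2_set_mono) auto
    also have "\<dots> \<le> L2_set a I + L2_set b I"
      by (rule L2_set_triangle_ineq)
    also have "\<dots> \<le> ?r"
      unfolding L2_set_def using assms that
      by (intro add_mono real_sqrt_le_mono finite_sum_le_infsum) auto
    finally have "(L2_set c I)\<^sup>2 \<le> ?r\<^sup>2"
      by (intro power_mono) auto
    then show ?thesis
      by (simp add: L2_set_def sum_nonneg)
  qed
  show summable: "(\<lambda>i. (c i)\<^sup>2) summable_on UNIV"
    using fin by (intro nonneg_bdd_above_summable_on bdd_aboveI2[where M = "?r\<^sup>2"]) auto
  have "(\<Sum>\<^sub>\<infinity>i. (c i)\<^sup>2) \<le> ?r\<^sup>2"
    using summable fin by (intro infsum_le_finite_sums) auto
  then show "sqrt (\<Sum>\<^sub>\<infinity>i. (c i)\<^sup>2) \<le> ?r"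
    using r by (simp add: real_le_lsqrt)
qed

text \<open>The function t / sqrt (1 + t^2) increases while its ratio to t decreases. Its square at
  t = \<open>dist y y'\<close> is the bounded term in the metric.\<close>

lemma bounded_metric_subadditive:
  fixes a b c :: real
  assumes "0 \<le> a" "0 \<le> b" "0 \<le> c" "c \<le> a + b"
  shows "c / sqrt (1 + c\<^sup>2) \<le> a / sqrt (1 + a\<^sup>2) + b / sqrt (1 + b\<^sup>2)"
proof -
  have mono: "x / sqrt (1 + x\<^sup>2) \<le> y / sqrt (1 + y\<^sup>2)" if "0 \<le> x" "x \<le> y" for x y :: real
  proof (rule power2_le_imp_le)
    have "x\<^sup>2 \<le> y\<^sup>2"
      using that by (rule power_mono[rotated])
    moreover have "0 < 1 + x\<^sup>2" "0 < 1 + y\<^sup>2"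
      by (auto simp: add_pos_nonneg)
    ultimately have "x\<^sup>2 / (1 + x\<^sup>2) \<le> y\<^sup>2 / (1 + y\<^sup>2)"
      by (simp add: divide_simps algebra_simps)
    then show "(x / sqrt (1 + x\<^sup>2))\<^sup>2 \<le> (y / sqrt (1 + y\<^sup>2))\<^sup>2"
      by (simp add: power_divide)
    show "0 \<le> y / sqrt (1 + y\<^sup>2)"
      using that by simp
  qed
  have le: "x / sqrt (1 + (a + b)\<^sup>2) \<le> x / sqrt (1 + x\<^sup>2)" if "0 \<le> x" "x \<le> a + b" for x
    using that by (intro divide_left_mono real_sqrt_le_mono add_left_mono power_mono mult_pos_pos)
      (auto simp: add_pos_nonneg)
  have "c / sqrt (1 + c\<^sup>2) \<le> (a + b) / sqrt (1 + (a + b)\<^sup>2)"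
    using assms by (intro mono)
  also have "\<dots> = a / sqrt (1 + (a + b)\<^sup>2) + b / sqrt (1 + (a + b)\<^sup>2)"
    by (rule add_divide_distrib)
  also have "\<dots> \<le> a / sqrt (1 + a\<^sup>2) + b / sqrt (1 + b\<^sup>2)"
    using assms by (intro add_mono le) auto
  finally show ?thesis .
qed

text \<open>With the distances in B and X combined quadratically, \<open>config_dist\<close> becomes
  a weighted l2 norm of site distances. Its triangle inequality is then Minkowski's inequality, once
  at a site and once over the lattice.\<close>

definition site_dist :: "('x::metric_space \<Rightarrow> 'b::real_normed_vector) \<Rightarrow> 'x \<Rightarrow> 'x \<Rightarrow> real" where
  "site_dist iXB y y' = sqrt ((norm (iXB y - iXB y'))\<^sup>2 + (dist y y')\<^sup>2 / (1 + (dist y y')\<^sup>2))"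

lemma site_dist_sq:
  "(site_dist iXB y y')\<^sup>2 = (norm (iXB y - iXB y'))\<^sup>2 + (dist y y')\<^sup>2 / (1 + (dist y y')\<^sup>2)"
  by (simp add: site_dist_def)

lemma site_dist_nonneg: "0 \<le> site_dist iXB y y'"
  by (simp add: site_dist_def)

lemma site_dist_triangle: "site_dist iXB y z \<le> site_dist iXB y u + site_dist iXB u z"
proof -
  let ?\<rho> = "\<lambda>y z. dist y z / sqrt (1 + (dist y z)\<^sup>2)"
  have eq: "site_dist iXB y z = sqrt ((norm (iXB y - iXB z))\<^sup>2 + (?\<rho> y z)\<^sup>2)" for y z
    by (simp add: site_dist_def power_divide)
  have "norm (iXB y - iXB z) \<le> norm (iXB y - iXB u) + norm (iXB u - iXB z)"
    using norm_triangle_ineq[of "iXB y - iXB u" "iXB u - iXB z"] by simp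
  moreover have "?\<rho> y z \<le> ?\<rho> y u + ?\<rho> u z"
    by (intro bounded_metric_subadditive dist_triangle) auto
  ultimately have "site_dist iXB y z
      \<le> sqrt ((norm (iXB y - iXB u) + norm (iXB u - iXB z))\<^sup>2 + (?\<rho> y u + ?\<rho> u z)\<^sup>2)"
    unfolding eq by (intro real_sqrt_le_mono add_mono power_mono) auto
  also have "\<dots> \<le> site_dist iXB y u + site_dist iXB u z"
    unfolding eq by (rule real_sqrt_sum_squares_triangle_ineq)
  finally show ?thesis .
qed

context weight_system
begin

lemma weight_pos: "0 < \<gamma> k"
  using weight_ge_1[of k] by linarith

lemma config_dist_eq:
  "config_dist iXB \<gamma> x y = sqrt (\<Sum>\<^sub>\<infinity>k. (sqrt (inverse (\<gamma> k)) * site_dist iXB (x k) (y k))\<^sup>2)"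
  using weight_pos by (simp add: config_dist_def power_mult_distrib site_dist_sq less_imp_le)

lemma config_dist_summable:
  assumes "x \<in> config iXB \<gamma>" "y \<in> config iXB \<gamma>"
  shows "(\<lambda>k. (sqrt (inverse (\<gamma> k)) * site_dist iXB (x k) (y k))\<^sup>2) summable_on UNIV"
proof (rule summable_on_comparison_test)
  show "(\<lambda>k. 2 * (inverse (\<gamma> k) * (norm (iXB (x k)))\<^sup>2) + 2 * (inverse (\<gamma> k) * (norm (iXB (y k)))\<^sup>2)
      + inverse (\<gamma> k)) summable_on UNIV"
    using assms weight_summable
    by (auto simp: config_def intro!: summable_on_add summable_on_cmult_right)
  fix k
  have "(norm (iXB (x k) - iXB (y k)))\<^sup>2 \<le> (norm (iXB (x k)) + norm (iXB (y k)))\<^sup>2"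
    by (intro power_mono norm_triangle_ineq4) auto
  also have "\<dots> \<le> 2 * (norm (iXB (x k)))\<^sup>2 + 2 * (norm (iXB (y k)))\<^sup>2"
    by (smt (verit) sum_squares_bound power2_sum)
  finally have "(site_dist iXB (x k) (y k))\<^sup>2
      \<le> 2 * (norm (iXB (x k)))\<^sup>2 + 2 * (norm (iXB (y k)))\<^sup>2 + 1"
    unfolding site_dist_sq by (intro add_mono) (auto simp: divide_le_eq add_pos_nonneg)
  from mult_left_mono[OF this, of "inverse (\<gamma> k)"] weight_pos[of k]
  show "(sqrt (inverse (\<gamma> k)) * site_dist iXB (x k) (y k))\<^sup>2
     \<le> 2 * (inverse (\<gamma> k) * (norm (iXB (x k)))\<^sup>2) + 2 * (inverse (\<gamma> k) * (norm (iXB (y k)))\<^sup>2)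
      + inverse (\<gamma> k)"
    by (simp add: power_mult_distrib algebra_simps)
qed simp

lemma config_dist_ge:
  assumes "x \<in> config iXB \<gamma>" "y \<in> config iXB \<gamma>"
  shows "sqrt (inverse (\<gamma> k)) * site_dist iXB (x k) (y k) \<le> config_dist iXB \<gamma> x y"
  unfolding config_dist_eq
  using finite_sum_le_infsum[OF config_dist_summable[OF assms], of "{k}"]
  by (intro real_le_rsqrt) auto

lemma config_metric_space: "Metric_space (config iXB \<gamma>) (config_dist iXB \<gamma>)"
proof
  fix x y z
  show "0 \<le> config_dist iXB \<gamma> x y"
    unfolding config_dist_eq by (simp add: infsum_nonneg)
  show "config_dist iXB \<gamma> x y = config_dist iXB \<gamma> y x"
    by (simp add: config_dist_def dist_commute norm_minus_commute)
  show "config_dist iXB \<gamma> x y = 0 \<longleftrightarrow> x = y" if xy: "x \<in> config iXB \<gamma>" "y \<in> config iXB \<gamma>"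
  proof
    assume zero: "config_dist iXB \<gamma> x y = 0"
    have "site_dist iXB (x k) (y k) = 0" for k
      using config_dist_ge[OF xy, of k] zero weight_pos[of k] site_dist_nonneg[of iXB "x k" "y k"]
      by (simp add: mult_le_0_iff)
    then have "(site_dist iXB (x k) (y k))\<^sup>2 = 0" for k
      by simp
    then have "dist (x k) (y k) = 0" for k
      unfolding site_dist_sq
      by (metis add_nonneg_eq_0_iff add_nonneg_nonneg divide_eq_0_iff divide_nonneg_nonneg power_eq_0_iff
          zero_le_power2 zero_le_one zero_neq_one)
    then show "x = y"
      by auto
  qed (simp add: config_dist_def)
  show "config_dist iXB \<gamma> x z \<le> config_dist iXB \<gamma> x y + config_dist iXB \<gamma> y z"
    if "x \<in> config iXB \<gamma>" "y \<in> config iXB \<gamma>" "z \<in> config iXB \<gamma>"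
    unfolding config_dist_eq
  proof (rule l2_triangle(2)[OF config_dist_summable config_dist_summable])
    fix k
    show "sqrt (inverse (\<gamma> k)) * site_dist iXB (x k) (z k)
      \<le> sqrt (inverse (\<gamma> k)) * site_dist iXB (x k) (y k) + sqrt (inverse (\<gamma> k)) * site_dist iXB (y k) (z k)"
      using mult_left_mono[OF site_dist_triangle, of "sqrt (inverse (\<gamma> k))"] weight_pos[of k]
      by (simp add: distrib_left less_imp_le)
  qed (use that weight_pos in \<open>auto simp: less_imp_le site_dist_nonneg\<close>)
qed

lemma topspace_config [simp]: "topspace (config_topology iXB \<gamma>) = config iXB \<gamma>"
  unfolding config_topology_def
  by (rule Metric_space.topspace_mtopology[OF config_metric_space])

lemma continuous_map_configI:
  fixes f :: "_ \<Rightarrow> 'e::metric_space"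
  assumes "\<And>x e. x \<in> config iXB \<gamma> \<Longrightarrow> 0 < e \<Longrightarrow>
    \<exists>r>0. \<forall>y\<in>config iXB \<gamma>. config_dist iXB \<gamma> x y < r \<longrightarrow> dist (f x) (f y) < e"
  shows "continuous_map (config_topology iXB \<gamma>) euclidean f"
proof -
  interpret M: Metric_space "config iXB \<gamma>" "config_dist iXB \<gamma>"
    by (rule config_metric_space)
  show ?thesis
    unfolding continuous_map_def
  proof (intro conjI allI impI)
    fix U :: "'e set" assume "openin euclidean U"
    then have U: "open U" by simp
    show "openin (config_topology iXB \<gamma>) {x \<in> topspace (config_topology iXB \<gamma>). f x \<in> U}"
      unfolding topspace_config unfolding config_topology_def M.openin_mtopology
    proof (intro conjI allI impI)
      fix x assume x: "x \<in> {x \<in> config iXB \<gamma>. f x \<in> U}"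
      with U obtain e where e: "0 < e" "ball (f x) e \<subseteq> U"
        by (auto simp: open_contains_ball)
      with assms[of x e] x obtain r where
        "0 < r" "\<forall>y\<in>config iXB \<gamma>. config_dist iXB \<gamma> x y < r \<longrightarrow> dist (f x) (f y) < e"
        by auto
      with e show "\<exists>r>0. M.mball x r \<subseteq> {x \<in> config iXB \<gamma>. f x \<in> U}"
        by (intro exI[of _ r]) auto
    qed auto
  qed auto
qed

lemma continuous_map_site: "continuous_map (config_topology iXB \<gamma>) euclidean (\<lambda>x. x k)"
proof (rule continuous_map_configI)
  fix x and e :: real
  assume x: "x \<in> config iXB \<gamma>" and e: "0 < e"
  \<comment> \<open>Points at distance at least e in X have at least this weighted site distance,
    since t^2 / (1 + t^2) increases with t.\<close>
  define r where "r = sqrt (inverse (\<gamma> k)) * sqrt (e\<^sup>2 / (1 + e\<^sup>2))"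
  have "0 < 1 + e\<^sup>2"
    by (simp add: add_pos_nonneg)
  then have "0 < r"
    using e weight_pos[of k] by (simp add: r_def)
  moreover have "dist (x k) (y k) < e" if y: "y \<in> config iXB \<gamma>" and lt: "config_dist iXB \<gamma> x y < r" for y
  proof (rule ccontr)
    assume "\<not> dist (x k) (y k) < e"
    then have "e\<^sup>2 \<le> (dist (x k) (y k))\<^sup>2"
      using e by (intro power_mono) auto
    then have "e\<^sup>2 / (1 + e\<^sup>2) \<le> (dist (x k) (y k))\<^sup>2 / (1 + (dist (x k) (y k))\<^sup>2)"
      using \<open>0 < 1 + e\<^sup>2\<close> by (simp add: divide_simps algebra_simps add_pos_nonneg not_less_iff_gr_or_eq)
    also have "\<dots> \<le> (site_dist iXB (x k) (y k))\<^sup>2"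
      by (simp add: site_dist_sq)
    finally have "sqrt (e\<^sup>2 / (1 + e\<^sup>2)) \<le> site_dist iXB (x k) (y k)"
      by (intro real_le_lsqrt) (auto simp: site_dist_nonneg)
    then have "r \<le> sqrt (inverse (\<gamma> k)) * site_dist iXB (x k) (y k)"
      unfolding r_def using weight_pos[of k] by (intro mult_left_mono) auto
    with config_dist_ge[OF x y, of k] lt show False
      by linarith
  qed
  ultimately show "\<exists>r>0. \<forall>y\<in>config iXB \<gamma>. config_dist iXB \<gamma> x y < r \<longrightarrow> dist (x k) (y k) < e"
    by auto
qed

section \<open>The squared norm of a configuration\<close>

definition energy :: "('x \<Rightarrow> 'b::real_normed_vector) \<Rightarrow> ('k \<Rightarrow> 'x) \<Rightarrow> real" where
  "energy iXB x = (\<Sum>\<^sub>\<infinity>k. inverse (\<gamma> k) * (norm (iXB (x k)))\<^sup>2)"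

lemma energy_nonneg: "0 \<le> energy iXB x"
  using weight_pos by (auto simp: energy_def less_imp_le intro!: infsum_nonneg)

text \<open>The metric dominates the weighted distance in B, so the norm is 1-Lipschitz. This makes
  the cutoffs continuous.\<close>

lemma sqrt_energy_le:
  assumes "x \<in> config iXB \<gamma>" "y \<in> config iXB \<gamma>"
  shows "sqrt (energy iXB x) \<le> config_dist iXB \<gamma> x y + sqrt (energy iXB y)"
proof -
  have eq: "energy iXB x = (\<Sum>\<^sub>\<infinity>k. (sqrt (inverse (\<gamma> k)) * norm (iXB (x k)))\<^sup>2)" for x
    using weight_pos by (simp add: energy_def power_mult_distrib less_imp_le)
  show ?thesis
    unfolding eq config_dist_eq
  proof (rule l2_triangle(2)[OF config_dist_summable])
    show "(\<lambda>k. (sqrt (inverse (\<gamma> k)) * norm (iXB (y k)))\<^sup>2) summable_on UNIV"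
      using assms weight_pos by (simp add: config_def power_mult_distrib less_imp_le)
    fix k
    have "norm (iXB (x k) - iXB (y k)) \<le> site_dist iXB (x k) (y k)"
      by (simp add: site_dist_def real_le_rsqrt)
    then have "norm (iXB (x k)) \<le> site_dist iXB (x k) (y k) + norm (iXB (y k))"
      using norm_triangle_sub[of "iXB (x k)" "iXB (y k)"] by linarith
    from mult_left_mono[OF this, of "sqrt (inverse (\<gamma> k))"]
    show "sqrt (inverse (\<gamma> k)) * norm (iXB (x k))
        \<le> sqrt (inverse (\<gamma> k)) * site_dist iXB (x k) (y k) + sqrt (inverse (\<gamma> k)) * norm (iXB (y k))"
      using weight_pos[of k] by (simp add: distrib_left less_imp_le)
  qed (use assms weight_pos in \<open>auto simp: less_imp_le\<close>)
qed

lemma continuous_map_energy: "continuous_map (config_topology iXB \<gamma>) euclidean (energy iXB)"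
proof -
  interpret M: Metric_space "config iXB \<gamma>" "config_dist iXB \<gamma>"
    by (rule config_metric_space)
  have "continuous_map (config_topology iXB \<gamma>) euclidean (\<lambda>x. sqrt (energy iXB x))"
  proof (rule continuous_map_configI)
    fix x and e :: real
    assume x: "x \<in> config iXB \<gamma>" "0 < e"
    have "dist (sqrt (energy iXB x)) (sqrt (energy iXB y)) < e"
      if "y \<in> config iXB \<gamma>" "config_dist iXB \<gamma> x y < e" for y
      using sqrt_energy_le[OF x(1) that(1)] sqrt_energy_le[OF that(1) x(1)] that(2)
      by (simp add: dist_real_def M.commute[of y x] abs_less_iff)
    with x(2) show "\<exists>r>0. \<forall>y\<in>config iXB \<gamma>. config_dist iXB \<gamma> x y < r \<longrightarrow>
        dist (sqrt (energy iXB x)) (sqrt (energy iXB y)) < e"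
      by auto
  qed
  from continuous_map_real_pow[OF this, of 2] show ?thesis
    by (simp add: energy_nonneg)
qed

end

section \<open>Functions that are smooth along a coordinate direction\<close>

lemma (in weight_system) continuous_map_borel_measurable:
  fixes f :: "('k \<Rightarrow> 'x::metric_space) \<Rightarrow> real"
  assumes "borel_prob iXB \<gamma> \<mu>" "continuous_map (config_topology iXB \<gamma>) euclidean f"
  shows "f \<in> borel_measurable \<mu>"
proof (rule borel_measurableI)
  fix S :: "real set" assume "open S"
  then have "openin (config_topology iXB \<gamma>) {x \<in> config iXB \<gamma>. f x \<in> S}"
    using assms(2) by (auto simp: continuous_map_def)
  moreover have "f -` S \<inter> space \<mu> = {x \<in> config iXB \<gamma>. f x \<in> S}"
    using assms(1) by (auto simp: borel_prob_def)
  ultimately show "f -` S \<inter> space \<mu> \<in> sets \<mu>"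
    using assms(1) by (auto simp: borel_prob_def intro: sigma_sets.Basic)
qed

context log_gradient
begin

abbreviation "configs \<equiv> config iXB \<gamma>"
abbreviation "ctop \<equiv> config_topology iXB \<gamma>"
abbreviation "line k n \<equiv> config_line (basis_dir \<phi> k n)"
abbreviation "dF0 k n \<equiv> partial_deriv (site_line (\<phi> n)) (F0 k)"
abbreviation "dG k n \<equiv> partial_deriv (line k n) (G k)"

lemma iXB_line: "iXB (y + t *\<^sub>R v) = iXB y + t *\<^sub>R iXB v"
  using XB_embedding(1) by (simp add: linear_add linear_cmul)

lemma continuous_map_ctop_iff:
  "continuous_map ctop euclidean f \<longleftrightarrow> (\<forall>x\<in>configs. (f \<longlongrightarrow> f x) (atin ctop x))"
  by (simp add: continuous_map_atin)

lemma line_same [simp]: "line k n x t k = x k + t *\<^sub>R \<phi> n"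
  by (simp add: config_line_def basis_dir_def)

lemma line_other [simp]: "j \<noteq> k \<Longrightarrow> line k n x t j = x j"
  by (simp add: config_line_def basis_dir_def)

lemma line_0 [simp]: "line k n x 0 = x"
  by (simp add: config_line_def)

text \<open>This is \<open>C1b\<close> without boundedness. Unbounded ingredients such as
  \<open>energy\<close> can be combined by the product and quotient rules, and bounds are checked
  only for the finished test function. The derivative is an argument because the later estimates
  need its formula.\<close>

definition smooth_along :: "'k \<Rightarrow> nat \<Rightarrow> (('k \<Rightarrow> 'x) \<Rightarrow> real) \<Rightarrow> (('k \<Rightarrow> 'x) \<Rightarrow> real) \<Rightarrow> bool" where
  "smooth_along k n f f' \<longleftrightarrow> continuous_map ctop euclidean f \<and> continuous_map ctop euclidean f' \<and>
     (\<forall>x\<in>configs. ((\<lambda>t. f (line k n x t)) has_real_derivative f' x) (at 0))"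

lemma smooth_along_const: "smooth_along k n (\<lambda>_. c) (\<lambda>_. 0)"
  by (simp add: smooth_along_def)

lemma smooth_along_add:
  assumes "smooth_along k n f f'" "smooth_along k n g g'"
  shows "smooth_along k n (\<lambda>x. f x + g x) (\<lambda>x. f' x + g' x)"
  using assms unfolding smooth_along_def continuous_map_ctop_iff
  by (auto intro!: tendsto_intros derivative_intros)

lemma smooth_along_mult:
  assumes "smooth_along k n f f'" "smooth_along k n g g'"
  shows "smooth_along k n (\<lambda>x. f x * g x) (\<lambda>x. f' x * g x + f x * g' x)"
  using assms unfolding smooth_along_def continuous_map_ctop_iff
  by (auto intro!: tendsto_intros derivative_eq_intros)

lemma smooth_along_cmult:
  assumes "smooth_along k n f f'"
  shows "smooth_along k n (\<lambda>x. c * f x) (\<lambda>x. c * f' x)"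
  using smooth_along_mult[OF smooth_along_const assms, of c] by simp

lemma smooth_along_power:
  assumes "smooth_along k n f f'"
  shows "smooth_along k n (\<lambda>x. f x ^ m) (\<lambda>x. real m * f x ^ (m - 1) * f' x)"
  using assms unfolding smooth_along_def continuous_map_ctop_iff
  by (auto intro!: tendsto_intros derivative_eq_intros)

lemma smooth_along_inverse:
  assumes "smooth_along k n f f'" and "\<And>x. x \<in> configs \<Longrightarrow> f x \<noteq> 0"
  shows "smooth_along k n (\<lambda>x. inverse (f x)) (\<lambda>x. - (f' x / (f x)\<^sup>2))"
  using assms unfolding smooth_along_def continuous_map_ctop_iff
  by (auto intro!: tendsto_intros derivative_eq_intros simp: power2_eq_square divide_inverse)

lemma continuous_map_site_compose:
  assumes "continuous_map euclidean euclidean g"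
  shows "continuous_map ctop euclidean (\<lambda>x. g (x k))"
  using continuous_map_compose[OF continuous_map_site assms] by (simp add: o_def)

lemma tendsto_F0: "x \<in> configs \<Longrightarrow> ((\<lambda>x. F0 k (x k)) \<longlongrightarrow> F0 k (x k)) (atin ctop x)"
  using F0_regular[of k] continuous_map_site_compose[of "F0 k" k]
  by (simp add: cont_loc_bounded_def continuous_map_ctop_iff)

lemma tendsto_dF0: "x \<in> configs \<Longrightarrow> ((\<lambda>x. dF0 k n (x k)) \<longlongrightarrow> dF0 k n (x k)) (atin ctop x)"
  using F0_partial_regular[of n k] continuous_map_site_compose[of "dF0 k n" k]
  by (simp add: cont_loc_bounded_def continuous_map_ctop_iff)

lemma tendsto_iXB: "x \<in> configs \<Longrightarrow> ((\<lambda>x. iXB (x k)) \<longlongrightarrow> iXB (x k)) (atin ctop x)"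
  using XB_embedding(3) continuous_map_site_compose[of iXB k]
  by (simp add: continuous_map_ctop_iff)

lemma tendsto_G: "x \<in> configs \<Longrightarrow> (G k \<longlongrightarrow> G k x) (atin ctop x)"
  using G_regular[of k] by (simp add: cont_loc_bounded_def continuous_map_ctop_iff)

lemma tendsto_dG: "x \<in> configs \<Longrightarrow> (dG k n \<longlongrightarrow> dG k n x) (atin ctop x)"
  using G_partial_regular[of k n] by (simp add: cont_loc_bounded_def continuous_map_ctop_iff)

lemma F0_line_deriv: "((\<lambda>t. F0 k (y + t *\<^sub>R \<phi> n)) has_vector_derivative dF0 k n y) (at 0)"
  using F0_partial[of n k]
  by (simp add: has_partial_on_def partial_deriv_def site_line_def vector_derivative_works)

lemma G_line_deriv: "x \<in> configs \<Longrightarrow> ((\<lambda>t. G k (line k n x t)) has_vector_derivative dG k n x) (at 0)"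
  using G_partial[of k n]
  by (simp add: has_partial_on_def partial_deriv_def vector_derivative_works)

lemma iXB_line_deriv: "((\<lambda>t. iXB (y + t *\<^sub>R v)) has_vector_derivative iXB v) (at 0)"
  unfolding iXB_line by (auto intro!: derivative_eq_intros)

lemma smooth_along_F0_apply:
  "smooth_along k n (\<lambda>x. F0 k (x k) v) (\<lambda>x. dF0 k n (x k) v)"
  unfolding smooth_along_def continuous_map_ctop_iff
proof (intro conjI ballI)
  fix x assume "x \<in> configs"
  show "((\<lambda>t. F0 k (line k n x t k) v) has_real_derivative dF0 k n (x k) v) (at 0)"
    using bounded_linear.has_vector_derivative[OF blinfun.bounded_linear_left F0_line_deriv]
    by (simp add: has_real_derivative_iff_has_vector_derivative)
qed (auto intro!: tendsto_intros tendsto_F0 tendsto_dF0)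

lemma smooth_along_G_apply:
  "smooth_along k n (\<lambda>x. G k x v) (\<lambda>x. dG k n x v)"
  unfolding smooth_along_def continuous_map_ctop_iff
proof (intro conjI ballI)
  fix x assume "x \<in> configs"
  then show "((\<lambda>t. G k (line k n x t) v) has_real_derivative dG k n x v) (at 0)"
    using bounded_linear.has_vector_derivative[OF blinfun.bounded_linear_left G_line_deriv]
    by (simp add: has_real_derivative_iff_has_vector_derivative)
qed (auto intro!: tendsto_intros tendsto_G tendsto_dG)

text \<open>The product rule for the duality pairing. The two terms are the ones that
  \<open>hL1\<close> and \<open>hL2\<close> will bound by the coercivity functional itself.\<close>

lemma smooth_along_coercivity:
  "smooth_along k n (\<lambda>x. coercivity iXB F0 k (x k))
    (\<lambda>x. F0 k (x k) (iXB (\<phi> n)) + dF0 k n (x k) (iXB (x k)))"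
  unfolding smooth_along_def continuous_map_ctop_iff coercivity_def
proof (intro conjI ballI)
  fix x assume "x \<in> configs"
  show "((\<lambda>t. F0 k (line k n x t k) (iXB (line k n x t k))) has_real_derivative
      F0 k (x k) (iXB (\<phi> n)) + dF0 k n (x k) (iXB (x k))) (at 0)"
    using bounded_bilinear.has_vector_derivative[OF bounded_bilinear_blinfun_apply F0_line_deriv iXB_line_deriv]
    by (simp add: has_real_derivative_iff_has_vector_derivative)
qed (auto intro!: tendsto_intros tendsto_F0 tendsto_dF0 tendsto_iXB)

text \<open>The drift moves along a curve and not along a straight line, so the directional
  derivative of the squared norm would not suffice; the chain rule uses the Frechet
  derivative.\<close>

lemma smooth_along_norm_F0:
  "smooth_along k n (\<lambda>x. (norm (F0 k (x k)))\<^sup>2) (\<lambda>x. sqnorm_deriv (F0 k (x k)) (dF0 k n (x k)))"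
  unfolding smooth_along_def continuous_map_ctop_iff
proof (intro conjI ballI)
  fix x assume "x \<in> configs"
  have "((\<lambda>v. (norm v)\<^sup>2) has_derivative sqnorm_deriv (F0 k (x k)))
      (at (F0 k (x k + 0 *\<^sub>R \<phi> n)) within range (\<lambda>t. F0 k (x k + t *\<^sub>R \<phi> n)))"
    using sqnorm_has_derivative[OF dual_norm_differentiable, of "F0 k (x k)"]
    by (simp add: has_derivative_at_withinI)
  from vector_derivative_diff_chain_within[OF F0_line_deriv this]
  show "((\<lambda>t. (norm (F0 k (line k n x t k)))\<^sup>2) has_real_derivative
      sqnorm_deriv (F0 k (x k)) (dF0 k n (x k))) (at 0)"
    by (simp add: has_real_derivative_iff_has_vector_derivative o_def)
qed (auto intro!: tendsto_intros tendsto_F0 tendsto_dF0 tendsto_sqnorm_deriv dual_norm_differentiable)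

text \<open>Splitting off one site avoids differentiating an infinite series along a coordinate
  line. The rest of the sum is literally unchanged, so membership of \<open>y\<close> in the
  configuration space is a consequence rather than an assumption.\<close>

lemma energy_update:
  assumes "x \<in> configs" and "\<And>j. j \<noteq> k \<Longrightarrow> y j = x j"
  shows "energy iXB y = energy iXB x + inverse (\<gamma> k) * ((norm (iXB (y k)))\<^sup>2 - (norm (iXB (x k)))\<^sup>2)"
proof -
  let ?e = "\<lambda>x j. inverse (\<gamma> j) * (norm (iXB (x j)))\<^sup>2"
  have sx: "?e x summable_on - {k}"
    using assms(1) by (auto simp: config_def intro: summable_on_subset)
  moreover have "?e y summable_on - {k} \<longleftrightarrow> ?e x summable_on - {k}"
    by (rule summable_on_cong) (use assms(2) in auto)
  moreover have "infsum (?e y) (- {k}) = infsum (?e x) (- {k})"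
    by (rule infsum_cong) (use assms(2) in auto)
  moreover have "energy iXB z = ?e z k + infsum (?e z) (- {k})" if "?e z summable_on - {k}" for z
  proof -
    have "infsum (?e z) (insert k (- {k})) = ?e z k + infsum (?e z) (- {k})"
      by (rule infsum_insert[OF that]) simp
    moreover have "insert k (- {k}) = UNIV"
      by auto
    ultimately show ?thesis
      by (simp add: energy_def)
  qed
  ultimately show ?thesis
    by (simp add: algebra_simps)
qed

lemma smooth_along_energy:
  "smooth_along k n (energy iXB) (\<lambda>x. inverse (\<gamma> k) * sqnorm_deriv (iXB (x k)) (iXB (\<phi> n)))"
  unfolding smooth_along_def
proof (intro conjI ballI)
  show "continuous_map ctop euclidean (\<lambda>x. inverse (\<gamma> k) * sqnorm_deriv (iXB (x k)) (iXB (\<phi> n)))"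
    unfolding continuous_map_ctop_iff
    by (auto intro!: tendsto_intros tendsto_iXB tendsto_sqnorm_deriv B_norm_differentiable)
  fix x assume x: "x \<in> configs"
  have "((\<lambda>t. energy iXB x + inverse (\<gamma> k) *
        ((norm (iXB (x k) + t *\<^sub>R iXB (\<phi> n)))\<^sup>2 - (norm (iXB (x k)))\<^sup>2))
      has_real_derivative inverse (\<gamma> k) * sqnorm_deriv (iXB (x k)) (iXB (\<phi> n))) (at 0)"
    using DERIV_add[OF DERIV_const[of "energy iXB x"]
        DERIV_cmult[of _ _ _ _ "inverse (\<gamma> k)", OF DERIV_diff[OF sqnorm_line_deriv[OF B_norm_differentiable]
            DERIV_const[of "(norm (iXB (x k)))\<^sup>2"]]]]
    by simp
  then show "((\<lambda>t. energy iXB (line k n x t)) has_real_derivative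
      inverse (\<gamma> k) * sqnorm_deriv (iXB (x k)) (iXB (\<phi> n))) (at 0)"
    by (subst energy_update[OF x, where k = k]) (auto simp: iXB_line)
qed (rule continuous_map_energy)

section \<open>Integration by parts and expansion in eigenvectors\<close>

text \<open>The class of test functions is defined with the dual norm of the site variable. It is
  dominated by the norm of B, which is the one that the cutoffs control.\<close>

lemma norm_dual_embed_le:
  "norm (dual_embed iBH (iBH v)) \<le> (norm iBH)\<^sup>2 * norm v"
proof -
  have "norm (dual_embed iBH (iBH v)) \<le> norm (iBH v) * norm iBH"
  proof (rule norm_blinfun_bound)
    fix w
    have "norm (dual_embed iBH (iBH v) w) \<le> norm (iBH v) * norm (iBH w)"
      by (simp add: dual_embed_def Cauchy_Schwarz_ineq2)
    also have "\<dots> \<le> norm (iBH v) * (norm iBH * norm w)"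
      by (intro mult_left_mono norm_blinfun) auto
    finally show "norm (dual_embed iBH (iBH v) w) \<le> norm (iBH v) * norm iBH * norm w"
      by (simp add: mult_ac)
  qed auto
  also have "\<dots> \<le> (norm iBH * norm v) * norm iBH"
    by (intro mult_right_mono norm_blinfun) auto
  finally show ?thesis
    by (simp add: power2_eq_square mult_ac)
qed

text \<open>The defining identity with an explicit derivative and with admissibility reduced to two
  pointwise bounds. The second one also bounds \<open>f\<close> itself, because its factor is at
  least 1.\<close>

lemma integration_by_parts:
  assumes "\<mu> \<in> symmetrizing_measures iXB iBH A \<phi> \<gamma> F" and f: "smooth_along k n f f'"
    and bounds: "\<And>x. x \<in> configs \<Longrightarrow> \<bar>f' x\<bar> \<le> c"
      "\<And>x. x \<in> configs \<Longrightarrow> \<bar>f x\<bar> * (1 + norm (iXB (x k)) + norm (F k x)) \<le> c"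
  shows "(\<integral>x. f' x \<partial>\<mu>) = - (\<integral>x. f x * log_grad iXB iBH A \<phi> F k n x \<partial>\<mu>)"
proof -
  have \<mu>: "borel_prob iXB \<gamma> \<mu>"
    using assms(1) by (simp add: symmetrizing_measures_def)
  have deriv: "partial_deriv (line k n) f x = f' x" if "x \<in> configs" for x
    using f that
    by (auto simp: smooth_along_def partial_deriv_def has_real_derivative_iff_has_vector_derivative
        intro!: vector_derivative_at)
  have f_le: "\<bar>f x\<bar> \<le> c" if "x \<in> configs" for x
  proof -
    have "\<bar>f x\<bar> * 1 \<le> \<bar>f x\<bar> * (1 + norm (iXB (x k)) + norm (F k x))"
      by (intro mult_left_mono) auto
    with bounds(2)[OF that] show ?thesis by simp
  qed
  have "f \<in> C1b iXB \<gamma> (basis_dir \<phi> k n)"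
    unfolding C1b_def
  proof (intro CollectI conjI)
    show "has_partial_on configs (line k n) f"
      using f
      by (auto simp: smooth_along_def has_partial_on_def has_field_derivative_def intro: differentiableI)
    show "continuous_map ctop euclidean (partial_deriv (line k n) f)"
      by (rule continuous_map_eq[of _ _ f']) (use f deriv in \<open>auto simp: smooth_along_def\<close>)
    show "bounded (partial_deriv (line k n) f ` configs)"
      unfolding bounded_iff using bounds(1) deriv by (intro exI[of _ c]) auto
    show "bounded (f ` configs)"
      unfolding bounded_iff using f_le by (intro exI[of _ c]) auto
  qed (use f in \<open>auto simp: smooth_along_def\<close>)
  moreover have "bdd_above ((\<lambda>x. \<bar>f x\<bar> * (1 + norm (dual_embed iBH (iBH (iXB (x k)))) + norm (F k x)))
      ` configs)"
  proof (rule bdd_aboveI2)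
    fix x assume x: "x \<in> configs"
    have "1 + norm (dual_embed iBH (iBH (iXB (x k)))) + norm (F k x)
        \<le> (1 + (norm iBH)\<^sup>2) * (1 + norm (iXB (x k)) + norm (F k x))"
      using norm_dual_embed_le[of "iXB (x k)"]
      by (simp add: algebra_simps) (smt (verit) mult_nonneg_nonneg norm_ge_zero zero_le_power2)
    then have "\<bar>f x\<bar> * (1 + norm (dual_embed iBH (iBH (iXB (x k)))) + norm (F k x))
        \<le> \<bar>f x\<bar> * ((1 + (norm iBH)\<^sup>2) * (1 + norm (iXB (x k)) + norm (F k x)))"
      by (intro mult_left_mono) auto
    also have "\<dots> = (1 + (norm iBH)\<^sup>2) * (\<bar>f x\<bar> * (1 + norm (iXB (x k)) + norm (F k x)))"
      by (simp add: mult_ac)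
    also have "\<dots> \<le> (1 + (norm iBH)\<^sup>2) * c"
      using bounds(2)[OF x] by (intro mult_left_mono) auto
    finally show "\<bar>f x\<bar> * (1 + norm (dual_embed iBH (iBH (iXB (x k)))) + norm (F k x))
        \<le> (1 + (norm iBH)\<^sup>2) * c" .
  qed
  ultimately have "(\<integral>x. partial_deriv (line k n) f x \<partial>\<mu>) = - (\<integral>x. f x * log_grad iXB iBH A \<phi> F k n x \<partial>\<mu>)"
    using assms(1) by (simp add: symmetrizing_measures_def)
  moreover have "(\<integral>x. partial_deriv (line k n) f x \<partial>\<mu>) = (\<integral>x. f' x \<partial>\<mu>)"
    using \<mu> deriv by (intro Bochner_Integration.integral_cong) (auto simp: borel_prob_def)
  ultimately show ?thesis
    by simp
qed

lemma lam_pos: "0 < lam n"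
proof -
  let ?e = "iBH (iXB (\<phi> n))"
  have one: "inner ?e ?e = 1"
    using orthonormal[of n n] by simp
  then have "?e \<noteq> 0"
    by auto
  then have "0 < inner (A ?e) ?e"
    using A_positive eigenvectors(1) by (simp add: positive_op_def)
  then show ?thesis
    by (simp add: eigenvectors(2) one)
qed

lemma log_grad_eq:
  "log_grad iXB iBH A \<phi> F k n x =
    - lam n * inner (iBH (iXB (x k))) (iBH (iXB (\<phi> n))) - F k x (iXB (\<phi> n))"
  by (simp add: log_grad_def eigenvectors(2) inner_commute)

text \<open>Pairing a Schauder expansion with an eigenvector in H is continuous on B, so
  orthonormality identifies the coefficients as Fourier coefficients. The point is convergence in B:
  the drift is a functional on B, not on H.\<close>

lemma schauder_partial_sums:
  "(\<lambda>K. \<Sum>n<K. inner (iBH v) (iBH (iXB (\<phi> n))) *\<^sub>R iXB (\<phi> n)) \<longlonglongrightarrow> v"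
proof -
  obtain c where c: "(\<lambda>n. c n *\<^sub>R iXB (\<phi> n)) sums v"
    using schauder unfolding schauder_basis_def by blast
  have "c m = inner (iBH v) (iBH (iXB (\<phi> m)))" for m
  proof -
    have "bounded_linear (\<lambda>v. inner (iBH v) (iBH (iXB (\<phi> m))))"
      by (intro bounded_linear_intros)
    from bounded_linear.sums[OF this c]
    have "(\<lambda>n. c n * (if m = n then 1 else 0)) sums inner (iBH v) (iBH (iXB (\<phi> m)))"
      by (simp add: blinfun.scaleR_right orthonormal eq_commute)
    moreover have "(\<lambda>n. c n * (if m = n then 1 else 0)) sums c m"
      using sums_single[of m c] by (simp add: if_distrib eq_commute cong: if_cong)
    ultimately show ?thesis
      using sums_unique2 by blast
  qed
  with c show ?thesis
    by (simp add: sums_def)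
qed

end

section \<open>The basic moment inequality\<close>

lemma mult_le_sq_add: "a * c \<le> a * a + c\<^sup>2 / 4" for a c :: real
proof -
  have "0 \<le> (a - c / 2) * (a - c / 2)"
    by simp
  also have "\<dots> = a * a - a * c + c\<^sup>2 / 4"
    by (simp add: field_simps power2_eq_square)
  finally show ?thesis
    by simp
qed

locale moment_setting = log_gradient iXB iBH D A lam \<phi> \<gamma> F0 G
  for iXB :: "'x::{real_vector, polish_space} \<Rightarrow> 'b::banach"
    and iBH :: "'b \<Rightarrow>\<^sub>L 'h::{real_inner, polish_space}"
    and D :: "'h set" and A :: "'h \<Rightarrow> 'h"
    and lam :: "nat \<Rightarrow> real" and \<phi> :: "nat \<Rightarrow> 'x"
    and \<gamma> :: "'k::{countable, ab_group_add} \<Rightarrow> real"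
    and F0 :: "'k \<Rightarrow> 'x \<Rightarrow> ('b \<Rightarrow>\<^sub>L real)"
    and G :: "'k \<Rightarrow> ('k \<Rightarrow> 'x) \<Rightarrow> ('b \<Rightarrow>\<^sub>L real)" +
  fixes J :: "'k \<Rightarrow> 'k \<Rightarrow> real"
    and R K0 K1 K2 K3 M1 M2 L0 L1 L2 L3 N1 N2 :: real
  assumes R: "1 \<le> R"
    and J: "\<And>k j. 0 \<le> J k j" "interaction_norm_finite \<gamma> R J"
    and pos: "0 < K0" "0 < K1" "0 < K2" "0 < K3" "0 < M1" "0 < M2"
    and nonneg: "0 \<le> L0" "0 \<le> L1" "0 \<le> L2" "0 \<le> L3" "0 \<le> N1" "0 \<le> N2"
    and hF0: "\<And>x k n. x \<in> config iXB \<gamma> \<Longrightarrow>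
      norm (dF0 k n (x k)) \<le> K0 * (norm (F0 k (x k)) + norm (iXB (x k)) powr R) + L0"
    and hG1: "\<And>x k n. x \<in> config iXB \<gamma> \<Longrightarrow>
      \<bar>G k x (iXB (\<phi> n))\<bar> + \<bar>dG k n x (iXB (\<phi> n))\<bar> \<le> M1 * interaction_sum iXB R J k x + N1"
    and hG2: "\<And>x k n. x \<in> config iXB \<gamma> \<Longrightarrow>
      norm (G k x) + \<bar>G k x (iXB (x k))\<bar> + \<bar>dG k n x (iXB (x k))\<bar>
        \<le> M2 * interaction_sum iXB R J k x + N2"
    and hL1: "\<And>x k n. x \<in> config iXB \<gamma> \<Longrightarrow>
      \<bar>F0 k (x k) (iXB (\<phi> n))\<bar> + \<bar>dF0 k n (x k) (iXB (\<phi> n))\<bar> \<le> K1 * coercivity iXB F0 k (x k) + L1"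
    and hL2: "\<And>x k n. x \<in> config iXB \<gamma> \<Longrightarrow>
      \<bar>dF0 k n (x k) (iXB (x k))\<bar> \<le> K2 * coercivity iXB F0 k (x k) + L2"
    and hL3: "\<And>x k. x \<in> config iXB \<gamma> \<Longrightarrow>
      norm (iXB (x k)) powr R \<le> K3 * coercivity iXB F0 k (x k) + L3"
begin

abbreviation "S \<equiv> interaction_sum iXB R J"
abbreviation "Jnorm \<equiv> interaction_norm \<gamma> R J"
abbreviation "Tr \<equiv> trace_inv lam"
abbreviation "\<M> \<equiv> symmetrizing_measures iXB iBH A \<phi> \<gamma> (full_drift F0 G)"

section \<open>Consequences of the coercivity hypotheses\<close>

text \<open>Large enough to swallow the additive constants \<open>L1\<close>, \<open>L2\<close>,
  \<open>L3\<close>. By \<open>hL3\<close> the coercivity functional is at least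
  \<open>- L3 / K3\<close>; twice this quantity is needed for the shifted functional to dominate the
  absolute value as well, and the 1 makes its powers monotone in the exponent.\<close>

definition "shift = 1 + L1 / K1 + L2 / K2 + 2 * L3 / K3"

definition "ell k x = coercivity iXB F0 k (x k) + shift"

context
  fixes x :: "'k \<Rightarrow> 'x" and k :: 'k
  assumes x: "x \<in> configs"
begin

lemma coercivity_lower: "- (L3 / K3) \<le> coercivity iXB F0 k (x k)"
proof -
  have "0 \<le> K3 * coercivity iXB F0 k (x k) + L3"
    using hL3[OF x, of k] powr_ge_zero order_trans by blast
  then show ?thesis
    using pos by (simp add: field_simps)
qed

lemma shift_ge: "1 \<le> shift" "L1 / K1 \<le> shift" "L2 / K2 \<le> shift" "L3 / K3 \<le> shift"
  "1 + 2 * (L3 / K3) \<le> shift" "0 \<le> L3 / K3"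
proof -
  have "0 \<le> L1 / K1" "0 \<le> L2 / K2" "0 \<le> L3 / K3"
    using pos nonneg by auto
  then show "1 \<le> shift" "L1 / K1 \<le> shift" "L2 / K2 \<le> shift" "L3 / K3 \<le> shift"
    "1 + 2 * (L3 / K3) \<le> shift" "0 \<le> L3 / K3"
    unfolding shift_def times_divide_eq_right[symmetric] by linarith+
qed

lemma ell_ge_1: "1 \<le> ell k x"
  using coercivity_lower shift_ge(5,6) unfolding ell_def by linarith

lemma abs_coercivity_le: "\<bar>coercivity iXB F0 k (x k)\<bar> \<le> ell k x"
  using coercivity_lower shift_ge(5,6) unfolding ell_def by linarith

lemma site_power_le: "norm (iXB (x k)) powr R \<le> K3 * ell k x"
proof -
  have "L3 \<le> K3 * shift"
    using shift_ge(4) pos by (simp add: field_simps)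
  then show ?thesis
    using hL3[OF x, of k] by (simp add: ell_def distrib_left)
qed

lemma drift_component_le:
  "\<bar>F0 k (x k) (iXB (\<phi> n))\<bar> + \<bar>dF0 k n (x k) (iXB (\<phi> n))\<bar> \<le> K1 * ell k x"
proof -
  have "L1 \<le> K1 * shift"
    using shift_ge(2) pos by (simp add: field_simps)
  then show ?thesis
    using hL1[OF x, of k n] by (simp add: ell_def distrib_left)
qed

lemma drift_radial_le: "\<bar>dF0 k n (x k) (iXB (x k))\<bar> \<le> K2 * ell k x"
proof -
  have "L2 \<le> K2 * shift"
    using shift_ge(3) pos by (simp add: field_simps)
  then show ?thesis
    using hL2[OF x, of n k] by (simp add: ell_def distrib_left)
qed

lemma site_norm_sq_le: "(norm (iXB (x k)))\<^sup>2 \<le> \<gamma> k * energy iXB x"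
proof -
  have "sum (\<lambda>k. inverse (\<gamma> k) * (norm (iXB (x k)))\<^sup>2) {k} \<le> energy iXB x"
    unfolding energy_def using x weight_pos
    by (intro finite_sum_le_infsum) (auto simp: config_def less_imp_le)
  then show ?thesis
    using weight_pos[of k] by (simp add: field_simps)
qed

text \<open>Deliberately crude: the bound uses the first power of \<open>1 + energy iXB x\<close>
  instead of a square root, so that it can be cancelled against integer powers of the
  cutoff.\<close>

lemma site_norm_le: "norm (iXB (x k)) \<le> \<gamma> k * (1 + energy iXB x)"
proof (rule power2_le_imp_le)
  have one: "1 \<le> \<gamma> k * (1 + energy iXB x)"
    using mult_mono[of 1 "\<gamma> k" 1 "1 + energy iXB x"] weight_ge_1[of k] energy_nonneg[of iXB x] by simp
  have "(norm (iXB (x k)))\<^sup>2 \<le> \<gamma> k * (1 + energy iXB x)"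
    using site_norm_sq_le weight_pos[of k] by (simp add: distrib_left)
  also have "\<dots> \<le> (\<gamma> k * (1 + energy iXB x))\<^sup>2"
    using one by (rule self_le_power) simp
  finally show "(norm (iXB (x k)))\<^sup>2 \<le> (\<gamma> k * (1 + energy iXB x))\<^sup>2" .
  show "0 \<le> \<gamma> k * (1 + energy iXB x)"
    using one by linarith
qed

end

section \<open>The interaction sum\<close>

text \<open>An integer exponent in place of \<open>R\<close> keeps the cutoffs natural powers, for
  which the calculus above is available.\<close>

definition "r = nat \<lceil>R\<rceil>"

lemma r: "R \<le> real r" "1 \<le> r"
  using R by (auto simp: r_def le_nat_iff)

lemma interaction_row_le: "(\<Sum>\<^sub>\<infinity>j. J k j * \<gamma> (k - j) powr R) \<le> Jnorm"
  unfolding interaction_norm_def using J(2)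
  by (intro cSUP_upper) (auto simp: interaction_norm_finite_def)

lemma interaction_row_finite_le:
  assumes "finite I"
  shows "(\<Sum>j\<in>I. J k j * \<gamma> (k - j) powr R) \<le> Jnorm"
proof -
  have "(\<Sum>j\<in>I. J k j * \<gamma> (k - j) powr R) \<le> (\<Sum>\<^sub>\<infinity>j. J k j * \<gamma> (k - j) powr R)"
    using J assms by (intro finite_sum_le_infsum) (auto simp: interaction_norm_finite_def)
  also have "\<dots> \<le> Jnorm"
    by (rule interaction_row_le)
  finally show ?thesis .
qed

lemma Jnorm_nonneg: "0 \<le> Jnorm"
  using interaction_row_finite_le[of "{}" undefined] by simp

text \<open>Submultiplicativity applied to (k - a) - (k - j) = j - a. With a = 0 it bounds the
  interaction sum; with another a it transports a weight centred at a from site k to site j.\<close>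

lemma weight_shift: "\<gamma> (j - a) \<le> \<gamma> (k - a) * \<gamma> (k - j)"
  using weight_mult[of "k - a" "k - j"] by simp

lemma interaction_term_le:
  assumes x: "x \<in> configs"
  shows "J k j * norm (iXB (x j)) powr R
    \<le> (\<gamma> k powr R * (1 + energy iXB x) ^ r) * (J k j * \<gamma> (k - j) powr R)"
proof -
  have e: "1 \<le> 1 + energy iXB x"
    using energy_nonneg by simp
  have "norm (iXB (x j)) \<le> \<gamma> j * (1 + energy iXB x)"
    by (rule site_norm_le[OF x])
  also have "\<dots> \<le> (\<gamma> k * \<gamma> (k - j)) * (1 + energy iXB x)"
    using weight_shift[of j 0 k] e by (intro mult_right_mono) auto
  finally have "norm (iXB (x j)) \<le> (\<gamma> k * \<gamma> (k - j)) * (1 + energy iXB x)" .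
  then have "norm (iXB (x j)) powr R \<le> ((\<gamma> k * \<gamma> (k - j)) * (1 + energy iXB x)) powr R"
    using R by (intro powr_mono2) auto
  also have "\<dots> = \<gamma> k powr R * \<gamma> (k - j) powr R * (1 + energy iXB x) powr R"
    using weight_pos e by (simp add: powr_mult less_imp_le)
  also have "\<dots> \<le> \<gamma> k powr R * \<gamma> (k - j) powr R * (1 + energy iXB x) powr (real r)"
    using r e by (intro mult_left_mono powr_mono) auto
  also have "\<dots> = \<gamma> k powr R * \<gamma> (k - j) powr R * (1 + energy iXB x) ^ r"
    using e by (simp add: powr_realpow)
  finally have "J k j * norm (iXB (x j)) powr R
      \<le> J k j * (\<gamma> k powr R * \<gamma> (k - j) powr R * (1 + energy iXB x) ^ r)"
    using J(1) by (intro mult_left_mono)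
  then show ?thesis
    by (simp add: mult_ac)
qed

lemma interaction_summable:
  assumes "x \<in> configs"
  shows "(\<lambda>j. J k j * norm (iXB (x j)) powr R) summable_on UNIV"
proof (rule summable_on_comparison_test)
  show "(\<lambda>j. (\<gamma> k powr R * (1 + energy iXB x) ^ r) * (J k j * \<gamma> (k - j) powr R)) summable_on UNIV"
    using J(2) by (intro summable_on_cmult_right) (auto simp: interaction_norm_finite_def)
qed (use interaction_term_le[OF assms] J(1) in auto)

lemma S_nonneg: "0 \<le> S k x"
  using J(1) by (auto simp: interaction_sum_def intro!: infsum_nonneg)

text \<open>The growth in \<open>k\<close> of this bound is what the weights centred at a site have
  to compensate later.\<close>

lemma S_le:
  assumes "x \<in> configs"
  shows "S k x \<le> \<gamma> k powr R * Jnorm * (1 + energy iXB x) ^ r"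
proof -
  have "S k x \<le> (\<Sum>\<^sub>\<infinity>j. (\<gamma> k powr R * (1 + energy iXB x) ^ r) * (J k j * \<gamma> (k - j) powr R))"
    unfolding interaction_sum_def
    using J(2) by (intro infsum_mono interaction_summable interaction_term_le assms summable_on_cmult_right)
      (auto simp: interaction_norm_finite_def)
  also have "\<dots> = (\<gamma> k powr R * (1 + energy iXB x) ^ r) * (\<Sum>\<^sub>\<infinity>j. J k j * \<gamma> (k - j) powr R)"
    using J(2) by (intro infsum_cmult_right) (auto simp: interaction_norm_finite_def)
  also have "\<dots> \<le> (\<gamma> k powr R * (1 + energy iXB x) ^ r) * Jnorm"
    using energy_nonneg[of iXB x]
    by (intro mult_left_mono interaction_row_le mult_nonneg_nonneg zero_le_power) auto
  finally show ?thesis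
    by (simp add: mult_ac)
qed

text \<open>An exhausting sequence of finite sets. The lattice sum is a limit along the net of all
  finite subsets, whereas measurability of limits and Fatou's lemma need a sequence.\<close>

definition sites_upto :: "nat \<Rightarrow> 'k set" where
  "sites_upto i = {j. to_nat j < i}"

lemma finite_sites_upto [simp]: "finite (sites_upto i)"
  unfolding sites_upto_def
  by (rule inj_on_finite[of to_nat _ "{..<i}"]) auto

lemma S_LIMSEQ:
  assumes "x \<in> configs"
  shows "(\<lambda>i. \<Sum>j\<in>sites_upto i. J k j * norm (iXB (x j)) powr R) \<longlonglongrightarrow> S k x"
proof -
  have "\<forall>\<^sub>F i in sequentially. X \<subseteq> sites_upto i" if "finite X" for X :: "'k set"
  proof (rule eventually_sequentiallyI)
    fix i assume i: "Suc (Max (to_nat ` X)) \<le> i"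
    have "to_nat j < i" if "j \<in> X" for j
    proof -
      have "to_nat j \<le> Max (to_nat ` X)"
        using \<open>finite X\<close> that by (intro Max_ge) auto
      with i show ?thesis
        by linarith
    qed
    then show "X \<subseteq> sites_upto i"
      by (auto simp: sites_upto_def)
  qed
  then have "filterlim sites_upto (finite_subsets_at_top UNIV) sequentially"
    by (simp add: filterlim_finite_subsets_at_top)
  moreover have "(sum (\<lambda>j. J k j * norm (iXB (x j)) powr R) \<longlongrightarrow> S k x) (finite_subsets_at_top UNIV)"
    using has_sum_infsum[OF interaction_summable[OF assms]] by (simp add: has_sum_def interaction_sum_def)
  ultimately show ?thesis
    by (rule filterlim_compose[rotated])
qed

lemma continuous_map_site_power: "continuous_map ctop euclidean (\<lambda>x. norm (iXB (x j)) powr R)"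
  unfolding continuous_map_ctop_iff
  using R by (auto intro!: tendsto_powr' tendsto_norm tendsto_iXB tendsto_const)

lemma smooth_along_ell:
  "smooth_along k n (ell k) (\<lambda>x. F0 k (x k) (iXB (\<phi> n)) + dF0 k n (x k) (iXB (x k)))"
  using smooth_along_add[OF smooth_along_coercivity smooth_along_const[where c = shift]]
  by (simp add: ell_def[abs_def])

lemma continuous_map_ell: "continuous_map ctop euclidean (ell k)"
  using smooth_along_ell by (simp add: smooth_along_def)

section \<open>The moment inequality for a general weight\<close>

text \<open>A common majorant, up to constants, of the site variable, the drift and the interaction.
  At most two such factors are ever multiplied, hence the condition below that its square times the
  weight be bounded.\<close>

definition "growth k x = 1 + norm (iXB (x k)) + norm (F0 k (x k)) + ell k x + S k x"

lemma growth_lower: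
  assumes "x \<in> configs"
  shows "1 \<le> growth k x" "norm (iXB (x k)) \<le> growth k x" "norm (F0 k (x k)) \<le> growth k x"
    "ell k x \<le> growth k x" "S k x \<le> growth k x"
  using ell_ge_1[OF assms, of k] S_nonneg[of k x] by (auto simp: growth_def)

lemma growth_le_square: "x \<in> configs \<Longrightarrow> growth k x \<le> (growth k x)\<^sup>2"
  using growth_lower(1)[of x k] by (simp add: self_le_power)

context
  fixes \<mu> :: "('k \<Rightarrow> 'x) measure"
  assumes \<mu>: "\<mu> \<in> \<M>"
begin

lemma \<mu>_prob: "borel_prob iXB \<gamma> \<mu>"
  using \<mu> by (simp add: symmetrizing_measures_def)

lemma space_\<mu>: "space \<mu> = configs"
  using \<mu>_prob by (simp add: borel_prob_def)

lemma finite_measure_\<mu>: "finite_measure \<mu>"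
  using \<mu>_prob by (intro finite_measureI) (simp add: borel_prob_def)

lemmas measurable_\<mu> = continuous_map_borel_measurable[OF \<mu>_prob]

lemma S_measurable: "S k \<in> borel_measurable \<mu>"
proof (rule borel_measurable_LIMSEQ_real[where u = "\<lambda>i x. \<Sum>j\<in>sites_upto i. J k j * norm (iXB (x j)) powr R"])
  fix i
  have "(\<lambda>x. norm (iXB (x j)) powr R) \<in> borel_measurable \<mu>" for j
    by (rule measurable_\<mu>[OF continuous_map_site_power])
  then show "(\<lambda>x. \<Sum>j\<in>sites_upto i. J k j * norm (iXB (x j)) powr R) \<in> borel_measurable \<mu>"
    by measurable
qed (simp add: S_LIMSEQ space_\<mu>)

text \<open>
  With \<open>f = (F\<^sub>k, \<phi>\<^sub>n)\<close>, the derivative of \<open>\<Psi>\<close> is absorbed by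
  \<open>f \<partial>\<^sub>n \<Psi> \<le> \<bar>f\<bar> C \<Psi> \<le> f\<^sup>2 \<Psi> + C\<^sup>2 \<Psi> / 4\<close>. The factor \<open>1 / \<lambda>\<^sub>n\<close> is put in after integrating by parts.
\<close>

context
  fixes k :: 'k and \<Psi> :: "('k \<Rightarrow> 'x) \<Rightarrow> real" and \<Psi>' :: "nat \<Rightarrow> ('k \<Rightarrow> 'x) \<Rightarrow> real" and C Bd :: real
  assumes smooth: "\<And>n. smooth_along k n \<Psi> (\<Psi>' n)"
    and \<Psi>_nonneg: "\<And>x. x \<in> configs \<Longrightarrow> 0 \<le> \<Psi> x"
    and \<Psi>'_le: "\<And>n x. x \<in> configs \<Longrightarrow> \<bar>\<Psi>' n x\<bar> \<le> C * \<Psi> x"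
    and C: "0 \<le> C"
    and bound: "\<And>x. x \<in> configs \<Longrightarrow> (growth k x)\<^sup>2 * \<Psi> x \<le> Bd"
begin

lemmas growth_ge = growth_lower[where k = k]
lemmas growth_sq_ge = growth_le_square[where k = k]

lemma \<Psi>_measurable: "\<Psi> \<in> borel_measurable \<mu>"
  using smooth[of 0] by (intro measurable_\<mu>) (simp add: smooth_along_def)

text \<open>The constant \<open>Bd\<close> serves for integrability and for admissibility of the
  test function; it occurs in none of the resulting moment inequalities and may depend on the
  cutoffs.\<close>

lemma weighted_bound:
  assumes "x \<in> configs" "\<bar>f\<bar> \<le> c * (growth k x)\<^sup>2"
  shows "\<bar>f * \<Psi> x\<bar> \<le> \<bar>c\<bar> * Bd"
proof -
  have "\<bar>f * \<Psi> x\<bar> \<le> (c * (growth k x)\<^sup>2) * \<Psi> x"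
    using assms \<Psi>_nonneg[OF assms(1)] by (simp add: abs_mult mult_right_mono)
  also have "\<dots> \<le> (\<bar>c\<bar> * (growth k x)\<^sup>2) * \<Psi> x"
    using \<Psi>_nonneg[OF assms(1)] by (intro mult_right_mono) auto
  also have "\<dots> \<le> \<bar>c\<bar> * Bd"
    using bound[OF assms(1)] by (simp add: mult.assoc mult_left_mono)
  finally show ?thesis .
qed

lemma weighted_integrable:
  assumes "f \<in> borel_measurable \<mu>" "\<And>x. x \<in> configs \<Longrightarrow> \<bar>f x\<bar> \<le> c * (growth k x)\<^sup>2"
  shows "integrable \<mu> (\<lambda>x. f x * \<Psi> x)"
proof (rule finite_measure.integrable_const_bound[OF finite_measure_\<mu>])
  show "AE x in \<mu>. norm (f x * \<Psi> x) \<le> \<bar>c\<bar> * Bd"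
    using weighted_bound assms(2) by (intro AE_I2) (auto simp: space_\<mu>)
qed (use assms(1) \<Psi>_measurable in measurable)

definition "drift_coeff n x = full_drift F0 G k x (iXB (\<phi> n))"
definition "drift_coeff_deriv n x = dF0 k n (x k) (iXB (\<phi> n)) + dG k n x (iXB (\<phi> n))"
definition "coord n x = inner (iBH (iXB (x k))) (iBH (iXB (\<phi> n)))"

lemma drift_coeff_smooth: "smooth_along k n (drift_coeff n) (drift_coeff_deriv n)"
  using smooth_along_add[OF smooth_along_F0_apply smooth_along_G_apply]
  by (simp add: drift_coeff_def[abs_def] drift_coeff_deriv_def[abs_def] full_drift_def blinfun.add_left)

lemma drift_coeff_le:
  assumes "x \<in> configs"
  shows "\<bar>drift_coeff n x\<bar> \<le> K1 * ell k x + M1 * S k x + N1" "drift_coeff_deriv n x \<le> K1 * ell k x + M1 * S k x + N1"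
    "\<bar>drift_coeff_deriv n x\<bar> \<le> K1 * ell k x + M1 * S k x + N1"
  using drift_component_le[OF assms, of k n] hG1[OF assms, of k n]
  by (auto simp: drift_coeff_def drift_coeff_deriv_def full_drift_def blinfun.add_left)

lemma drift_coeff_growth:
  assumes "x \<in> configs"
  shows "K1 * ell k x + M1 * S k x + N1 \<le> (K1 + M1 + N1) * growth k x"
    "\<bar>drift_coeff n x\<bar> \<le> (K1 + M1 + N1) * growth k x" "\<bar>drift_coeff_deriv n x\<bar> \<le> (K1 + M1 + N1) * growth k x"
proof -
  have "K1 * ell k x + M1 * S k x + N1 * 1 \<le> K1 * growth k x + M1 * growth k x + N1 * growth k x"
    using growth_ge[OF assms] pos nonneg by (intro add_mono mult_left_mono) auto
  then show *: "K1 * ell k x + M1 * S k x + N1 \<le> (K1 + M1 + N1) * growth k x"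
    by (simp add: algebra_simps)
  show "\<bar>drift_coeff n x\<bar> \<le> (K1 + M1 + N1) * growth k x" "\<bar>drift_coeff_deriv n x\<bar> \<le> (K1 + M1 + N1) * growth k x"
    using * drift_coeff_le[OF assms, of n] by linarith+
qed

lemma drift_growth:
  assumes "x \<in> configs"
  shows "norm (full_drift F0 G k x) \<le> (1 + M2 + N2) * growth k x"
proof -
  have "norm (full_drift F0 G k x) \<le> norm (F0 k (x k)) + norm (G k x)"
    by (simp add: full_drift_def norm_triangle_ineq)
  also have "\<dots> \<le> norm (F0 k (x k)) + (M2 * S k x + N2 * 1)"
    using hG2[OF assms, of k 0] by simp
  also have "\<dots> \<le> growth k x + (M2 * growth k x + N2 * growth k x)"
    using growth_ge[OF assms] pos nonneg by (intro add_mono mult_left_mono) auto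
  finally show ?thesis
    by (simp add: algebra_simps)
qed

lemma coord_growth:
  assumes "x \<in> configs"
  shows "\<bar>coord n x\<bar> \<le> norm iBH * growth k x"
proof -
  have "norm (iBH (iXB (\<phi> n))) = 1"
    using orthonormal[of n n] by (simp add: norm_eq_sqrt_inner)
  then have "\<bar>coord n x\<bar> \<le> norm (iBH (iXB (x k)))"
    unfolding coord_def using Cauchy_Schwarz_ineq2[of "iBH (iXB (x k))" "iBH (iXB (\<phi> n))"] by simp
  also have "\<dots> \<le> norm iBH * norm (iXB (x k))"
    by (rule norm_blinfun)
  also have "\<dots> \<le> norm iBH * growth k x"
    using growth_ge(2)[OF assms] by (rule mult_left_mono) simp
  finally show ?thesis .
qed

lemma product_growth:
  assumes "\<bar>a\<bar> \<le> c * growth k x" "\<bar>b\<bar> \<le> d * growth k x"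
  shows "\<bar>a * b\<bar> \<le> (c * d) * (growth k x)\<^sup>2"
  using mult_mono[OF assms(1,2)] assms(1)
  by (simp add: abs_mult power2_eq_square mult_ac)

lemma coord_measurable: "coord n \<in> borel_measurable \<mu>"
  unfolding coord_def
  by (intro measurable_\<mu>) (auto simp: continuous_map_ctop_iff intro!: tendsto_intros tendsto_iXB)

lemma drift_coeff_measurable: "drift_coeff n \<in> borel_measurable \<mu>" "drift_coeff_deriv n \<in> borel_measurable \<mu>"
  using drift_coeff_smooth[of n] by (auto simp: smooth_along_def intro: measurable_\<mu>)

text \<open>Bounds what integration by parts leaves after the square has been absorbed. It does not
  depend on the eigenvector, so only the factors 1 / \<open>lam n\<close> are summed and they
  produce the trace.\<close>

definition "majorant x = K1 * ell k x + M1 * S k x + (N1 + C\<^sup>2 / 4)"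

lemma majorant_integrable: "integrable \<mu> (\<lambda>x. majorant x * \<Psi> x)"
proof (rule weighted_integrable)
  show "majorant \<in> borel_measurable \<mu>"
    unfolding majorant_def using measurable_\<mu>[OF continuous_map_ell, of k] S_measurable[of k] by measurable
  fix x assume x: "x \<in> configs"
  have "0 \<le> majorant x"
    unfolding majorant_def using ell_ge_1[OF x, of k] S_nonneg[of k x] pos nonneg
    by (intro add_nonneg_nonneg mult_nonneg_nonneg) auto
  moreover have "majorant x \<le> (K1 + M1 + N1) * growth k x + C\<^sup>2 / 4 * growth k x"
    unfolding majorant_def using drift_coeff_growth(1)[OF x] growth_ge(1)[OF x] mult_left_mono[of 1 "growth k x" "C\<^sup>2 / 4"]
    by simp
  moreover have "\<dots> \<le> (K1 + M1 + N1 + C\<^sup>2 / 4) * (growth k x)\<^sup>2"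
    unfolding distrib_right[symmetric] using growth_sq_ge[OF x] pos nonneg
    by (intro mult_left_mono) auto
  ultimately show "\<bar>majorant x\<bar> \<le> (K1 + M1 + N1 + C\<^sup>2 / 4) * (growth k x)\<^sup>2"
    by linarith
qed

lemma component_integrable:
  "integrable \<mu> (\<lambda>x. coord n x * drift_coeff n x * \<Psi> x)" "integrable \<mu> (\<lambda>x. drift_coeff n x * drift_coeff n x * \<Psi> x)"
proof -
  note [measurable] = coord_measurable[of n] drift_coeff_measurable(1)[of n]
  show "integrable \<mu> (\<lambda>x. coord n x * drift_coeff n x * \<Psi> x)"
  proof (rule weighted_integrable)
    fix x assume x: "x \<in> configs"
    show "\<bar>coord n x * drift_coeff n x\<bar> \<le> (norm iBH * (K1 + M1 + N1)) * (growth k x)\<^sup>2"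
      by (rule product_growth[OF coord_growth[OF x] drift_coeff_growth(2)[OF x]])
  qed measurable
  show "integrable \<mu> (\<lambda>x. drift_coeff n x * drift_coeff n x * \<Psi> x)"
  proof (rule weighted_integrable)
    fix x assume x: "x \<in> configs"
    show "\<bar>drift_coeff n x * drift_coeff n x\<bar> \<le> ((K1 + M1 + N1) * (K1 + M1 + N1)) * (growth k x)\<^sup>2"
      by (rule product_growth[OF drift_coeff_growth(2)[OF x] drift_coeff_growth(2)[OF x]])
  qed measurable
qed

lemma component_inequality:
  "(\<integral>x. coord n x * drift_coeff n x * \<Psi> x \<partial>\<mu>) \<le> inverse (lam n) * (\<integral>x. majorant x * \<Psi> x \<partial>\<mu>)"
proof -
  define c where "c = K1 + M1 + N1"
  have c: "0 \<le> c"
    using pos nonneg by (simp add: c_def)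
  note int_xF = component_integrable(1)[of n] and int_FF = component_integrable(2)[of n]
  have int_dF: "integrable \<mu> (\<lambda>x. drift_coeff_deriv n x * \<Psi> x)"
  proof (intro weighted_integrable drift_coeff_measurable(2))
    fix x assume x: "x \<in> configs"
    show "\<bar>drift_coeff_deriv n x\<bar> \<le> c * (growth k x)\<^sup>2"
      using drift_coeff_growth(3)[OF x, of n] growth_sq_ge[OF x] mult_left_mono[OF growth_sq_ge[OF x] c]
      by (simp add: c_def)
  qed
  have FP_le: "\<bar>drift_coeff n x * \<Psi>' n x\<bar> \<le> \<bar>c * C\<bar> * Bd" if x: "x \<in> configs" for x
  proof -
    have "\<bar>drift_coeff n x * \<Psi>' n x\<bar> \<le> (c * growth k x) * (C * \<Psi> x)"
      unfolding abs_mult using drift_coeff_growth(2)[OF x, of n] \<Psi>'_le[OF x, of n] growth_ge(1)[OF x] c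
      by (intro mult_mono) (auto simp: c_def)
    also have "\<dots> = (c * C * growth k x) * \<Psi> x"
      by (simp add: mult_ac)
    also have "\<dots> \<le> (c * C * (growth k x)\<^sup>2) * \<Psi> x"
      using growth_sq_ge[OF x] c C \<Psi>_nonneg[OF x] by (intro mult_right_mono mult_left_mono) auto
    also have "\<dots> \<le> \<bar>c * C * (growth k x)\<^sup>2 * \<Psi> x\<bar>"
      by simp
    also have "\<dots> \<le> \<bar>c * C\<bar> * Bd"
      using c C by (intro weighted_bound[OF x]) auto
    finally show ?thesis .
  qed
  have int_FP: "integrable \<mu> (\<lambda>x. drift_coeff n x * \<Psi>' n x)"
  proof (rule finite_measure.integrable_const_bound[OF finite_measure_\<mu>])
    show "AE x in \<mu>. norm (drift_coeff n x * \<Psi>' n x) \<le> \<bar>c * C\<bar> * Bd"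
      using FP_le by (intro AE_I2) (simp add: space_\<mu>)
    have "\<Psi>' n \<in> borel_measurable \<mu>"
      using smooth[of n] by (auto simp: smooth_along_def intro: measurable_\<mu>)
    then show "(\<lambda>x. drift_coeff n x * \<Psi>' n x) \<in> borel_measurable \<mu>"
      using drift_coeff_measurable(1)[of n] by measurable
  qed
  have "(\<integral>x. drift_coeff_deriv n x * \<Psi> x + drift_coeff n x * \<Psi>' n x \<partial>\<mu>)
      = - (\<integral>x. drift_coeff n x * \<Psi> x * log_grad iXB iBH A \<phi> (full_drift F0 G) k n x \<partial>\<mu>)"
  proof (rule integration_by_parts[OF \<mu> smooth_along_mult[OF drift_coeff_smooth smooth]])
    fix x assume x: "x \<in> configs"
    \<comment> \<open>One constant for both admissibility bounds: the first two summands bound the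
      two terms of the derivative, the third bounds the test function times the drift. There 1 +
      |x_k| contributes one \<open>growth k x\<close> and the drift \<open>1 + M2 + N2\<close> of
      them.\<close>
    let ?B = "\<bar>c\<bar> * Bd + \<bar>c * C\<bar> * Bd + \<bar>c * (2 + M2 + N2)\<bar> * Bd"
    have Bd: "0 \<le> Bd"
      using weighted_bound[OF x, of 0 1] by simp
    have "\<bar>drift_coeff_deriv n x * \<Psi> x\<bar> \<le> \<bar>c\<bar> * Bd"
      using drift_coeff_growth(3)[OF x, of n] mult_left_mono[OF growth_sq_ge[OF x] c]
      by (intro weighted_bound[OF x]) (simp add: c_def)
    with FP_le[OF x] Bd show "\<bar>drift_coeff_deriv n x * \<Psi> x + drift_coeff n x * \<Psi>' n x\<bar> \<le> ?B"
      using mult_nonneg_nonneg[OF abs_ge_zero Bd, of "c * (2 + M2 + N2)"] by linarith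
    define B where "B = 1 + norm (iXB (x k)) + norm (full_drift F0 G k x)"
    have B: "0 \<le> B"
      by (simp add: B_def)
    have "1 + norm (iXB (x k)) \<le> growth k x"
      using ell_ge_1[OF x, of k] S_nonneg[of k x] by (simp add: growth_def)
    then have "B \<le> growth k x + (1 + M2 + N2) * growth k x"
      unfolding B_def using drift_growth[OF x] by (rule add_mono)
    also have "\<dots> = (2 + M2 + N2) * growth k x"
      by (simp add: distrib_right)
    finally have "\<bar>B\<bar> \<le> (2 + M2 + N2) * growth k x"
      using B by simp
    from weighted_bound[OF x product_growth[OF drift_coeff_growth(2)[OF x] this], of n]
    have "\<bar>drift_coeff n x * B * \<Psi> x\<bar> \<le> \<bar>c * (2 + M2 + N2)\<bar> * Bd"
      unfolding c_def .
    moreover have "\<bar>drift_coeff n x * B * \<Psi> x\<bar> = \<bar>drift_coeff n x * \<Psi> x\<bar> * B"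
      using B by (simp add: abs_mult)
    moreover have "0 \<le> \<bar>c\<bar> * Bd" "0 \<le> \<bar>c * C\<bar> * Bd"
      using Bd by auto
    ultimately show "\<bar>drift_coeff n x * \<Psi> x\<bar> * (1 + norm (iXB (x k)) + norm (full_drift F0 G k x)) \<le> ?B"
      unfolding B_def by linarith
  qed
  \<comment> \<open>The logarithmic gradient is minus \<open>lam n\<close> times the coordinate,
    minus the drift component. After moving terms, the square of that component stands with a minus
    sign next to the derivative of \<open>\<Psi>\<close>.\<close>
  also have "(\<integral>x. drift_coeff n x * \<Psi> x * log_grad iXB iBH A \<phi> (full_drift F0 G) k n x \<partial>\<mu>)
      = (\<integral>x. - lam n * (coord n x * drift_coeff n x * \<Psi> x) - drift_coeff n x * drift_coeff n x * \<Psi> x \<partial>\<mu>)"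
  proof (intro Bochner_Integration.integral_cong refl)
    fix x
    have eq: "log_grad iXB iBH A \<phi> (full_drift F0 G) k n x = - lam n * coord n x - drift_coeff n x"
      by (simp add: log_grad_eq coord_def drift_coeff_def)
    show "drift_coeff n x * \<Psi> x * log_grad iXB iBH A \<phi> (full_drift F0 G) k n x
        = - lam n * (coord n x * drift_coeff n x * \<Psi> x) - drift_coeff n x * drift_coeff n x * \<Psi> x"
      unfolding eq by (simp add: right_diff_distrib)
  qed
  also have "\<dots> = - lam n * (\<integral>x. coord n x * drift_coeff n x * \<Psi> x \<partial>\<mu>) - (\<integral>x. drift_coeff n x * drift_coeff n x * \<Psi> x \<partial>\<mu>)"
    using int_xF int_FF by simp
  finally have "lam n * (\<integral>x. coord n x * drift_coeff n x * \<Psi> x \<partial>\<mu>)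
      = (\<integral>x. drift_coeff_deriv n x * \<Psi> x + drift_coeff n x * \<Psi>' n x \<partial>\<mu>) - (\<integral>x. drift_coeff n x * drift_coeff n x * \<Psi> x \<partial>\<mu>)"
    by simp
  also have "\<dots> = (\<integral>x. drift_coeff_deriv n x * \<Psi> x + drift_coeff n x * \<Psi>' n x - drift_coeff n x * drift_coeff n x * \<Psi> x \<partial>\<mu>)"
    using int_dF int_FP int_FF by simp
  also have "\<dots> \<le> (\<integral>x. majorant x * \<Psi> x \<partial>\<mu>)"
  proof (rule integral_mono)
    fix x assume "x \<in> space \<mu>"
    then have x: "x \<in> configs"
      by (simp add: space_\<mu>)
    have "drift_coeff n x * \<Psi>' n x \<le> \<bar>drift_coeff n x\<bar> * \<bar>\<Psi>' n x\<bar>"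
      unfolding abs_mult[symmetric] by (rule abs_ge_self)
    also have "\<dots> \<le> \<bar>drift_coeff n x\<bar> * (C * \<Psi> x)"
      using \<Psi>'_le[OF x, of n] by (rule mult_left_mono) simp
    also have "\<dots> \<le> (drift_coeff n x * drift_coeff n x + C\<^sup>2 / 4) * \<Psi> x"
    proof -
      have "\<bar>drift_coeff n x\<bar> * C \<le> drift_coeff n x * drift_coeff n x + C\<^sup>2 / 4"
        using mult_le_sq_add[of "\<bar>drift_coeff n x\<bar>" C] by (simp only: abs_mult_self_eq)
      from mult_right_mono[OF this \<Psi>_nonneg[OF x]] show ?thesis
        unfolding mult.assoc .
    qed
    finally have "drift_coeff n x * \<Psi>' n x - drift_coeff n x * drift_coeff n x * \<Psi> x \<le> C\<^sup>2 / 4 * \<Psi> x"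
      by (simp add: distrib_right)
    moreover have "drift_coeff_deriv n x * \<Psi> x \<le> (K1 * ell k x + M1 * S k x + N1) * \<Psi> x"
      using drift_coeff_le(2)[OF x] \<Psi>_nonneg[OF x] by (rule mult_right_mono)
    ultimately show "drift_coeff_deriv n x * \<Psi> x + drift_coeff n x * \<Psi>' n x - drift_coeff n x * drift_coeff n x * \<Psi> x \<le> majorant x * \<Psi> x"
      by (simp add: majorant_def algebra_simps)
  qed (use int_dF int_FP int_FF majorant_integrable in auto)
  finally show ?thesis
    using lam_pos[of n] by (simp add: field_simps)
qed

text \<open>Summing the components up to K pairs the drift with the K-th projection of x_k. The
  projections are uniformly bounded on B, which gives a dominating constant, and they converge by
  the Schauder property. The partial sums of 1 / \<open>lam n\<close> may be replaced by the trace
  because the majorant is nonnegative.\<close>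

lemma drift_inequality:
  "integrable \<mu> (\<lambda>x. full_drift F0 G k x (iXB (x k)) * \<Psi> x)" (is ?integrable)
  "(\<integral>x. full_drift F0 G k x (iXB (x k)) * \<Psi> x \<partial>\<mu>) \<le> Tr * (\<integral>x. majorant x * \<Psi> x \<partial>\<mu>)" (is ?le)
proof -
  obtain \<sigma> where \<sigma>: "norm (\<Sum>n\<le>K. inner (iBH v) (iBH (iXB (\<phi> n))) *\<^sub>R iXB (\<phi> n)) \<le> \<sigma> * norm v" for K v
    using projections_bounded by blast
  define P where "P K x = (\<Sum>n\<le>K. coord n x *\<^sub>R iXB (\<phi> n))" for K x
  have F_eq: "full_drift F0 G k x (P K x) = (\<Sum>n\<le>K. coord n x * drift_coeff n x)" for K x
    by (simp add: P_def drift_coeff_def blinfun.sum_right blinfun.scaleR_right)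
  have P_lim: "(\<lambda>K. P K x) \<longlonglongrightarrow> iXB (x k)" for x
    using schauder_partial_sums[of "iXB (x k)"] unfolding LIMSEQ_lessThan_iff_atMost P_def coord_def .
  note int_n = component_integrable(1)
  have meas: "(\<lambda>x. full_drift F0 G k x (iXB (x k)) * \<Psi> x) \<in> borel_measurable \<mu>"
  proof -
    have "continuous_map ctop euclidean (\<lambda>x. full_drift F0 G k x (iXB (x k)))"
      unfolding full_drift_def continuous_map_ctop_iff
      by (auto intro!: tendsto_intros tendsto_F0 tendsto_G tendsto_iXB)
    from measurable_\<mu>[OF this] \<Psi>_measurable show ?thesis
      by measurable
  qed
  have dom: "norm (full_drift F0 G k x (P K x) * \<Psi> x) \<le> \<bar>(1 + M2 + N2) * \<bar>\<sigma>\<bar>\<bar> * Bd"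
    if x: "x \<in> configs" for K x
  proof -
    have "\<bar>full_drift F0 G k x (P K x)\<bar> \<le> norm (full_drift F0 G k x) * norm (P K x)"
      using norm_blinfun[of "full_drift F0 G k x" "P K x"] by simp
    also have "\<dots> \<le> ((1 + M2 + N2) * growth k x) * (\<bar>\<sigma>\<bar> * growth k x)"
    proof (intro mult_mono drift_growth x)
      have "norm (P K x) \<le> \<bar>\<sigma>\<bar> * norm (iXB (x k))"
        unfolding P_def coord_def
        by (rule order_trans[OF \<sigma>]) (simp add: mult_right_mono)
      also have "\<dots> \<le> \<bar>\<sigma>\<bar> * growth k x"
        using growth_ge(2)[OF x] by (rule mult_left_mono) simp
      finally show "norm (P K x) \<le> \<bar>\<sigma>\<bar> * growth k x" .
    qed (use growth_ge(1)[OF x] pos nonneg in auto)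
    finally show ?thesis
      unfolding real_norm_def by (intro weighted_bound[OF x]) (simp add: power2_eq_square mult_ac)
  qed
  have lim: "(\<lambda>K. full_drift F0 G k x (P K x) * \<Psi> x) \<longlonglongrightarrow> full_drift F0 G k x (iXB (x k)) * \<Psi> x" for x
    by (intro tendsto_intros P_lim)
  have const: "integrable \<mu> (\<lambda>_. \<bar>(1 + M2 + N2) * \<bar>\<sigma>\<bar>\<bar> * Bd)"
    using finite_measure.integrable_const[OF finite_measure_\<mu>] .
  have step_meas: "(\<lambda>x. full_drift F0 G k x (P K x) * \<Psi> x) \<in> borel_measurable \<mu>" for K
    unfolding F_eq using int_n coord_measurable drift_coeff_measurable(1) \<Psi>_measurable by measurable
  show ?integrable
    by (rule integrable_dominated_convergence[OF meas step_meas const])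
      (use lim dom in \<open>auto simp: space_\<mu> intro!: AE_I2\<close>)
  have "(\<lambda>K. \<integral>x. full_drift F0 G k x (P K x) * \<Psi> x \<partial>\<mu>)
      \<longlonglongrightarrow> (\<integral>x. full_drift F0 G k x (iXB (x k)) * \<Psi> x \<partial>\<mu>)"
    by (rule integral_dominated_convergence[OF meas step_meas const])
      (use lim dom in \<open>auto simp: space_\<mu> intro!: AE_I2\<close>)
  moreover have "(\<integral>x. full_drift F0 G k x (P K x) * \<Psi> x \<partial>\<mu>) \<le> Tr * (\<integral>x. majorant x * \<Psi> x \<partial>\<mu>)" for K
  proof -
    have nonneg_rhs: "0 \<le> (\<integral>x. majorant x * \<Psi> x \<partial>\<mu>)"
    proof (rule Bochner_Integration.integral_nonneg)
      fix x assume "x \<in> space \<mu>"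
      then have x: "x \<in> configs"
        by (simp add: space_\<mu>)
      show "0 \<le> majorant x * \<Psi> x"
        unfolding majorant_def using ell_ge_1[OF x, of k] S_nonneg[of k x] pos nonneg \<Psi>_nonneg[OF x]
        by (intro add_nonneg_nonneg mult_nonneg_nonneg) auto
    qed
    have "(\<integral>x. full_drift F0 G k x (P K x) * \<Psi> x \<partial>\<mu>) = (\<Sum>n\<le>K. \<integral>x. coord n x * drift_coeff n x * \<Psi> x \<partial>\<mu>)"
      unfolding F_eq sum_distrib_right using int_n by simp
    also have "\<dots> \<le> (\<Sum>n\<le>K. inverse (lam n) * (\<integral>x. majorant x * \<Psi> x \<partial>\<mu>))"
      by (intro sum_mono component_inequality)
    also have "\<dots> = (\<Sum>n\<le>K. inverse (lam n)) * (\<integral>x. majorant x * \<Psi> x \<partial>\<mu>)"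
      by (simp add: sum_distrib_right)
    also have "\<dots> \<le> Tr * (\<integral>x. majorant x * \<Psi> x \<partial>\<mu>)"
      unfolding trace_inv_def using nonneg_rhs trace_class lam_pos
      by (intro mult_right_mono sum_le_suminf) (auto simp: less_imp_le)
    finally show ?thesis .
  qed
  ultimately show ?le
    by (intro LIMSEQ_le_const2) auto
qed

lemma basic_integrable:
  "integrable \<mu> (\<lambda>x. ell k x * \<Psi> x)" "integrable \<mu> (\<lambda>x. S k x * \<Psi> x)" "integrable \<mu> \<Psi>"
proof -
  have sq: "1 \<le> (growth k x)\<^sup>2" if "x \<in> configs" for x
    using growth_ge(1)[OF that] by (simp add: one_le_power)
  show "integrable \<mu> (\<lambda>x. ell k x * \<Psi> x)"
  proof (rule weighted_integrable[where c = 1])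
    fix x assume x: "x \<in> configs"
    show "\<bar>ell k x\<bar> \<le> 1 * (growth k x)\<^sup>2"
      using growth_ge(4)[OF x] growth_sq_ge[OF x] ell_ge_1[OF x, of k] by linarith
  qed (rule measurable_\<mu>[OF continuous_map_ell])
  show "integrable \<mu> (\<lambda>x. S k x * \<Psi> x)"
  proof (rule weighted_integrable[where c = 1])
    fix x assume x: "x \<in> configs"
    show "\<bar>S k x\<bar> \<le> 1 * (growth k x)\<^sup>2"
      using growth_ge(5)[OF x] growth_sq_ge[OF x] S_nonneg[of k x] by linarith
  qed (rule S_measurable)
  have "integrable \<mu> (\<lambda>x. 1 * \<Psi> x)"
    by (rule weighted_integrable[where c = 1]) (use sq in auto)
  then show "integrable \<mu> \<Psi>"
    by simp
qed

text \<open>The drift paired with x_k is \<open>ell k x - shift\<close> plus the pairing with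
  \<open>G k x\<close>, which \<open>hG2\<close> bounds. The constant \<open>C\<close> appears only
  in front of the integral of \<open>\<Psi>\<close>, the lowest order term.\<close>

lemma basic_inequality:
  "(1 - K1 * Tr) * (\<integral>x. ell k x * \<Psi> x \<partial>\<mu>) \<le> (M2 + M1 * Tr) * (\<integral>x. S k x * \<Psi> x \<partial>\<mu>)
    + (shift + N2 + Tr * (N1 + C\<^sup>2 / 4)) * (\<integral>x. \<Psi> x \<partial>\<mu>)"
proof -
  note int = basic_integrable
  have "(\<integral>x. ell k x * \<Psi> x - M2 * (S k x * \<Psi> x) - (shift + N2) * \<Psi> x \<partial>\<mu>)
      \<le> (\<integral>x. full_drift F0 G k x (iXB (x k)) * \<Psi> x \<partial>\<mu>)"
  proof (rule integral_mono)
    fix x assume "x \<in> space \<mu>"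
    then have x: "x \<in> configs"
      by (simp add: space_\<mu>)
    have "ell k x - shift - (M2 * S k x + N2) \<le> full_drift F0 G k x (iXB (x k))"
      using hG2[OF x, of k 0] norm_ge_zero[of "G k x"] abs_ge_zero[of "dG k 0 x (iXB (x k))"]
      unfolding ell_def coercivity_def full_drift_def blinfun.add_left by linarith
    from mult_right_mono[OF this \<Psi>_nonneg[OF x]]
    show "ell k x * \<Psi> x - M2 * (S k x * \<Psi> x) - (shift + N2) * \<Psi> x \<le> full_drift F0 G k x (iXB (x k)) * \<Psi> x"
      by (simp add: algebra_simps)
  qed (use int drift_inequality(1) in auto)
  also have "\<dots> \<le> Tr * (\<integral>x. majorant x * \<Psi> x \<partial>\<mu>)"
    by (rule drift_inequality(2))
  also have "(\<integral>x. majorant x * \<Psi> x \<partial>\<mu>)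
      = (\<integral>x. K1 * (ell k x * \<Psi> x) + M1 * (S k x * \<Psi> x) + (N1 + C\<^sup>2 / 4) * \<Psi> x \<partial>\<mu>)"
    by (simp add: majorant_def algebra_simps)
  also have "\<dots> = K1 * (\<integral>x. ell k x * \<Psi> x \<partial>\<mu>) + M1 * (\<integral>x. S k x * \<Psi> x \<partial>\<mu>)
      + (N1 + C\<^sup>2 / 4) * (\<integral>x. \<Psi> x \<partial>\<mu>)"
    using int by simp
  finally show ?thesis
    using int by (simp add: algebra_simps)
qed

end

end

end

section \<open>Uniform moments\<close>

text \<open>Young's inequality for the exponents m + 1 and (m + 1) / m without roots. The induction
  step adds the rearrangement inequality, that is, (x - y) (x^(m+1) - y^(m+1)) is nonnegative. The
  weights 1 / (m + 1) and m / (m + 1) add up to 1, so comparing sites costs no constant.\<close>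

lemma young_power_mult:
  fixes x y :: real
  assumes "0 \<le> x" "0 \<le> y"
  shows "real (Suc m) * (x * y ^ m) \<le> x ^ Suc m + real m * y ^ Suc m"
proof (induction m)
  case (Suc m)
  have "0 \<le> (x - y) * (x ^ Suc m - y ^ Suc m)"
  proof (cases "x \<le> y")
    case True
    then show ?thesis
      using power_mono[OF True assms(1), of "Suc m"] by (intro mult_nonpos_nonpos) auto
  next
    case False
    then show ?thesis
      using power_mono[OF _ assms(2), of x "Suc m"] by (intro mult_nonneg_nonneg) auto
  qed
  then have "x * y ^ Suc m + x ^ Suc m * y \<le> x ^ Suc (Suc m) + y ^ Suc (Suc m)"
    by (simp add: algebra_simps)
  moreover have "real (Suc m) * (x * y ^ m) * y \<le> (x ^ Suc m + real m * y ^ Suc m) * y"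
    using Suc assms(2) by (rule mult_right_mono)
  then have "real (Suc m) * (x * y ^ Suc m) \<le> x ^ Suc m * y + real m * y ^ Suc (Suc m)"
    by (simp add: algebra_simps)
  ultimately show ?case
    by (simp add: algebra_simps)
qed simp

text \<open>A Young inequality with an arbitrarily small coefficient of the top power: either y is
  at most \<open>\<eta> * e\<close>, or e is less than \<open>y / \<eta>\<close>. It is applied to
  terms whose constant is irrelevant.\<close>

lemma absorb_power:
  fixes y e \<eta> :: real
  assumes "0 \<le> y" "0 \<le> e" "0 < \<eta>"
  shows "y * e ^ m \<le> \<eta> * e ^ Suc m + y ^ Suc m / \<eta> ^ m"
proof (cases "y \<le> \<eta> * e")
  case True
  then have "y * e ^ m \<le> \<eta> * e ^ Suc m"
    using mult_right_mono[OF True, of "e ^ m"] assms(2) by (simp add: mult_ac)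
  moreover have "0 \<le> y ^ Suc m / \<eta> ^ m"
    using assms by simp
  ultimately show ?thesis
    by linarith
next
  case False
  then have "e \<le> y / \<eta>"
    using assms by (simp add: field_simps)
  then have "y * e ^ m \<le> y * (y / \<eta>) ^ m"
    using assms by (intro mult_left_mono power_mono) auto
  also have "\<dots> = y ^ Suc m / \<eta> ^ m"
    by (simp add: power_divide)
  moreover have "0 \<le> \<eta> * e ^ Suc m"
    using assms by simp
  ultimately show ?thesis
    by linarith
qed

text \<open>Fatou's lemma also delivers integrability of the limit, which is not known beforehand
  whenever a cutoff is removed.\<close>

lemma fatou_real:
  fixes f :: "nat \<Rightarrow> 'a \<Rightarrow> real"
  assumes f: "\<And>i. integrable M (f i)" "\<And>i x. x \<in> space M \<Longrightarrow> 0 \<le> f i x"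
    and lim: "\<And>x. x \<in> space M \<Longrightarrow> (\<lambda>i. f i x) \<longlonglongrightarrow> g x"
    and le: "\<And>i. (\<integral>x. f i x \<partial>M) \<le> c"
  shows "integrable M g" "(\<integral>x. g x \<partial>M) \<le> c"
proof -
  have g_nonneg: "0 \<le> g x" if "x \<in> space M" for x
    using LIMSEQ_le_const[OF lim[OF that], of 0] f(2)[OF that] by auto
  have meas: "g \<in> borel_measurable M"
    by (rule borel_measurable_LIMSEQ_real[where u = f]) (use lim f(1) in auto)
  have "0 \<le> (\<integral>x. f 0 x \<partial>M)"
    using f(2) by (intro Bochner_Integration.integral_nonneg)
  with le[of 0] have c: "0 \<le> c"
    by linarith
  have "(\<integral>\<^sup>+x. ennreal (g x) \<partial>M) = (\<integral>\<^sup>+x. liminf (\<lambda>i. ennreal (f i x)) \<partial>M)"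
    by (rule nn_integral_cong) (auto intro!: lim_imp_Liminf[symmetric] tendsto_ennrealI lim)
  also have "\<dots> \<le> liminf (\<lambda>i. \<integral>\<^sup>+x. ennreal (f i x) \<partial>M)"
    using f(1) by (intro nn_integral_liminf) auto
  also have "\<dots> \<le> liminf (\<lambda>i. ennreal c)"
  proof (intro Liminf_mono always_eventually allI)
    fix i
    have "(\<integral>\<^sup>+x. ennreal (f i x) \<partial>M) = ennreal (\<integral>x. f i x \<partial>M)"
      using f by (intro nn_integral_eq_integral AE_I2)
    also have "\<dots> \<le> ennreal c"
      using le by (rule ennreal_leI)
    finally show "(\<integral>\<^sup>+x. ennreal (f i x) \<partial>M) \<le> ennreal c" .
  qed
  also have "\<dots> = ennreal c"
    by (simp add: Liminf_const)
  finally have nn: "(\<integral>\<^sup>+x. ennreal (g x) \<partial>M) \<le> ennreal c" .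
  then have "(\<integral>\<^sup>+x. ennreal (g x) \<partial>M) < \<infinity>"
    using le_less_trans[OF nn ennreal_less_top] by simp
  then show int: "integrable M g"
    using meas g_nonneg by (intro integrableI_nonneg AE_I2) auto
  have "ennreal (\<integral>x. g x \<partial>M) = (\<integral>\<^sup>+x. ennreal (g x) \<partial>M)"
    using int g_nonneg by (intro nn_integral_eq_integral[symmetric] AE_I2)
  with nn have "ennreal (\<integral>x. g x \<partial>M) \<le> ennreal c"
    by simp
  then show "(\<integral>x. g x \<partial>M) \<le> c"
    using c by (simp only: ennreal_le_iff)
qed

context moment_setting
begin

section \<open>Cutoff weights and their logarithmic derivatives\<close>

text \<open>The exponent meets two demands: 2 r + m to dominate the squared growth times the m-th
  power of \<open>ell k\<close>, and r (m + 1) to dominate the power m + 1 of the interaction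
  sum.\<close>

definition "expo m = (m + 2) * r"
definition "base \<epsilon> \<delta> k x = 1 + \<epsilon> * energy iXB x + \<delta> * ((norm (F0 k (x k)))\<^sup>2 + (ell k x)\<^sup>2)"
text \<open>The limit of \<open>chid\<close> as \<open>\<delta>\<close> vanishes; it is one function
  for all sites.\<close>

definition "chi \<epsilon> m x = inverse (1 + \<epsilon> * energy iXB x) ^ expo m"
definition "chid \<epsilon> \<delta> m k x = inverse (base \<epsilon> \<delta> k x) ^ expo m"

lemma expo_ge: "2 * r + m \<le> expo m" "r * Suc m \<le> expo m"
proof -
  have "m \<le> m * r"
    using r(2) by simp
  then show "2 * r + m \<le> expo m" "r * Suc m \<le> expo m"
    by (auto simp: expo_def algebra_simps)
qed

lemma base_ge:
  assumes "x \<in> configs" "0 \<le> \<epsilon>" "0 \<le> \<delta>"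
  shows "1 + \<epsilon> * energy iXB x \<le> base \<epsilon> \<delta> k x" "1 \<le> base \<epsilon> \<delta> k x"
    "\<delta> * ((norm (F0 k (x k)))\<^sup>2 + (ell k x)\<^sup>2) \<le> base \<epsilon> \<delta> k x"
  using assms energy_nonneg[of iXB x] by (auto simp: base_def)

lemma chi_bounds:
  assumes "0 \<le> \<epsilon>"
  shows "0 < chi \<epsilon> m x" "chi \<epsilon> m x \<le> 1"
proof -
  have "1 \<le> 1 + \<epsilon> * energy iXB x"
    using assms energy_nonneg[of iXB x] by simp
  then show "0 < chi \<epsilon> m x" "chi \<epsilon> m x \<le> 1"
    by (auto simp: chi_def power_inverse inverse_le_1_iff one_le_power)
qed

lemma chid_bounds:
  assumes "x \<in> configs" "0 \<le> \<epsilon>" "0 \<le> \<delta>"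
  shows "0 < chid \<epsilon> \<delta> m k x" "chid \<epsilon> \<delta> m k x \<le> chi \<epsilon> m x"
proof -
  show "0 < chid \<epsilon> \<delta> m k x"
    using base_ge(2)[OF assms, of k] by (simp add: chid_def)
  show "chid \<epsilon> \<delta> m k x \<le> chi \<epsilon> m x"
    unfolding chid_def chi_def
    using base_ge[OF assms, of k] energy_nonneg[of iXB x] assms(2)
    by (intro power_mono le_imp_inverse_le) (auto simp: add_pos_nonneg)
qed

lemma ell_deriv_le:
  assumes "x \<in> configs"
  shows "\<bar>F0 k (x k) (iXB (\<phi> n)) + dF0 k n (x k) (iXB (x k))\<bar> \<le> (K1 + K2) * ell k x"
  using drift_component_le[OF assms, of k n] drift_radial_le[OF assms, of n k]
  by (simp add: distrib_right)

text \<open>Each summand of \<open>base\<close> controls its own derivative. For the norm this is 2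
  t <= 1 + t^2, where \<open>\<epsilon>\<close> at most 1 lets the constant be absorbed. For the
  drift, \<open>hF0\<close> and \<open>site_power_le\<close> bound the derivative by a combination
  of |F0|, \<open>ell\<close> and 1. This is why \<open>ell\<close> is squared along with the drift,
  and \<open>ell\<close> itself has derivative at most \<open>(K1 + K2) * ell\<close>.\<close>

lemma base_log_deriv:
  "\<exists>C\<ge>0. \<forall>\<epsilon>\<in>{0<..1}. \<forall>\<delta>\<in>{0<..1}. \<forall>k n. \<exists>b'. smooth_along k n (base \<epsilon> \<delta> k) b' \<and>
    (\<forall>x\<in>configs. \<bar>b' x\<bar> \<le> C * base \<epsilon> \<delta> k x)"
proof -
  obtain \<kappa> where \<kappa>: "norm (iXB (\<phi> n)) \<le> \<kappa>" for n
    using eigenvectors_bounded by blast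
  have \<kappa>0: "0 \<le> \<kappa>"
    using \<kappa>[of 0] norm_ge_zero order_trans by blast
  \<comment> \<open>The first three summands come from the derivative of |F0|^2: the diagonal part,
    the mixed product of |F0| and \<open>ell\<close>, and the constant \<open>L0\<close>. The last
    one comes from the derivative of the square of \<open>ell\<close>.\<close>
  define C' where "C' = 2 * K0 + K0 * K3 + L0 + 2 * (K1 + K2)"
  have C': "0 \<le> C'"
    using pos nonneg by (simp add: C'_def)
  show ?thesis
  proof (intro exI[of _ "\<kappa> + C'"] conjI ballI allI)
    fix \<epsilon> \<delta> :: real and k n
    assume \<epsilon>: "\<epsilon> \<in> {0<..1}" and \<delta>: "\<delta> \<in> {0<..1}"
    let ?e' = "\<lambda>x. F0 k (x k) (iXB (\<phi> n)) + dF0 k n (x k) (iXB (x k))"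
    define b' where "b' x = \<epsilon> * (inverse (\<gamma> k) * sqnorm_deriv (iXB (x k)) (iXB (\<phi> n)))
      + \<delta> * (sqnorm_deriv (F0 k (x k)) (dF0 k n (x k)) + 2 * ell k x * ?e' x)" for x
    have "smooth_along k n (\<lambda>x. (1 + \<epsilon> * energy iXB x) + \<delta> * ((norm (F0 k (x k)))\<^sup>2 + (ell k x)\<^sup>2))
       (\<lambda>x. (0 + \<epsilon> * (inverse (\<gamma> k) * sqnorm_deriv (iXB (x k)) (iXB (\<phi> n))))
       + \<delta> * (sqnorm_deriv (F0 k (x k)) (dF0 k n (x k)) + real 2 * ell k x ^ (2 - 1) * ?e' x))"
      by (intro smooth_along_add smooth_along_cmult smooth_along_const smooth_along_energy
          smooth_along_norm_F0 smooth_along_power smooth_along_ell)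
    then have "smooth_along k n (base \<epsilon> \<delta> k) b'"
      by (simp add: base_def[abs_def] b'_def[abs_def])
    moreover have "\<bar>b' x\<bar> \<le> (\<kappa> + C') * base \<epsilon> \<delta> k x" if x: "x \<in> configs" for x
    proof -
      let ?N = "(norm (F0 k (x k)))\<^sup>2 + (ell k x)\<^sup>2"
      define f e where "f = norm (F0 k (x k))" and "e = ell k x"
      have f: "0 \<le> f" and e: "1 \<le> e"
        using ell_ge_1[OF x, of k] by (auto simp: f_def e_def)
      have U: "inverse (\<gamma> k) * (norm (iXB (x k)))\<^sup>2 \<le> energy iXB x"
        using site_norm_sq_le[OF x, of k] weight_pos[of k] by (simp add: field_simps)
      have inv: "0 \<le> inverse (\<gamma> k)" "inverse (\<gamma> k) \<le> 1"
        using weight_ge_1[of k] by (auto simp: inverse_le_1_iff)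
      have "\<bar>inverse (\<gamma> k) * sqnorm_deriv (iXB (x k)) (iXB (\<phi> n))\<bar>
          \<le> inverse (\<gamma> k) * (2 * norm (iXB (x k)) * norm (iXB (\<phi> n)))"
        unfolding abs_mult using inv abs_sqnorm_deriv_le[OF B_norm_differentiable]
        by (intro mult_mono) auto
      also have "\<dots> \<le> inverse (\<gamma> k) * ((1 + (norm (iXB (x k)))\<^sup>2) * \<kappa>)"
      proof (intro mult_left_mono mult_mono \<kappa>)
        show "2 * norm (iXB (x k)) \<le> 1 + (norm (iXB (x k)))\<^sup>2"
          using sum_squares_bound[of 1 "norm (iXB (x k))"] by simp
      qed (use inv in auto)
      also have "\<dots> = \<kappa> * (inverse (\<gamma> k) + inverse (\<gamma> k) * (norm (iXB (x k)))\<^sup>2)"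
        by (simp add: algebra_simps)
      also have "\<dots> \<le> \<kappa> * (1 + energy iXB x)"
        using inv U \<kappa>0 by (intro mult_left_mono add_mono) auto
      finally have "\<epsilon> * \<bar>inverse (\<gamma> k) * sqnorm_deriv (iXB (x k)) (iXB (\<phi> n))\<bar>
          \<le> \<epsilon> * (\<kappa> * (1 + energy iXB x))"
        using \<epsilon> by (intro mult_left_mono) auto
      also have "\<dots> = \<kappa> * (\<epsilon> + \<epsilon> * energy iXB x)"
        by (simp add: algebra_simps)
      also have "\<dots> \<le> \<kappa> * base \<epsilon> \<delta> k x"
        using base_ge(1)[OF x, of \<epsilon> \<delta> k] \<epsilon> \<delta> \<kappa>0 by (intro mult_left_mono) auto
      finally have one: "\<bar>\<epsilon> * (inverse (\<gamma> k) * sqnorm_deriv (iXB (x k)) (iXB (\<phi> n)))\<bar>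
          \<le> \<kappa> * base \<epsilon> \<delta> k x"
        using \<epsilon> by (simp add: abs_mult)
      have "norm (dF0 k n (x k)) \<le> K0 * (f + K3 * e) + L0"
        unfolding e_def f_def using site_power_le[OF x, of k] pos
        by (intro order_trans[OF hF0[OF x, of n k]] add_mono mult_left_mono order_refl) auto
      then have "2 * f * norm (dF0 k n (x k)) \<le> 2 * f * (K0 * (f + K3 * e) + L0)"
        using f by (intro mult_left_mono) auto
      also have "\<dots> = 2 * K0 * f\<^sup>2 + K0 * K3 * (2 * f * e) + L0 * (2 * f * 1)"
        by (simp add: algebra_simps power2_eq_square)
      also have "\<dots> \<le> 2 * K0 * (f\<^sup>2 + e\<^sup>2) + K0 * K3 * (f\<^sup>2 + e\<^sup>2) + L0 * (f\<^sup>2 + e\<^sup>2)"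
      proof (intro add_mono mult_left_mono)
        show "2 * f * e \<le> f\<^sup>2 + e\<^sup>2"
          by (rule sum_squares_bound)
        have "1 \<le> e\<^sup>2"
          using e by (simp add: one_le_power)
        then show "2 * f * 1 \<le> f\<^sup>2 + e\<^sup>2"
          using sum_squares_bound[of f 1] by simp
      qed (use pos nonneg in auto)
      finally have "\<bar>sqnorm_deriv (F0 k (x k)) (dF0 k n (x k))\<bar> \<le> (2 * K0 + K0 * K3 + L0) * (f\<^sup>2 + e\<^sup>2)"
        using abs_sqnorm_deriv_le[OF dual_norm_differentiable, of "F0 k (x k)" "dF0 k n (x k)"]
        by (simp add: f_def distrib_right)
      moreover have "\<bar>2 * ell k x * ?e' x\<bar> \<le> 2 * (K1 + K2) * (f\<^sup>2 + e\<^sup>2)"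
      proof -
        have "\<bar>2 * ell k x * ?e' x\<bar> \<le> (2 * e) * ((K1 + K2) * e)"
          unfolding abs_mult using ell_deriv_le[OF x, of k n] e by (intro mult_mono) (auto simp: e_def)
        also have "\<dots> = 2 * (K1 + K2) * e\<^sup>2"
          by (simp add: power2_eq_square mult_ac)
        also have "\<dots> \<le> 2 * (K1 + K2) * (f\<^sup>2 + e\<^sup>2)"
          using pos by (intro mult_left_mono) auto
        finally show ?thesis .
      qed
      ultimately have "\<bar>sqnorm_deriv (F0 k (x k)) (dF0 k n (x k)) + 2 * ell k x * ?e' x\<bar> \<le> C' * ?N"
        unfolding C'_def f_def[symmetric] e_def[symmetric] distrib_right by linarith
      then have "\<delta> * \<bar>sqnorm_deriv (F0 k (x k)) (dF0 k n (x k)) + 2 * ell k x * ?e' x\<bar> \<le> \<delta> * (C' * ?N)"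
        using \<delta> by (intro mult_left_mono) auto
      also have "\<dots> = C' * (\<delta> * ?N)"
        by (simp add: mult_ac)
      also have "\<dots> \<le> C' * base \<epsilon> \<delta> k x"
        using base_ge(3)[OF x, of \<epsilon> \<delta> k] \<epsilon> \<delta> C' by (intro mult_left_mono) auto
      finally have two: "\<bar>\<delta> * (sqnorm_deriv (F0 k (x k)) (dF0 k n (x k)) + 2 * ell k x * ?e' x)\<bar>
          \<le> C' * base \<epsilon> \<delta> k x"
        using \<delta> by (simp add: abs_mult)
      show ?thesis
        unfolding b'_def distrib_right by (rule order_trans[OF abs_triangle_ineq add_mono[OF one two]])
    qed
    ultimately show "\<exists>b'. smooth_along k n (base \<epsilon> \<delta> k) b' \<and>
        (\<forall>x\<in>configs. \<bar>b' x\<bar> \<le> (\<kappa> + C') * base \<epsilon> \<delta> k x)"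
      by blast
  qed (use \<kappa>0 C' in auto)
qed

text \<open>Logarithmic derivatives of factors add up: m times that of \<open>ell k\<close> and
  \<open>expo m\<close> times that of \<open>base\<close>. Uniformity in both cutoffs and in the
  site is inherited.\<close>

lemma weight_log_deriv:
  "\<exists>C\<ge>0. \<forall>\<epsilon>\<in>{0<..1}. \<forall>\<delta>\<in>{0<..1}. \<forall>k. \<exists>\<Psi>'. \<forall>n.
    smooth_along k n (\<lambda>x. ell k x ^ m * chid \<epsilon> \<delta> m k x) (\<Psi>' n) \<and>
    (\<forall>x\<in>configs. \<bar>\<Psi>' n x\<bar> \<le> C * (ell k x ^ m * chid \<epsilon> \<delta> m k x))"
proof -
  obtain C where C: "0 \<le> C" and ex: "\<forall>\<epsilon>\<in>{0<..1}. \<forall>\<delta>\<in>{0<..1}. \<forall>k n. \<exists>b'. smooth_along k n (base \<epsilon> \<delta> k) b' \<and>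
    (\<forall>x\<in>configs. \<bar>b' x\<bar> \<le> C * base \<epsilon> \<delta> k x)"
    using base_log_deriv by blast
  define p where "p = expo m"
  show ?thesis
  proof (intro exI[of _ "real m * (K1 + K2) + real p * C"] conjI ballI allI)
    fix \<epsilon> \<delta> :: real and k
    assume \<epsilon>: "\<epsilon> \<in> {0<..1}" and \<delta>: "\<delta> \<in> {0<..1}"
    have "\<forall>n. \<exists>b'. smooth_along k n (base \<epsilon> \<delta> k) b' \<and> (\<forall>x\<in>configs. \<bar>b' x\<bar> \<le> C * base \<epsilon> \<delta> k x)"
      using ex \<epsilon> \<delta> by blast
    from choice[OF this] obtain b' where b': "\<And>n. smooth_along k n (base \<epsilon> \<delta> k) (b' n)"
      "\<And>n x. x \<in> configs \<Longrightarrow> \<bar>b' n x\<bar> \<le> C * base \<epsilon> \<delta> k x"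
      by blast
    let ?e' = "\<lambda>n x. F0 k (x k) (iXB (\<phi> n)) + dF0 k n (x k) (iXB (x k))"
    let ?b = "base \<epsilon> \<delta> k"
    have b1: "1 \<le> ?b x" if "x \<in> configs" for x
      using base_ge(2)[OF that, of \<epsilon> \<delta> k] \<epsilon> \<delta> by simp
    define \<Psi>' where "\<Psi>' n x = (real m * ell k x ^ (m - 1) * ?e' n x) * inverse (?b x) ^ p
      + ell k x ^ m * (real p * inverse (?b x) ^ (p - 1) * - (b' n x / (?b x)\<^sup>2))" for n x
    have "smooth_along k n (\<lambda>x. ell k x ^ m * chid \<epsilon> \<delta> m k x) (\<Psi>' n)" for n
      unfolding \<Psi>'_def[abs_def] chid_def p_def[symmetric]
      using b1 by (intro smooth_along_mult smooth_along_power smooth_along_ell smooth_along_inverse b') force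
    moreover have "\<bar>\<Psi>' n x\<bar> \<le> (real m * (K1 + K2) + real p * C) * (ell k x ^ m * chid \<epsilon> \<delta> m k x)"
      if x: "x \<in> configs" for n x
    proof -
      define e i where "e = ell k x" and "i = inverse (?b x)"
      have e: "0 \<le> e" and i: "0 < i"
        using ell_ge_1[OF x, of k] b1[OF x] by (auto simp: e_def i_def)
      have "\<bar>real m * e ^ (m - 1) * ?e' n x\<bar> \<le> real m * (K1 + K2) * e ^ m"
      \<comment> \<open>For m = 0 the truncated exponent m - 1 is harmless, as the factor
        \<open>real m\<close> vanishes.\<close>
      proof (cases m)
        case (Suc m')
        have "\<bar>real m * e ^ (m - 1) * ?e' n x\<bar> \<le> (real m * e ^ (m - 1)) * ((K1 + K2) * e)"
          unfolding abs_mult using ell_deriv_le[OF x, of k n] e by (intro mult_mono) (auto simp: e_def)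
        then show ?thesis
          using Suc by (simp add: mult_ac)
      qed simp
      then have one: "\<bar>real m * e ^ (m - 1) * ?e' n x * i ^ p\<bar> \<le> real m * (K1 + K2) * e ^ m * i ^ p"
        using i unfolding abs_mult[of _ "i ^ p"] by (simp add: mult_right_mono)
      have "\<bar>b' n x / (?b x)\<^sup>2\<bar> \<le> C * i"
        using b'(2)[OF x, of n] b1[OF x]
        by (simp add: i_def power2_eq_square abs_mult divide_simps mult_ac)
      then have "\<bar>real p * i ^ (p - 1) * - (b' n x / (?b x)\<^sup>2)\<bar> \<le> real p * C * i ^ p"
      proof (cases p)
        case (Suc p')
        assume le: "\<bar>b' n x / (?b x)\<^sup>2\<bar> \<le> C * i"
        have "\<bar>real p * i ^ (p - 1) * - (b' n x / (?b x)\<^sup>2)\<bar> = (real p * i ^ (p - 1)) * \<bar>b' n x / (?b x)\<^sup>2\<bar>"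
          using i by (simp add: abs_mult)
        also have "\<dots> \<le> (real p * i ^ (p - 1)) * (C * i)"
          using le i by (intro mult_left_mono) auto
        finally show ?thesis
          using Suc by (simp add: mult_ac)
      qed simp
      then have two: "\<bar>e ^ m * (real p * i ^ (p - 1) * - (b' n x / (?b x)\<^sup>2))\<bar> \<le> e ^ m * (real p * C * i ^ p)"
        unfolding abs_mult[of "e ^ m"] power_abs abs_of_nonneg[OF e]
        by (rule mult_left_mono) (use e in simp)
      have "\<bar>\<Psi>' n x\<bar> \<le> real m * (K1 + K2) * e ^ m * i ^ p + e ^ m * (real p * C * i ^ p)"
        unfolding \<Psi>'_def e_def[symmetric] i_def[symmetric]
        by (rule order_trans[OF abs_triangle_ineq add_mono[OF one two]])
      also have "\<dots> = (real m * (K1 + K2) + real p * C) * (ell k x ^ m * chid \<epsilon> \<delta> m k x)"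
        by (simp add: e_def i_def chid_def p_def algebra_simps)
      finally show ?thesis .
    qed
    ultimately show "\<exists>\<Psi>'. \<forall>n. smooth_along k n (\<lambda>x. ell k x ^ m * chid \<epsilon> \<delta> m k x) (\<Psi>' n) \<and>
      (\<forall>x\<in>configs. \<bar>\<Psi>' n x\<bar> \<le> (real m * (K1 + K2) + real p * C) * (ell k x ^ m * chid \<epsilon> \<delta> m k x))"
      by blast
  qed (use C pos in auto)
qed

lemma energy_le_base:
  assumes "x \<in> configs" "0 < \<epsilon>" "\<epsilon> \<le> 1" "0 \<le> \<delta>"
  shows "1 + energy iXB x \<le> base \<epsilon> \<delta> k x / \<epsilon>" "1 + energy iXB x \<le> (1 + \<epsilon> * energy iXB x) / \<epsilon>"
proof -
  have "\<epsilon> * (1 + energy iXB x) \<le> 1 + \<epsilon> * energy iXB x"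
    using assms by (simp add: distrib_left)
  moreover note base_ge(1)[OF assms(1), of \<epsilon> \<delta> k]
  ultimately show "1 + energy iXB x \<le> base \<epsilon> \<delta> k x / \<epsilon>" "1 + energy iXB x \<le> (1 + \<epsilon> * energy iXB x) / \<epsilon>"
    using assms by (auto simp: field_simps)
qed

text \<open>Every summand of \<open>growth\<close> is at most a constant times the r-th power of
  \<open>base\<close>, and \<open>ell\<close> is at most \<open>base\<close> divided by
  \<open>\<delta>\<close>. The constants explode as the cutoffs vanish, but only existence of a
  bound is needed.\<close>

lemma weight_growth_bound:
  assumes \<epsilon>: "\<epsilon> \<in> {0<..1}" and \<delta>: "\<delta> \<in> {0<..1}"
  shows "\<exists>Bd. \<forall>x\<in>configs. (growth k x)\<^sup>2 * (ell k x ^ m * chid \<epsilon> \<delta> m k x) \<le> Bd"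
proof -
  \<comment> \<open>The summands correspond one by one to those of \<open>growth\<close>.\<close>
  define c where "c = 1 + \<gamma> k / \<epsilon> + 1 / \<delta> + 1 / \<delta> + \<gamma> k powr R * Jnorm / \<epsilon> ^ r"
  have "(growth k x)\<^sup>2 * (ell k x ^ m * chid \<epsilon> \<delta> m k x) \<le> c\<^sup>2 / \<delta> ^ m" if x: "x \<in> configs" for x
  proof -
    define w where "w = base \<epsilon> \<delta> k x"
    have w: "1 \<le> w"
      using base_ge(2)[OF x, of \<epsilon> \<delta> k] \<epsilon> \<delta> by (simp add: w_def)
    have U: "0 \<le> 1 + energy iXB x" "1 + energy iXB x \<le> w / \<epsilon>"
      using energy_le_base(1)[OF x, of \<epsilon> \<delta> k] energy_nonneg[of iXB x] \<epsilon> \<delta> by (auto simp: w_def)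
    have wr: "w \<le> w ^ r"
      using w r(2) by (simp add: self_le_power)
    have N: "(norm (F0 k (x k)))\<^sup>2 + (ell k x)\<^sup>2 \<le> w / \<delta>"
      using base_ge(3)[OF x, of \<epsilon> \<delta> k] \<epsilon> \<delta> by (simp add: w_def field_simps)
    have e: "1 \<le> ell k x" "ell k x \<le> (ell k x)\<^sup>2" "1 \<le> (ell k x)\<^sup>2"
      using ell_ge_1[OF x, of k] by (auto simp: self_le_power one_le_power)
    have ew: "ell k x \<le> w / \<delta>"
      using N e(2) zero_le_power2[of "norm (F0 k (x k))"] by linarith
    \<comment> \<open>The additive 1 is paid for by the square of \<open>ell\<close>, which is at
      least 1.\<close>
    have "norm (F0 k (x k)) \<le> (norm (F0 k (x k)))\<^sup>2 + 1"
      using sum_squares_bound[of "norm (F0 k (x k))" 1] norm_ge_zero[of "F0 k (x k)"]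
      by (simp only: mult_1_right one_power2)
    then have Fw: "norm (F0 k (x k)) \<le> w / \<delta>"
      using N e(3) by linarith
    have "norm (iXB (x k)) \<le> \<gamma> k * (w / \<epsilon>)"
      using site_norm_le[OF x, of k] U(2) weight_pos[of k] by (meson less_imp_le mult_left_mono order_trans)
    then have xw: "norm (iXB (x k)) \<le> \<gamma> k / \<epsilon> * w ^ r"
      using wr \<epsilon> weight_pos[of k] mult_left_mono[OF wr, of "\<gamma> k / \<epsilon>"] by simp
    have "S k x \<le> \<gamma> k powr R * Jnorm * (w / \<epsilon>) ^ r"
      by (rule order_trans[OF S_le[OF x]]) (intro mult_left_mono power_mono U mult_nonneg_nonneg Jnorm_nonneg; simp)
    then have Sw: "S k x \<le> \<gamma> k powr R * Jnorm / \<epsilon> ^ r * w ^ r"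
      by (simp add: power_divide)
    have wd: "w / \<delta> \<le> 1 / \<delta> * w ^ r"
      using wr \<delta> by (simp add: divide_right_mono)
    have "growth k x \<le> 1 * w ^ r + \<gamma> k / \<epsilon> * w ^ r + 1 / \<delta> * w ^ r + 1 / \<delta> * w ^ r
        + \<gamma> k powr R * Jnorm / \<epsilon> ^ r * w ^ r"
      unfolding growth_def using xw Sw Fw ew wd w wr by (intro add_mono) linarith+
    then have g: "growth k x \<le> c * w ^ r"
      by (simp only: c_def distrib_right)
    have "(growth k x)\<^sup>2 * ell k x ^ m \<le> (c * w ^ r)\<^sup>2 * (w / \<delta>) ^ m"
      using g ew e(1) growth_lower(1)[OF x, of k] by (intro mult_mono power_mono) auto
    also have "\<dots> = c\<^sup>2 / \<delta> ^ m * w ^ (2 * r + m)"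
      by (simp add: power_mult_distrib power_divide power_add power_mult[symmetric] mult_ac)
    also have "\<dots> \<le> c\<^sup>2 / \<delta> ^ m * w ^ expo m"
      using w expo_ge(1)[of m] \<delta> by (intro mult_left_mono power_increasing) auto
    finally have "(growth k x)\<^sup>2 * ell k x ^ m * inverse w ^ expo m \<le> c\<^sup>2 / \<delta> ^ m * w ^ expo m * inverse w ^ expo m"
      using w by (intro mult_right_mono) auto
    also have "\<dots> = c\<^sup>2 / \<delta> ^ m"
      using w by (simp add: power_inverse)
    finally show ?thesis
      by (simp add: chid_def w_def mult_ac)
  qed
  then show ?thesis
    by blast
qed

lemma cutoff_inequality:
  "\<exists>C\<ge>0. \<forall>\<mu>\<in>\<M>. \<forall>\<epsilon>\<in>{0<..1}. \<forall>\<delta>\<in>{0<..1}. \<forall>k.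
    integrable \<mu> (\<lambda>x. ell k x ^ Suc m * chid \<epsilon> \<delta> m k x) \<and>
    integrable \<mu> (\<lambda>x. S k x * ell k x ^ m * chid \<epsilon> \<delta> m k x) \<and>
    integrable \<mu> (\<lambda>x. ell k x ^ m * chid \<epsilon> \<delta> m k x) \<and>
    (1 - K1 * Tr) * (\<integral>x. ell k x ^ Suc m * chid \<epsilon> \<delta> m k x \<partial>\<mu>)
      \<le> (M2 + M1 * Tr) * (\<integral>x. S k x * ell k x ^ m * chid \<epsilon> \<delta> m k x \<partial>\<mu>)
        + C * (\<integral>x. ell k x ^ m * chid \<epsilon> \<delta> m k x \<partial>\<mu>)"
proof -
  obtain C where C: "0 \<le> C" and ex: "\<forall>\<epsilon>\<in>{0<..1}. \<forall>\<delta>\<in>{0<..1}. \<forall>k. \<exists>\<Psi>'. \<forall>n.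
    smooth_along k n (\<lambda>x. ell k x ^ m * chid \<epsilon> \<delta> m k x) (\<Psi>' n) \<and>
    (\<forall>x\<in>configs. \<bar>\<Psi>' n x\<bar> \<le> C * (ell k x ^ m * chid \<epsilon> \<delta> m k x))"
    using weight_log_deriv[of m] by blast
  have Tr: "0 \<le> Tr"
    unfolding trace_inv_def using trace_class lam_pos by (intro suminf_nonneg) (auto simp: less_imp_le)
  show ?thesis
  proof (intro exI[of _ "shift + N2 + Tr * (N1 + C\<^sup>2 / 4)"] conjI[of "0 \<le> _"] ballI allI)
    have "0 \<le> L1 / K1" "0 \<le> L2 / K2" "0 \<le> 2 * L3 / K3"
      using pos nonneg by auto
    then have "0 \<le> shift"
      by (simp add: shift_def)
    then show "0 \<le> shift + N2 + Tr * (N1 + C\<^sup>2 / 4)"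
      using nonneg Tr by (intro add_nonneg_nonneg mult_nonneg_nonneg) auto
    fix \<mu> and \<epsilon> \<delta> :: real and k
    assume \<mu>: "\<mu> \<in> \<M>" and \<epsilon>: "\<epsilon> \<in> {0<..1}" and \<delta>: "\<delta> \<in> {0<..1}"
    obtain Bd where Bd: "\<And>x. x \<in> configs \<Longrightarrow> (growth k x)\<^sup>2 * (ell k x ^ m * chid \<epsilon> \<delta> m k x) \<le> Bd"
      using weight_growth_bound[OF \<epsilon> \<delta>] by blast
    have "\<exists>\<Psi>'. \<forall>n. smooth_along k n (\<lambda>x. ell k x ^ m * chid \<epsilon> \<delta> m k x) (\<Psi>' n) \<and>
      (\<forall>x\<in>configs. \<bar>\<Psi>' n x\<bar> \<le> C * (ell k x ^ m * chid \<epsilon> \<delta> m k x))"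
      using ex \<epsilon> \<delta> by blast
    then obtain \<Psi>' where \<Psi>': "\<And>n. smooth_along k n (\<lambda>x. ell k x ^ m * chid \<epsilon> \<delta> m k x) (\<Psi>' n)"
      "\<And>n x. x \<in> configs \<Longrightarrow> \<bar>\<Psi>' n x\<bar> \<le> C * (ell k x ^ m * chid \<epsilon> \<delta> m k x)"
      by blast
    have nn: "0 \<le> ell k x ^ m * chid \<epsilon> \<delta> m k x" if "x \<in> configs" for x
      using ell_ge_1[OF that, of k] chid_bounds(1)[OF that, of \<epsilon> \<delta> m k] \<epsilon> \<delta> by simp
    note facts = \<mu> \<Psi>'(1) nn \<Psi>'(2) C Bd
    show "integrable \<mu> (\<lambda>x. ell k x ^ Suc m * chid \<epsilon> \<delta> m k x) \<and>
      integrable \<mu> (\<lambda>x. S k x * ell k x ^ m * chid \<epsilon> \<delta> m k x) \<and>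
      integrable \<mu> (\<lambda>x. ell k x ^ m * chid \<epsilon> \<delta> m k x) \<and>
      (1 - K1 * Tr) * (\<integral>x. ell k x ^ Suc m * chid \<epsilon> \<delta> m k x \<partial>\<mu>)
        \<le> (M2 + M1 * Tr) * (\<integral>x. S k x * ell k x ^ m * chid \<epsilon> \<delta> m k x \<partial>\<mu>)
        + (shift + N2 + Tr * (N1 + C\<^sup>2 / 4)) * (\<integral>x. ell k x ^ m * chid \<epsilon> \<delta> m k x \<partial>\<mu>)"
      using basic_integrable[OF facts] basic_inequality[OF facts] by (simp add: mult.assoc)
  qed
qed

lemma Tr_nonneg: "0 \<le> Tr"
  unfolding trace_inv_def using trace_class lam_pos by (intro suminf_nonneg) (auto simp: less_imp_le)

lemma weight_powr_ge_1: "1 \<le> \<gamma> k powr R"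
  using weight_ge_1[of k] R by (simp add: ge_one_powr_ge_zero)

section \<open>A priori bounds and the limit of vanishing \<open>\<delta>\<close>\<close>

text \<open>For fixed \<open>\<epsilon>\<close> the interaction is a bounded source, since
  \<open>chi\<close> beats the power of the energy in \<open>S_le\<close>. The price is a factor
  growing with the site and with 1 / \<open>\<epsilon>\<close>.\<close>

lemma source_bound:
  assumes x: "x \<in> configs" and \<epsilon>: "\<epsilon> \<in> {0<..1}" and "0 \<le> B" "0 \<le> C"
  shows "(B * S k x + C) ^ Suc m * chi \<epsilon> m x \<le> ((B * Jnorm + C) * \<gamma> k powr R) ^ Suc m / \<epsilon> ^ expo m"
proof -
  define g v w where "g = \<gamma> k powr R" and "v = 1 + energy iXB x" and "w = 1 + \<epsilon> * energy iXB x"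
  have v: "1 \<le> v" and w: "1 \<le> w"
    using energy_nonneg[of iXB x] \<epsilon> by (auto simp: v_def w_def)
  have vw: "v \<le> w / \<epsilon>"
    using energy_le_base(2)[OF x, of \<epsilon> 0] \<epsilon> by (simp add: v_def w_def)
  have g: "1 \<le> g"
    by (simp add: g_def weight_powr_ge_1)
  have vr: "1 \<le> v ^ r"
    using v by (rule one_le_power)
  have "B * S k x + C * 1 \<le> B * (g * Jnorm * v ^ r) + C * (g * v ^ r)"
    using S_le[OF x, of k] assms(3,4) mult_mono[OF g vr] g
    by (intro add_mono mult_left_mono) (auto simp: g_def v_def)
  then have "B * S k x + C \<le> (B * Jnorm + C) * g * v ^ r"
    by (simp add: algebra_simps)
  moreover have "0 \<le> B * S k x + C"
    using assms(3,4) S_nonneg by simp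
  ultimately have "(B * S k x + C) ^ Suc m \<le> ((B * Jnorm + C) * g * v ^ r) ^ Suc m"
    by (intro power_mono)
  also have "\<dots> = ((B * Jnorm + C) * g) ^ Suc m * v ^ (r * Suc m)"
    by (simp only: power_mult_distrib power_mult)
  also have "\<dots> \<le> ((B * Jnorm + C) * g) ^ Suc m * v ^ expo m"
    using v assms(3,4) g Jnorm_nonneg
    by (intro mult_left_mono power_increasing expo_ge(2) zero_le_power mult_nonneg_nonneg add_nonneg_nonneg) auto
  also have "\<dots> \<le> ((B * Jnorm + C) * g) ^ Suc m * (w / \<epsilon>) ^ expo m"
    using v vw assms(3,4) g Jnorm_nonneg
    by (intro mult_left_mono power_mono zero_le_power mult_nonneg_nonneg add_nonneg_nonneg) auto
  finally have "(B * S k x + C) ^ Suc m * inverse w ^ expo m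
      \<le> ((B * Jnorm + C) * g) ^ Suc m * (w / \<epsilon>) ^ expo m * inverse w ^ expo m"
    using w by (intro mult_right_mono) auto
  also have "\<dots> = ((B * Jnorm + C) * g) ^ Suc m / \<epsilon> ^ expo m"
    using w by (simp add: power_divide power_inverse)
  finally show ?thesis
    by (simp add: chi_def w_def g_def)
qed

lemma chid_LIMSEQ:
  assumes "0 \<le> \<epsilon>"
  shows "(\<lambda>i. chid \<epsilon> (inverse (real (Suc i))) m k x) \<longlonglongrightarrow> chi \<epsilon> m x"
proof -
  have "1 + \<epsilon> * energy iXB x > 0"
    using assms energy_nonneg[of iXB x] by (simp add: add_pos_nonneg)
  then have "(\<lambda>i. chid \<epsilon> (inverse (real (Suc i))) m k x) \<longlonglongrightarrow>
      inverse (1 + \<epsilon> * energy iXB x + 0 * ((norm (F0 k (x k)))\<^sup>2 + (ell k x)\<^sup>2)) ^ expo m"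
    unfolding chid_def base_def
    by (intro tendsto_intros LIMSEQ_inverse_real_of_nat) auto
  then show ?thesis
    by (simp add: chi_def)
qed

lemma chi_LIMSEQ: "(\<lambda>i. chi (inverse (real (Suc i))) m x) \<longlonglongrightarrow> 1"
proof -
  have "(\<lambda>i. chi (inverse (real (Suc i))) m x) \<longlonglongrightarrow> inverse (1 + 0 * energy iXB x) ^ expo m"
    unfolding chi_def by (intro tendsto_intros LIMSEQ_inverse_real_of_nat) auto
  then show ?thesis
    by simp
qed

lemma inverse_Suc_in: "inverse (real (Suc i)) \<in> {0<..1}"
  by (auto simp: inverse_le_1_iff)

lemma continuous_map_chi: "0 \<le> \<epsilon> \<Longrightarrow> continuous_map ctop euclidean (chi \<epsilon> m)"
  using continuous_map_energy[of iXB] energy_nonneg[of iXB] unfolding continuous_map_ctop_iff chi_def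
  by (auto intro!: tendsto_intros simp: add_nonneg_eq_0_iff)

context
  fixes \<mu> :: "('k \<Rightarrow> 'x) measure"
  assumes \<mu>: "\<mu> \<in> \<M>"
begin

lemma ell_measurable: "ell k \<in> borel_measurable \<mu>"
  by (rule measurable_\<mu>[OF \<mu> continuous_map_ell])

lemma chi_measurable: "0 \<le> \<epsilon> \<Longrightarrow> chi \<epsilon> m \<in> borel_measurable \<mu>"
  by (rule measurable_\<mu>[OF \<mu> continuous_map_chi])

lemma integrable_const_\<mu>: "integrable \<mu> (\<lambda>_. c :: real)"
  by (rule finite_measure.integrable_const[OF finite_measure_\<mu>[OF \<mu>]])

lemma total_mass: "measure \<mu> (space \<mu>) = 1"
  using \<mu>_prob[OF \<mu>] by (simp add: borel_prob_def measure_def)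

text \<open>By \<open>absorb_power\<close> the mixed term is at most the top power of
  \<open>ell\<close> plus a power of the interaction sum, which is bounded under the cutoff. The
  other term uses \<open>ell\<close> at least 1.\<close>

lemma cutoff_integrable:
  assumes \<epsilon>: "\<epsilon> \<in> {0<..1}" and int: "integrable \<mu> (\<lambda>x. ell k x ^ Suc m * chi \<epsilon> m x)"
  shows "integrable \<mu> (\<lambda>x. S k x * ell k x ^ m * chi \<epsilon> m x)" "integrable \<mu> (\<lambda>x. ell k x ^ m * chi \<epsilon> m x)"
proof -
  note [measurable] = ell_measurable S_measurable[OF \<mu>] chi_measurable
  have \<epsilon>0: "0 \<le> \<epsilon>"
    using \<epsilon> by simp
  have [measurable]: "chi \<epsilon> m \<in> borel_measurable \<mu>"
    by (rule chi_measurable[OF \<epsilon>0])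
  define c where "c = ((1 * Jnorm + 0) * \<gamma> k powr R) ^ Suc m / \<epsilon> ^ expo m"
  have "integrable \<mu> (\<lambda>x. ell k x ^ Suc m * chi \<epsilon> m x + c)"
    using int integrable_const_\<mu> by (rule Bochner_Integration.integrable_add)
  then show "integrable \<mu> (\<lambda>x. S k x * ell k x ^ m * chi \<epsilon> m x)"
  proof (rule Bochner_Integration.integrable_bound)
    show "AE x in \<mu>. norm (S k x * ell k x ^ m * chi \<epsilon> m x) \<le> norm (ell k x ^ Suc m * chi \<epsilon> m x + c)"
    proof (rule AE_I2)
      fix x assume "x \<in> space \<mu>"
      then have x: "x \<in> configs"
        by (simp add: space_\<mu>[OF \<mu>])
      have e: "0 \<le> ell k x"
        using ell_ge_1[OF x, of k] by simp
      have "S k x * ell k x ^ m * chi \<epsilon> m x \<le> (1 * ell k x ^ Suc m + S k x ^ Suc m / 1 ^ m) * chi \<epsilon> m x"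
        using chi_bounds(1)[OF \<epsilon>0, of m x] e S_nonneg by (intro mult_right_mono absorb_power) auto
      also have "\<dots> = ell k x ^ Suc m * chi \<epsilon> m x + S k x ^ Suc m * chi \<epsilon> m x"
        by (simp add: distrib_right)
      also have "\<dots> \<le> ell k x ^ Suc m * chi \<epsilon> m x + c"
        using source_bound[OF x \<epsilon>, of 1 0 k m] by (simp add: c_def)
      finally have "S k x * ell k x ^ m * chi \<epsilon> m x \<le> ell k x ^ Suc m * chi \<epsilon> m x + c" .
      moreover have "0 \<le> S k x * ell k x ^ m * chi \<epsilon> m x"
        using chi_bounds(1)[OF \<epsilon>0, of m x] e S_nonneg[of k x] by simp
      ultimately show "norm (S k x * ell k x ^ m * chi \<epsilon> m x) \<le> norm (ell k x ^ Suc m * chi \<epsilon> m x + c)"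
        by simp
    qed
  qed measurable
  show "integrable \<mu> (\<lambda>x. ell k x ^ m * chi \<epsilon> m x)"
    using int
  proof (rule Bochner_Integration.integrable_bound)
    show "AE x in \<mu>. norm (ell k x ^ m * chi \<epsilon> m x) \<le> norm (ell k x ^ Suc m * chi \<epsilon> m x)"
    proof (rule AE_I2)
      fix x assume "x \<in> space \<mu>"
      then have x: "x \<in> configs"
        by (simp add: space_\<mu>[OF \<mu>])
      have "ell k x ^ m \<le> ell k x ^ Suc m"
        using ell_ge_1[OF x, of k] by (intro power_increasing) auto
      then show "norm (ell k x ^ m * chi \<epsilon> m x) \<le> norm (ell k x ^ Suc m * chi \<epsilon> m x)"
        using chi_bounds(1)[OF \<epsilon>0, of m x] ell_ge_1[OF x, of k]
        by (simp add: abs_mult mult_right_mono)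
    qed
  qed measurable
qed

end

text \<open>The cutoff \<open>\<delta>\<close> makes the top moment finite, so half of the left side
  can absorb it while the interaction is treated as a bounded source. The resulting estimate does
  not involve \<open>\<delta>\<close>. Its constant depends on \<open>\<epsilon>\<close> and is used
  later only to know that a supremum is finite; the last inequality, whose \<open>C\<close> is
  independent of \<open>\<epsilon>\<close>, is the one that is iterated.\<close>

lemma local_cutoff_limit:
  assumes a: "K1 * Tr < 1"
  shows "\<exists>C\<ge>0. \<forall>\<epsilon>\<in>{0<..1}. \<exists>c\<ge>0. \<forall>\<mu>\<in>\<M>. \<forall>k.
    integrable \<mu> (\<lambda>x. ell k x ^ Suc m * chi \<epsilon> m x) \<and>
    (\<integral>x. ell k x ^ Suc m * chi \<epsilon> m x \<partial>\<mu>) \<le> c * (\<gamma> k powr R) ^ Suc m \<and>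
    (1 - K1 * Tr) * (\<integral>x. ell k x ^ Suc m * chi \<epsilon> m x \<partial>\<mu>)
      \<le> (M2 + M1 * Tr) * (\<integral>x. S k x * ell k x ^ m * chi \<epsilon> m x \<partial>\<mu>)
        + C * (\<integral>x. ell k x ^ m * chi \<epsilon> m x \<partial>\<mu>)"
proof -
  define a B where "a = 1 - K1 * Tr" and "B = M2 + M1 * Tr"
  have a0: "0 < a" and B0: "0 \<le> B"
    using a pos Tr_nonneg by (auto simp: a_def B_def)
  obtain C where C: "0 \<le> C" and ineq: "\<forall>\<mu>\<in>\<M>. \<forall>\<epsilon>\<in>{0<..1}. \<forall>\<delta>\<in>{0<..1}. \<forall>k.
    integrable \<mu> (\<lambda>x. ell k x ^ Suc m * chid \<epsilon> \<delta> m k x) \<and>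
    integrable \<mu> (\<lambda>x. S k x * ell k x ^ m * chid \<epsilon> \<delta> m k x) \<and>
    integrable \<mu> (\<lambda>x. ell k x ^ m * chid \<epsilon> \<delta> m k x) \<and>
    a * (\<integral>x. ell k x ^ Suc m * chid \<epsilon> \<delta> m k x \<partial>\<mu>)
      \<le> B * (\<integral>x. S k x * ell k x ^ m * chid \<epsilon> \<delta> m k x \<partial>\<mu>)
        + C * (\<integral>x. ell k x ^ m * chid \<epsilon> \<delta> m k x \<partial>\<mu>)"
    using cutoff_inequality[of m] unfolding a_def B_def by blast
  show ?thesis
    unfolding a_def[symmetric] B_def[symmetric]
  proof (rule exI[of _ C], rule conjI[OF C], rule ballI)
    fix \<epsilon> :: real assume \<epsilon>: "\<epsilon> \<in> {0<..1}"
    then have \<epsilon>0: "0 \<le> \<epsilon>"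
      by simp
    define D where "D = (B * Jnorm + C) ^ Suc m / \<epsilon> ^ expo m"
    \<comment> \<open>The powers of a / 2 stem from \<open>absorb_power\<close> with
      \<open>\<eta>\<close> = a / 2; the last division is by the half of the left side that
      remains.\<close>
    define c where "c = D / (a / 2) ^ m / (a / 2)"
    have "0 \<le> c"
      unfolding c_def D_def using \<epsilon> a0 B0 C Jnorm_nonneg
      by (intro divide_nonneg_nonneg zero_le_power add_nonneg_nonneg mult_nonneg_nonneg) auto
    moreover have "integrable \<mu> (\<lambda>x. ell k x ^ Suc m * chi \<epsilon> m x) \<and>
      (\<integral>x. ell k x ^ Suc m * chi \<epsilon> m x \<partial>\<mu>) \<le> c * (\<gamma> k powr R) ^ Suc m \<and>
      a * (\<integral>x. ell k x ^ Suc m * chi \<epsilon> m x \<partial>\<mu>)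
        \<le> B * (\<integral>x. S k x * ell k x ^ m * chi \<epsilon> m x \<partial>\<mu>) + C * (\<integral>x. ell k x ^ m * chi \<epsilon> m x \<partial>\<mu>)"
      if \<mu>: "\<mu> \<in> \<M>" for \<mu> k
    proof -
      define \<delta> where "\<delta> i = inverse (real (Suc i))" for i
      have \<delta>: "\<delta> i \<in> {0<..1}" for i
        unfolding \<delta>_def by (rule inverse_Suc_in)
      then have \<delta>0: "0 \<le> \<delta> i" for i
        by (simp add: less_imp_le)
      define f where "f i x = ell k x ^ Suc m * chid \<epsilon> (\<delta> i) m k x" for i x
      have int: "integrable \<mu> (f i)" "integrable \<mu> (\<lambda>x. S k x * ell k x ^ m * chid \<epsilon> (\<delta> i) m k x)"
        "integrable \<mu> (\<lambda>x. ell k x ^ m * chid \<epsilon> (\<delta> i) m k x)"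
        and le: "a * (\<integral>x. f i x \<partial>\<mu>) \<le> B * (\<integral>x. S k x * ell k x ^ m * chid \<epsilon> (\<delta> i) m k x \<partial>\<mu>)
        + C * (\<integral>x. ell k x ^ m * chid \<epsilon> (\<delta> i) m k x \<partial>\<mu>)" for i
        using bspec[OF bspec[OF bspec[OF ineq \<mu>] \<epsilon>] \<delta>[of i]] unfolding f_def by auto
      have e: "1 \<le> ell k x" if "x \<in> space \<mu>" for x
        using that ell_ge_1 by (simp add: space_\<mu>[OF \<mu>])
      have e0: "0 \<le> ell k x" if "x \<in> space \<mu>" for x
        using e[OF that] by simp
      have chid: "0 \<le> chid \<epsilon> (\<delta> i) m k x" "chid \<epsilon> (\<delta> i) m k x \<le> chi \<epsilon> m x" if "x \<in> space \<mu>" for i x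
        using that chid_bounds[of x \<epsilon> "\<delta> i" m k] \<epsilon>0 \<delta>0[of i] by (auto simp: space_\<mu>[OF \<mu>] less_imp_le)
      have f_nonneg: "0 \<le> f i x" if "x \<in> space \<mu>" for i x
        using e[OF that] chid(1)[OF that] by (simp add: f_def)
      have f_lim: "(\<lambda>i. f i x) \<longlonglongrightarrow> ell k x ^ Suc m * chi \<epsilon> m x" for x
        unfolding f_def \<delta>_def by (intro tendsto_intros chid_LIMSEQ \<epsilon>0)
      have "(\<integral>x. f i x \<partial>\<mu>) \<le> c * (\<gamma> k powr R) ^ Suc m" for i
      proof -
        define g where "g = D * (\<gamma> k powr R) ^ Suc m / (a / 2) ^ m"
        have "a * (\<integral>x. f i x \<partial>\<mu>) \<le> (\<integral>x. B * (S k x * ell k x ^ m * chid \<epsilon> (\<delta> i) m k x)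
            + C * (ell k x ^ m * chid \<epsilon> (\<delta> i) m k x) \<partial>\<mu>)"
          using le[of i] int[of i] by simp
        also have "\<dots> \<le> (\<integral>x. a / 2 * f i x + g \<partial>\<mu>)"
        proof (rule integral_mono)
          fix x assume x: "x \<in> space \<mu>"
          define h where "h = chid \<epsilon> (\<delta> i) m k x"
          have h: "0 \<le> h" "h \<le> chi \<epsilon> m x"
            using chid[OF x] by (auto simp: h_def)
          have y: "0 \<le> B * S k x + C"
            using B0 C S_nonneg by simp
          have "(B * S k x + C) * ell k x ^ m * h
              \<le> (a / 2 * ell k x ^ Suc m + (B * S k x + C) ^ Suc m / (a / 2) ^ m) * h"
            using e[OF x] a0 y h(1) by (intro mult_right_mono absorb_power) auto
          also have "\<dots> = a / 2 * (ell k x ^ Suc m * h) + (B * S k x + C) ^ Suc m * h / (a / 2) ^ m"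
            by (simp add: distrib_right)
          also have "\<dots> \<le> a / 2 * (ell k x ^ Suc m * h) + (B * S k x + C) ^ Suc m * chi \<epsilon> m x / (a / 2) ^ m"
            using h(2) y a0 by (intro add_left_mono divide_right_mono mult_left_mono) auto
          also have "\<dots> \<le> a / 2 * (ell k x ^ Suc m * h) + g"
            unfolding g_def D_def
            using source_bound[OF _ \<epsilon> B0 C, of x k m] x a0
            by (intro add_left_mono divide_right_mono) (auto simp: space_\<mu>[OF \<mu>] power_mult_distrib mult_ac)
          finally show "B * (S k x * ell k x ^ m * chid \<epsilon> (\<delta> i) m k x) + C * (ell k x ^ m * chid \<epsilon> (\<delta> i) m k x)
              \<le> a / 2 * f i x + g"
            unfolding f_def h_def by (simp add: distrib_right mult.assoc)
        qed (use int[of i] integrable_const_\<mu>[OF \<mu>] in auto)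
        also have "\<dots> = a / 2 * (\<integral>x. f i x \<partial>\<mu>) + g"
          using int(1)[of i] integrable_const_\<mu>[OF \<mu>] by (simp add: total_mass[OF \<mu>])
        finally have "a / 2 * (\<integral>x. f i x \<partial>\<mu>) \<le> g"
          by simp
        then show ?thesis
          using a0 by (simp add: c_def g_def field_simps)
      qed
      \<comment> \<open>This first use of Fatou's lemma provides integrability with
        \<open>chi\<close>; without it the right side of the limiting inequality would be
        meaningless.\<close>
      note bound = fatou_real[of \<mu> f, OF int(1) f_nonneg f_lim this]
      note lim_int = cutoff_integrable[OF \<mu> \<epsilon> bound(1)]
      \<comment> \<open>Now the original inequality is passed to the limit: on the right
        \<open>chid\<close> is simply replaced by the larger \<open>chi\<close>, on the left Fatou's
        lemma is used once more.\<close>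
      have "(\<integral>x. f i x \<partial>\<mu>) \<le> (B * (\<integral>x. S k x * ell k x ^ m * chi \<epsilon> m x \<partial>\<mu>)
          + C * (\<integral>x. ell k x ^ m * chi \<epsilon> m x \<partial>\<mu>)) / a" for i
      proof -
        have "(\<integral>x. S k x * ell k x ^ m * chid \<epsilon> (\<delta> i) m k x \<partial>\<mu>) \<le> (\<integral>x. S k x * ell k x ^ m * chi \<epsilon> m x \<partial>\<mu>)"
          using int(2)[of i] lim_int(1) chid(2) e0 S_nonneg
          by (intro integral_mono mult_left_mono mult_nonneg_nonneg zero_le_power)
        moreover have "(\<integral>x. ell k x ^ m * chid \<epsilon> (\<delta> i) m k x \<partial>\<mu>) \<le> (\<integral>x. ell k x ^ m * chi \<epsilon> m x \<partial>\<mu>)"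
          using int(3)[of i] lim_int(2) chid(2) e0
          by (intro integral_mono mult_left_mono zero_le_power)
        ultimately have "a * (\<integral>x. f i x \<partial>\<mu>) \<le> B * (\<integral>x. S k x * ell k x ^ m * chi \<epsilon> m x \<partial>\<mu>)
          + C * (\<integral>x. ell k x ^ m * chi \<epsilon> m x \<partial>\<mu>)"
          using B0 C by (intro order_trans[OF le[of i]] add_mono mult_left_mono)
        then show ?thesis
          using a0 by (simp add: field_simps)
      qed
      from fatou_real(2)[of \<mu> f, OF int(1) f_nonneg f_lim this] bound show ?thesis
        using a0 by (simp add: field_simps)
    qed
    ultimately show "\<exists>c\<ge>0. \<forall>\<mu>\<in>\<M>. \<forall>k. integrable \<mu> (\<lambda>x. ell k x ^ Suc m * chi \<epsilon> m x) \<and>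
      (\<integral>x. ell k x ^ Suc m * chi \<epsilon> m x \<partial>\<mu>) \<le> c * (\<gamma> k powr R) ^ Suc m \<and>
      a * (\<integral>x. ell k x ^ Suc m * chi \<epsilon> m x \<partial>\<mu>)
        \<le> B * (\<integral>x. S k x * ell k x ^ m * chi \<epsilon> m x \<partial>\<mu>) + C * (\<integral>x. ell k x ^ m * chi \<epsilon> m x \<partial>\<mu>)"
      by blast
  qed
qed

section \<open>Combining the sites\<close>

text \<open>A contraction argument in a weighted supremum over the sites. The weight is centred at
  the site whose moment is wanted, so the final bound does not depend on that site.\<close>

lemma uniform_cutoff_moment:
  assumes a: "K1 * Tr < 1" and \<Theta>: "Jnorm * K3 * ((M2 + M1 * Tr) / (1 - K1 * Tr)) < 1"
  shows "\<exists>c. \<forall>\<mu>\<in>\<M>. \<forall>\<epsilon>\<in>{0<..1}. \<forall>k.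
    integrable \<mu> (\<lambda>x. ell k x ^ Suc m * chi \<epsilon> m x) \<and> (\<integral>x. ell k x ^ Suc m * chi \<epsilon> m x \<partial>\<mu>) \<le> c"
proof -
  define a B where "a = 1 - K1 * Tr" and "B = M2 + M1 * Tr"
  have a0: "0 < a" and B0: "0 \<le> B"
    using a pos Tr_nonneg by (auto simp: a_def B_def)
  \<comment> \<open>Half of the gap that \<open>\<Theta>\<close> leaves between the left side and
    the interaction: one half absorbs lower order terms, the other remains.\<close>
  define \<eta> where "\<eta> = (a - B * K3 * Jnorm) / 2"
  have \<eta>: "0 < \<eta>"
    using \<Theta> a0 by (simp add: \<eta>_def a_def[symmetric] B_def[symmetric] field_simps)
  obtain C where C: "0 \<le> C" and ex: "\<forall>\<epsilon>\<in>{0<..1}. \<exists>c\<ge>0. \<forall>\<mu>\<in>\<M>. \<forall>k.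
    integrable \<mu> (\<lambda>x. ell k x ^ Suc m * chi \<epsilon> m x) \<and>
    (\<integral>x. ell k x ^ Suc m * chi \<epsilon> m x \<partial>\<mu>) \<le> c * (\<gamma> k powr R) ^ Suc m \<and>
    a * (\<integral>x. ell k x ^ Suc m * chi \<epsilon> m x \<partial>\<mu>)
      \<le> B * (\<integral>x. S k x * ell k x ^ m * chi \<epsilon> m x \<partial>\<mu>) + C * (\<integral>x. ell k x ^ m * chi \<epsilon> m x \<partial>\<mu>)"
    using local_cutoff_limit[OF a, of m] unfolding a_def B_def by blast
  define rest where "rest = C ^ Suc m / \<eta> ^ m"
  show ?thesis
  \<comment> \<open>The factor undoes the weight at its own centre, since \<open>\<gamma> 0\<close>
    may exceed 1.\<close>
  proof (intro exI[of _ "(\<gamma> 0 powr R) ^ Suc m * (rest / \<eta>)"] ballI allI conjI)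
    fix \<mu> and \<epsilon> :: real and k0
    assume \<mu>: "\<mu> \<in> \<M>" and \<epsilon>: "\<epsilon> \<in> {0<..1}"
    then have \<epsilon>0: "0 \<le> \<epsilon>"
      by simp
    obtain c where c: "0 \<le> c" and int: "\<And>k. integrable \<mu> (\<lambda>x. ell k x ^ Suc m * chi \<epsilon> m x)"
      and apriori: "\<And>k. (\<integral>x. ell k x ^ Suc m * chi \<epsilon> m x \<partial>\<mu>) \<le> c * (\<gamma> k powr R) ^ Suc m"
      and ineq: "\<And>k. a * (\<integral>x. ell k x ^ Suc m * chi \<epsilon> m x \<partial>\<mu>)
      \<le> B * (\<integral>x. S k x * ell k x ^ m * chi \<epsilon> m x \<partial>\<mu>) + C * (\<integral>x. ell k x ^ m * chi \<epsilon> m x \<partial>\<mu>)"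
      using bspec[OF ex \<epsilon>] \<mu> by blast
    show "integrable \<mu> (\<lambda>x. ell k0 x ^ Suc m * chi \<epsilon> m x)"
      by (rule int)
    note int' = cutoff_integrable[OF \<mu> \<epsilon> int]
    note [measurable] = ell_measurable[OF \<mu>] S_measurable[OF \<mu>] chi_measurable[OF \<mu> \<epsilon>0]
    \<comment> \<open>The properties needed are \<open>u k \<le> 1\<close>, compensation of the a
      priori growth in \<open>k\<close>, and \<open>u_shift\<close>.\<close>
    define u where "u k = inverse (\<gamma> (k - k0) powr R)" for k
    define Z where "Z k x = u k * ell k x" for k x
    have u: "0 < u k" "u k \<le> 1" for k
      using weight_powr_ge_1[of "k - k0"] by (auto simp: u_def inverse_le_1_iff)
    have u_shift: "u k \<le> \<gamma> (k - j) powr R * u j" for k j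
    proof -
      have "\<gamma> (j - k0) powr R \<le> (\<gamma> (k - k0) * \<gamma> (k - j)) powr R"
        using weight_shift[of j k0 k] weight_pos[of "j - k0"] R by (intro powr_mono2) auto
      also have "\<dots> = \<gamma> (k - k0) powr R * \<gamma> (k - j) powr R"
        using weight_pos by (simp add: powr_mult less_imp_le)
      finally show ?thesis
        using weight_pos[of "k - k0"] weight_pos[of "j - k0"] by (simp add: u_def field_simps)
    qed
    have sp: "x \<in> configs" if "x \<in> space \<mu>" for x
      using that by (simp add: space_\<mu>[OF \<mu>])
    have Z0: "0 \<le> Z k x" if "x \<in> space \<mu>" for k x
      using u[of k] ell_ge_1[OF sp[OF that], of k] by (simp add: Z_def)
    have chi: "0 \<le> chi \<epsilon> m x" "chi \<epsilon> m x \<le> 1" for x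
      using chi_bounds[OF \<epsilon>0, of m x] by auto
    have [measurable]: "Z k \<in> borel_measurable \<mu>" for k
      unfolding Z_def by measurable
    have Z_pow: "Z k x ^ n * chi \<epsilon> m x = u k ^ n * (ell k x ^ n * chi \<epsilon> m x)" for k x n
      by (simp add: Z_def power_mult_distrib)
    have int_Z: "integrable \<mu> (\<lambda>x. Z k x ^ Suc m * chi \<epsilon> m x)" for k
      unfolding Z_pow using int[of k] by (rule integrable_mult_right)
    have eq_Z: "(\<integral>x. Z k x ^ Suc m * chi \<epsilon> m x \<partial>\<mu>) = u k ^ Suc m * (\<integral>x. ell k x ^ Suc m * chi \<epsilon> m x \<partial>\<mu>)" for k
      unfolding Z_pow by (rule integral_mult_right_zero)
    define M where "M = (SUP k. \<integral>x. Z k x ^ Suc m * chi \<epsilon> m x \<partial>\<mu>)"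
    \<comment> \<open>The bound depends on \<open>k0\<close>, \<open>\<epsilon>\<close> and
      \<open>c\<close>, but not on \<open>k\<close>. Hence M is a genuine finite supremum and may be
      absorbed.\<close>
    have "(\<integral>x. Z k x ^ Suc m * chi \<epsilon> m x \<partial>\<mu>) \<le> c * (\<gamma> (- k0) powr R) ^ Suc m" for k
    proof -
      have "\<gamma> k powr R \<le> (\<gamma> (k - k0) * \<gamma> (- k0)) powr R"
        using weight_mult[of "k - k0" "- k0"] weight_pos[of k] R by (intro powr_mono2) auto
      also have "\<dots> = \<gamma> (k - k0) powr R * \<gamma> (- k0) powr R"
        using weight_pos by (simp add: powr_mult less_imp_le)
      finally have "u k * \<gamma> k powr R \<le> \<gamma> (- k0) powr R"
        using weight_pos[of "k - k0"] by (simp add: u_def field_simps)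
      then have "(u k * \<gamma> k powr R) ^ Suc m \<le> (\<gamma> (- k0) powr R) ^ Suc m"
        using u(1)[of k] by (intro power_mono) auto
      then have "c * (u k * \<gamma> k powr R) ^ Suc m \<le> c * (\<gamma> (- k0) powr R) ^ Suc m"
        using c by (rule mult_left_mono)
      moreover have "u k ^ Suc m * (\<integral>x. ell k x ^ Suc m * chi \<epsilon> m x \<partial>\<mu>) \<le> u k ^ Suc m * (c * (\<gamma> k powr R) ^ Suc m)"
        using apriori[of k] u(1)[of k] by (intro mult_left_mono) auto
      ultimately show ?thesis
        unfolding eq_Z power_mult_distrib by (simp only: mult_ac)
    qed
    then have bdd: "bdd_above (range (\<lambda>k. \<integral>x. Z k x ^ Suc m * chi \<epsilon> m x \<partial>\<mu>))"
      by (intro bdd_aboveI2)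
    have le_M: "(\<integral>x. Z k x ^ Suc m * chi \<epsilon> m x \<partial>\<mu>) \<le> M" for k
      unfolding M_def using bdd by (intro cSUP_upper) auto
    have "0 \<le> (\<integral>x. Z k0 x ^ Suc m * chi \<epsilon> m x \<partial>\<mu>)"
      using Z0 chi by (intro Bochner_Integration.integral_nonneg) auto
    then have M0: "0 \<le> M"
      using le_M[of k0] by linarith
    \<comment> \<open>Of the m + 1 factors \<open>u k\<close>, one is moved with the interaction to
      the sites j by \<open>u_shift\<close>; the other m turn the power of \<open>ell k\<close> into
      a power of \<open>Z k\<close>. Young's inequality bounds each mixed moment by M, and what
      remains is a row sum of \<open>J\<close> with the weights of its norm. Finite partial sums are
      treated first.\<close>
    have source: "(\<integral>x. u k * S k x * Z k x ^ m * chi \<epsilon> m x \<partial>\<mu>) \<le> K3 * Jnorm * M" for k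
    proof (rule fatou_real(2))
      define f where "f i x = (\<Sum>j\<in>sites_upto i. J k j * (u k * norm (iXB (x j)) powr R * Z k x ^ m * chi \<epsilon> m x))" for i x
      have [measurable]: "(\<lambda>x. norm (iXB (x j)) powr R) \<in> borel_measurable \<mu>" for j
        by (rule measurable_\<mu>[OF \<mu> continuous_map_site_power])
      define h where "h j x = K3 * \<gamma> (k - j) powr R *
        ((Z j x ^ Suc m * chi \<epsilon> m x + real m * (Z k x ^ Suc m * chi \<epsilon> m x)) / real (Suc m))" for j x
      have int_h: "integrable \<mu> (h j)" for j
        unfolding h_def using int_Z by (intro integrable_mult_right integrable_divide Bochner_Integration.integrable_add)
      have "(\<integral>x. h j x \<partial>\<mu>) \<le> K3 * \<gamma> (k - j) powr R * M" for j
      proof -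
        have "(\<integral>x. h j x \<partial>\<mu>) = K3 * \<gamma> (k - j) powr R *
          (((\<integral>x. Z j x ^ Suc m * chi \<epsilon> m x \<partial>\<mu>) + real m * (\<integral>x. Z k x ^ Suc m * chi \<epsilon> m x \<partial>\<mu>)) / real (Suc m))"
          unfolding h_def using int_Z by simp
        also have "\<dots> \<le> K3 * \<gamma> (k - j) powr R * ((M + real m * M) / real (Suc m))"
          using le_M pos by (intro mult_left_mono divide_right_mono add_mono) auto
        also have "(M + real m * M) / real (Suc m) = M"
          by (simp add: field_simps)
        finally show ?thesis .
      qed
      note h_le = this
      have term_nonneg: "0 \<le> u k * norm (iXB (x j)) powr R * Z k x ^ m * chi \<epsilon> m x" if "x \<in> space \<mu>" for x j
        using u(1)[of k] Z0[OF that, of k] chi(1)[of x] by simp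
      have term_le: "u k * norm (iXB (x j)) powr R * Z k x ^ m * chi \<epsilon> m x \<le> h j x" if x: "x \<in> space \<mu>" for x j
      proof -
        have "u k * norm (iXB (x j)) powr R \<le> (\<gamma> (k - j) powr R * u j) * (K3 * ell j x)"
          using u_shift[of k j] site_power_le[OF sp[OF x], of j] u(1)[of j] by (intro mult_mono) (auto simp: less_imp_le)
        also have "\<dots> = K3 * \<gamma> (k - j) powr R * Z j x"
          by (simp add: Z_def mult_ac)
        finally have "(u k * norm (iXB (x j)) powr R) * (Z k x ^ m * chi \<epsilon> m x)
            \<le> (K3 * \<gamma> (k - j) powr R * Z j x) * (Z k x ^ m * chi \<epsilon> m x)"
          using Z0[OF x, of k] chi(1)[of x] by (intro mult_right_mono) auto
        also have "\<dots> = K3 * \<gamma> (k - j) powr R * ((Z j x * Z k x ^ m) * chi \<epsilon> m x)"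
          by (simp add: mult_ac)
        also have "\<dots> \<le> K3 * \<gamma> (k - j) powr R *
            (((Z j x ^ Suc m + real m * Z k x ^ Suc m) / real (Suc m)) * chi \<epsilon> m x)"
        proof (intro mult_left_mono mult_right_mono)
          show "Z j x * Z k x ^ m \<le> (Z j x ^ Suc m + real m * Z k x ^ Suc m) / real (Suc m)"
            using young_power_mult[OF Z0[OF x, of j] Z0[OF x, of k], of m]
            by (simp only: pos_le_divide_eq of_nat_0_less_iff zero_less_Suc mult.commute)
        qed (use chi pos in auto)
        also have "\<dots> = h j x"
          by (simp add: h_def distrib_right)
        finally show ?thesis
          by (simp only: mult.assoc)
      qed
      have int_term: "integrable \<mu> (\<lambda>x. u k * norm (iXB (x j)) powr R * Z k x ^ m * chi \<epsilon> m x)" for j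
      proof (rule Bochner_Integration.integrable_bound[OF int_h[of j]])
        show "AE x in \<mu>. norm (u k * norm (iXB (x j)) powr R * Z k x ^ m * chi \<epsilon> m x) \<le> norm (h j x)"
          using term_nonneg term_le by (intro AE_I2) (auto intro: order_trans[OF _ abs_ge_self])
      qed measurable
      show int_f: "integrable \<mu> (f i)" for i
        unfolding f_def using int_term by (intro Bochner_Integration.integrable_sum integrable_mult_right)
      show "0 \<le> f i x" if "x \<in> space \<mu>" for i x
        unfolding f_def by (intro sum_nonneg mult_nonneg_nonneg[OF J(1) term_nonneg[OF that]])
      show "(\<lambda>i. f i x) \<longlonglongrightarrow> u k * S k x * Z k x ^ m * chi \<epsilon> m x" if "x \<in> space \<mu>" for x
      proof -
        have "(\<lambda>i. u k * (\<Sum>j\<in>sites_upto i. J k j * norm (iXB (x j)) powr R) * Z k x ^ m * chi \<epsilon> m x)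
            \<longlonglongrightarrow> u k * S k x * Z k x ^ m * chi \<epsilon> m x"
          by (intro tendsto_intros S_LIMSEQ sp that)
        moreover have "f i x = u k * (\<Sum>j\<in>sites_upto i. J k j * norm (iXB (x j)) powr R) * Z k x ^ m * chi \<epsilon> m x" for i
          unfolding f_def by (simp add: sum_distrib_left sum_distrib_right mult_ac)
        ultimately show ?thesis
          by (simp only:)
      qed
      show "(\<integral>x. f i x \<partial>\<mu>) \<le> K3 * Jnorm * M" for i
      proof -
        have "(\<integral>x. f i x \<partial>\<mu>) = (\<Sum>j\<in>sites_upto i. J k j * (\<integral>x. u k * norm (iXB (x j)) powr R * Z k x ^ m * chi \<epsilon> m x \<partial>\<mu>))"
          unfolding f_def using int_term by simp
        also have "\<dots> \<le> (\<Sum>j\<in>sites_upto i. J k j * (K3 * \<gamma> (k - j) powr R * M))"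
        proof (intro sum_mono mult_left_mono J(1))
          fix j
          have "(\<integral>x. u k * norm (iXB (x j)) powr R * Z k x ^ m * chi \<epsilon> m x \<partial>\<mu>) \<le> (\<integral>x. h j x \<partial>\<mu>)"
            by (rule integral_mono[OF int_term int_h term_le])
          also note h_le
          finally show "(\<integral>x. u k * norm (iXB (x j)) powr R * Z k x ^ m * chi \<epsilon> m x \<partial>\<mu>) \<le> K3 * \<gamma> (k - j) powr R * M" .
        qed
        also have "\<dots> = K3 * M * (\<Sum>j\<in>sites_upto i. J k j * \<gamma> (k - j) powr R)"
          by (simp add: sum_distrib_left mult_ac)
        also have "\<dots> \<le> K3 * M * Jnorm"
          using M0 pos by (intro mult_left_mono interaction_row_finite_le) auto
        finally show ?thesis
          by (simp add: mult_ac)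
      qed
    qed
    \<comment> \<open>Here one factor \<open>u k\<close> is left over and is estimated by 1.\<close>
    have lower: "C * (\<integral>x. u k * (Z k x ^ m * chi \<epsilon> m x) \<partial>\<mu>) \<le> \<eta> * M + rest" for k
    proof -
      have int_lower: "integrable \<mu> (\<lambda>x. u k * (Z k x ^ m * chi \<epsilon> m x))"
        unfolding Z_pow using int'(2)[of k] by (intro integrable_mult_right)
      have "C * (\<integral>x. u k * (Z k x ^ m * chi \<epsilon> m x) \<partial>\<mu>) = (\<integral>x. C * (u k * (Z k x ^ m * chi \<epsilon> m x)) \<partial>\<mu>)"
        by simp
      also have "\<dots> \<le> (\<integral>x. \<eta> * (Z k x ^ Suc m * chi \<epsilon> m x) + rest \<partial>\<mu>)"
      proof (rule integral_mono)
        fix x assume x: "x \<in> space \<mu>"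
        have z: "0 \<le> Z k x ^ m * chi \<epsilon> m x"
          using Z0[OF x, of k] chi(1)[of x] by simp
        have "C * (u k * (Z k x ^ m * chi \<epsilon> m x)) \<le> C * (1 * (Z k x ^ m * chi \<epsilon> m x))"
          using u(2)[of k] z C by (intro mult_left_mono mult_right_mono)
        also have "\<dots> = (C * Z k x ^ m) * chi \<epsilon> m x"
          by simp
        also have "\<dots> \<le> (\<eta> * Z k x ^ Suc m + rest) * chi \<epsilon> m x"
          unfolding rest_def using C Z0[OF x, of k] \<eta> chi(1)[of x] by (intro mult_right_mono absorb_power)
        also have "\<dots> \<le> \<eta> * (Z k x ^ Suc m * chi \<epsilon> m x) + rest"
        proof -
          have "0 \<le> rest"
            unfolding rest_def using C \<eta> by simp
          then have "rest * chi \<epsilon> m x \<le> rest * 1"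
            using chi(2)[of x] by (intro mult_left_mono)
          then show ?thesis
            by (simp add: distrib_right)
        qed
        finally show "C * (u k * (Z k x ^ m * chi \<epsilon> m x)) \<le> \<eta> * (Z k x ^ Suc m * chi \<epsilon> m x) + rest" .
      qed (use int_lower int_Z[of k] integrable_const_\<mu>[OF \<mu>] in auto)
      also have "\<dots> = \<eta> * (\<integral>x. Z k x ^ Suc m * chi \<epsilon> m x \<partial>\<mu>) + rest"
        using int_Z[of k] integrable_const_\<mu>[OF \<mu>] by (simp add: total_mass[OF \<mu>])
      also have "\<dots> \<le> \<eta> * M + rest"
        using le_M[of k] \<eta> by (intro add_right_mono mult_left_mono) auto
      finally show ?thesis .
    qed
    have "(\<integral>x. Z k x ^ Suc m * chi \<epsilon> m x \<partial>\<mu>) \<le> (B * (K3 * Jnorm * M) + (\<eta> * M + rest)) / a" for k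
    proof -
      have "a * (\<integral>x. Z k x ^ Suc m * chi \<epsilon> m x \<partial>\<mu>) = u k ^ Suc m * (a * (\<integral>x. ell k x ^ Suc m * chi \<epsilon> m x \<partial>\<mu>))"
        unfolding eq_Z by (simp only: mult_ac)
      also have "\<dots> \<le> u k ^ Suc m * (B * (\<integral>x. S k x * ell k x ^ m * chi \<epsilon> m x \<partial>\<mu>)
          + C * (\<integral>x. ell k x ^ m * chi \<epsilon> m x \<partial>\<mu>))"
        using ineq[of k] u(1)[of k] by (intro mult_left_mono) auto
      also have "\<dots> = B * (u k ^ Suc m * (\<integral>x. S k x * ell k x ^ m * chi \<epsilon> m x \<partial>\<mu>))
          + C * (u k ^ Suc m * (\<integral>x. ell k x ^ m * chi \<epsilon> m x \<partial>\<mu>))"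
        by (simp only: distrib_left mult_ac)
      also have "u k ^ Suc m * (\<integral>x. S k x * ell k x ^ m * chi \<epsilon> m x \<partial>\<mu>)
          = (\<integral>x. u k ^ Suc m * (S k x * ell k x ^ m * chi \<epsilon> m x) \<partial>\<mu>)"
        by simp
      also have "\<dots> = (\<integral>x. u k * S k x * Z k x ^ m * chi \<epsilon> m x \<partial>\<mu>)"
        by (rule Bochner_Integration.integral_cong) (simp_all add: Z_def power_mult_distrib mult_ac)
      also have "u k ^ Suc m * (\<integral>x. ell k x ^ m * chi \<epsilon> m x \<partial>\<mu>)
          = (\<integral>x. u k ^ Suc m * (ell k x ^ m * chi \<epsilon> m x) \<partial>\<mu>)"
        by simp
      also have "\<dots> = (\<integral>x. u k * (Z k x ^ m * chi \<epsilon> m x) \<partial>\<mu>)"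
        by (rule Bochner_Integration.integral_cong) (simp_all add: Z_def power_mult_distrib mult_ac)
      also have "B * (\<integral>x. u k * S k x * Z k x ^ m * chi \<epsilon> m x \<partial>\<mu>) + C * (\<integral>x. u k * (Z k x ^ m * chi \<epsilon> m x) \<partial>\<mu>)
          \<le> B * (K3 * Jnorm * M) + (\<eta> * M + rest)"
        using source[of k] lower[of k] B0 by (intro add_mono mult_left_mono)
      finally show ?thesis
        using a0 by (simp only: pos_le_divide_eq mult.commute)
    qed
    then have "M \<le> (B * (K3 * Jnorm * M) + (\<eta> * M + rest)) / a"
      unfolding M_def[symmetric] by (subst M_def) (intro cSUP_least; simp)
    then have "a * M \<le> B * (K3 * Jnorm * M) + (\<eta> * M + rest)"
      using a0 by (simp only: pos_le_divide_eq mult.commute)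
    \<comment> \<open>Subtracting the interaction part and one \<open>\<eta>\<close> leaves
      \<open>\<eta> * M\<close> on the left.\<close>
    moreover have "a = B * K3 * Jnorm + 2 * \<eta>"
      by (simp add: \<eta>_def field_simps)
    ultimately have "\<eta> * M \<le> rest"
      by (simp add: algebra_simps)
    then have M_le: "M \<le> rest / \<eta>"
      using \<eta> by (simp add: pos_le_divide_eq mult.commute)
    have "(\<gamma> 0 powr R) ^ Suc m * (u k0 ^ Suc m * (\<integral>x. ell k0 x ^ Suc m * chi \<epsilon> m x \<partial>\<mu>))
        \<le> (\<gamma> 0 powr R) ^ Suc m * (rest / \<eta>)"
      using le_M[of k0] M_le unfolding eq_Z by (intro mult_left_mono) auto
    moreover have "(\<gamma> 0 powr R) ^ Suc m * u k0 ^ Suc m = 1"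
      using weight_pos[of 0] unfolding power_mult_distrib[symmetric] by (simp add: u_def)
    ultimately show "(\<integral>x. ell k0 x ^ Suc m * chi \<epsilon> m x \<partial>\<mu>) \<le> (\<gamma> 0 powr R) ^ Suc m * (rest / \<eta>)"
      by (simp only: mult.assoc[symmetric] mult_1_left)
  qed
qed

section \<open>From cutoff moments to the stated suprema\<close>

text \<open>The bound with \<open>chi\<close> is uniform in \<open>\<epsilon>\<close>, so Fatou's
  lemma removes the last cutoff.\<close>

lemma uniform_ell_moment:
  assumes "K1 * Tr < 1" and "Jnorm * K3 * ((M2 + M1 * Tr) / (1 - K1 * Tr)) < 1"
  shows "\<exists>c\<ge>0. \<forall>\<mu>\<in>\<M>. \<forall>k. integrable \<mu> (\<lambda>x. ell k x ^ Suc m) \<and> (\<integral>x. ell k x ^ Suc m \<partial>\<mu>) \<le> c"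
proof -
  obtain c where c: "\<And>\<mu> \<epsilon> k. \<mu> \<in> \<M> \<Longrightarrow> \<epsilon> \<in> {0<..1} \<Longrightarrow> integrable \<mu> (\<lambda>x. ell k x ^ Suc m * chi \<epsilon> m x)"
    "\<And>\<mu> \<epsilon> k. \<mu> \<in> \<M> \<Longrightarrow> \<epsilon> \<in> {0<..1} \<Longrightarrow> (\<integral>x. ell k x ^ Suc m * chi \<epsilon> m x \<partial>\<mu>) \<le> c"
    using uniform_cutoff_moment[OF assms, of m] by blast
  \<comment> \<open>If there is no symmetrizing measure, nothing prevents \<open>c\<close> from
    being negative; hence the maximum.\<close>
  have "integrable \<mu> (\<lambda>x. ell k x ^ Suc m)" "(\<integral>x. ell k x ^ Suc m \<partial>\<mu>) \<le> max 0 c" if \<mu>: "\<mu> \<in> \<M>" for \<mu> k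
  proof -
    define f where "f i x = ell k x ^ Suc m * chi (inverse (real (Suc i))) m x" for i x
    have lim: "(\<lambda>i. f i x) \<longlonglongrightarrow> ell k x ^ Suc m" for x
      using tendsto_mult[OF tendsto_const chi_LIMSEQ, of "ell k x ^ Suc m" m x] by (simp add: f_def)
    have nn: "0 \<le> f i x" if "x \<in> space \<mu>" for i x
      using that ell_ge_1[of x k] chi_bounds(1)[of "inverse (real (Suc i))" m x] inverse_Suc_in[of i]
      by (simp add: f_def space_\<mu>[OF \<mu>])
    have "integrable \<mu> (f i)" "(\<integral>x. f i x \<partial>\<mu>) \<le> max 0 c" for i
      unfolding f_def using c[OF \<mu> inverse_Suc_in] by (auto intro: order_trans[OF _ max.cobounded2])
    from fatou_real[of \<mu> f, OF this(1) nn lim this(2)]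
    show "integrable \<mu> (\<lambda>x. ell k x ^ Suc m)" "(\<integral>x. ell k x ^ Suc m \<partial>\<mu>) \<le> max 0 c"
      by auto
  qed
  then show ?thesis
    by (intro exI[of _ "max 0 c"]) auto
qed

text \<open>A replacement for Jensen's inequality with the weights \<open>J k j\<close>: one factor
  of the power of the partial sum is expanded, and \<open>absorb_power\<close> is applied to each
  term. Since the row sums of \<open>J\<close> are bounded, a small \<open>\<eta>\<close> returns at
  most half of the power.\<close>

lemma uniform_interaction_moment:
  assumes "K1 * Tr < 1" and "Jnorm * K3 * ((M2 + M1 * Tr) / (1 - K1 * Tr)) < 1"
  shows "\<exists>c\<ge>0. \<forall>\<mu>\<in>\<M>. \<forall>k. integrable \<mu> (\<lambda>x. S k x ^ Suc m) \<and> (\<integral>x. S k x ^ Suc m \<partial>\<mu>) \<le> c"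
proof -
  obtain c where c0: "0 \<le> c" and c: "\<And>\<mu> k. \<mu> \<in> \<M> \<Longrightarrow> integrable \<mu> (\<lambda>x. ell k x ^ Suc m)"
    "\<And>\<mu> k. \<mu> \<in> \<M> \<Longrightarrow> (\<integral>x. ell k x ^ Suc m \<partial>\<mu>) \<le> c"
    using uniform_ell_moment[OF assms, of m] by blast
  \<comment> \<open>The added 1 keeps this positive and finite when the interaction
    vanishes.\<close>
  define \<eta> where "\<eta> = 1 / (2 * (Jnorm + 1))"
  have \<eta>: "0 < \<eta>" "\<eta> * Jnorm \<le> 1 / 2"
    using Jnorm_nonneg by (auto simp: \<eta>_def field_simps)
  have row: "(\<Sum>j\<in>I. J k j) \<le> Jnorm" if "finite I" for I k
  proof -
    have "(\<Sum>j\<in>I. J k j * 1) \<le> (\<Sum>j\<in>I. J k j * \<gamma> (k - j) powr R)"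
      using J(1) weight_powr_ge_1 by (intro sum_mono mult_left_mono)
    also have "\<dots> \<le> Jnorm"
      by (rule interaction_row_finite_le[OF that])
    finally show ?thesis
      by simp
  qed
  define d where "d = 2 * (K3 ^ Suc m / \<eta> ^ m)"
  have d: "0 \<le> d"
    using \<eta> pos by (simp add: d_def)
  have "integrable \<mu> (\<lambda>x. S k x ^ Suc m)" "(\<integral>x. S k x ^ Suc m \<partial>\<mu>) \<le> d * (Jnorm * c)" if \<mu>: "\<mu> \<in> \<M>" for \<mu> k
  proof -
    define T where "T i x = (\<Sum>j\<in>sites_upto i. J k j * norm (iXB (x j)) powr R)" for i x
    have T0: "0 \<le> T i x" for i x
      unfolding T_def using J(1) by (intro sum_nonneg mult_nonneg_nonneg) auto
    define h where "h i x = d * (\<Sum>j\<in>sites_upto i. J k j * ell j x ^ Suc m)" for i x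
    have int_h: "integrable \<mu> (h i)" for i
      unfolding h_def using c(1)[OF \<mu>] by (intro integrable_mult_right Bochner_Integration.integrable_sum)
    have T_le: "T i x ^ Suc m \<le> h i x" if "x \<in> space \<mu>" for i x
    proof -
      have x: "x \<in> configs"
        using that by (simp add: space_\<mu>[OF \<mu>])
      let ?t = "T i x ^ Suc m"
      have "?t = (\<Sum>j\<in>sites_upto i. J k j * (norm (iXB (x j)) powr R * T i x ^ m))"
        by (simp add: T_def sum_distrib_right mult.assoc)
      also have "\<dots> \<le> (\<Sum>j\<in>sites_upto i. J k j * (\<eta> * ?t + (norm (iXB (x j)) powr R) ^ Suc m / \<eta> ^ m))"
        using T0 \<eta>(1) J(1) by (intro sum_mono mult_left_mono absorb_power) auto
      also have "\<dots> \<le> (\<Sum>j\<in>sites_upto i. J k j * (\<eta> * ?t + (K3 * ell j x) ^ Suc m / \<eta> ^ m))"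
        using J(1) \<eta>(1) site_power_le[OF x]
        by (intro sum_mono mult_left_mono add_left_mono divide_right_mono power_mono) auto
      also have "\<dots> = (\<Sum>j\<in>sites_upto i. J k j) * (\<eta> * ?t)
          + (K3 ^ Suc m / \<eta> ^ m) * (\<Sum>j\<in>sites_upto i. J k j * ell j x ^ Suc m)"
        unfolding sum_distrib_left sum_distrib_right sum.distrib[symmetric]
        by (intro sum.cong refl) (simp add: distrib_left power_mult_distrib mult_ac)
      also have "(\<Sum>j\<in>sites_upto i. J k j) * (\<eta> * ?t) \<le> 1 / 2 * ?t"
      proof -
        have "(\<Sum>j\<in>sites_upto i. J k j) * (\<eta> * ?t) \<le> Jnorm * (\<eta> * ?t)"
          using row \<eta>(1) T0 by (intro mult_right_mono mult_nonneg_nonneg zero_le_power) auto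
        also have "\<dots> = (\<eta> * Jnorm) * ?t"
          by (simp only: mult_ac)
        also have "\<dots> \<le> 1 / 2 * ?t"
          using \<eta>(2) T0 by (intro mult_right_mono zero_le_power)
        finally show ?thesis .
      qed
      finally show ?thesis
        by (simp add: h_def d_def)
    qed
    have meas: "(\<lambda>x. T i x ^ Suc m) \<in> borel_measurable \<mu>" for i
    proof -
      have [measurable]: "(\<lambda>x. norm (iXB (x j)) powr R) \<in> borel_measurable \<mu>" for j
        by (rule measurable_\<mu>[OF \<mu> continuous_map_site_power])
      show ?thesis
        unfolding T_def by measurable
    qed
    have int_T: "integrable \<mu> (\<lambda>x. T i x ^ Suc m)" for i
    proof (rule Bochner_Integration.integrable_bound[OF int_h[of i] meas])
      show "AE x in \<mu>. norm (T i x ^ Suc m) \<le> norm (h i x)"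
        using T_le T0 by (intro AE_I2) (auto intro: order_trans[OF _ abs_ge_self] simp del: power_Suc)
    qed
    have le_T: "(\<integral>x. T i x ^ Suc m \<partial>\<mu>) \<le> d * (Jnorm * c)" for i
    proof -
      have "(\<integral>x. T i x ^ Suc m \<partial>\<mu>) \<le> (\<integral>x. h i x \<partial>\<mu>)"
        by (rule integral_mono[OF int_T int_h T_le])
      also have "\<dots> = d * (\<Sum>j\<in>sites_upto i. J k j * (\<integral>x. ell j x ^ Suc m \<partial>\<mu>))"
        unfolding h_def using c(1)[OF \<mu>] by (simp del: power_Suc)
      also have "\<dots> \<le> d * (\<Sum>j\<in>sites_upto i. J k j * c)"
        using c(2)[OF \<mu>] d J(1) by (intro mult_left_mono sum_mono)
      also have "\<dots> \<le> d * (Jnorm * c)"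
        unfolding sum_distrib_right[symmetric] using d c0 row by (intro mult_left_mono mult_right_mono) auto
      finally show ?thesis .
    qed
    have lim: "(\<lambda>i. T i x ^ Suc m) \<longlonglongrightarrow> S k x ^ Suc m" if "x \<in> space \<mu>" for x
      unfolding T_def using that by (intro tendsto_power S_LIMSEQ) (simp add: space_\<mu>[OF \<mu>])
    from fatou_real[of \<mu> "\<lambda>i x. T i x ^ Suc m", OF int_T zero_le_power[OF T0] lim le_T]
    show "integrable \<mu> (\<lambda>x. S k x ^ Suc m)" "(\<integral>x. S k x ^ Suc m \<partial>\<mu>) \<le> d * (Jnorm * c)"
      by auto
  qed
  then show ?thesis
    using d Jnorm_nonneg c0 by (intro exI[of _ "d * (Jnorm * c)"]) auto
qed

text \<open>Passes to nonnegative integrals in the extended reals, where finiteness of the supremum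
  includes integrability for every measure and site.\<close>

lemma sup_moment_finite:
  fixes f :: "'k \<Rightarrow> ('k \<Rightarrow> 'x) \<Rightarrow> real"
  assumes moments: "\<And>m. \<exists>c\<ge>0. \<forall>\<mu>\<in>\<M>. \<forall>k. integrable \<mu> (\<lambda>x. g k x ^ Suc m) \<and> (\<integral>x. g k x ^ Suc m \<partial>\<mu>) \<le> c"
    and le: "\<And>k x. x \<in> configs \<Longrightarrow> 0 \<le> f k x \<and> f k x \<le> b * (1 + g k x ^ Suc n)"
    and "0 \<le> b" and g: "\<And>k x. x \<in> configs \<Longrightarrow> 0 \<le> g k x"
  shows "(SUP \<mu>\<in>\<M>. SUP k. \<integral>\<^sup>+x. ennreal (f k x) \<partial>\<mu>) < \<infinity>"
proof -
  obtain c where c: "\<And>\<mu> k. \<mu> \<in> \<M> \<Longrightarrow> integrable \<mu> (\<lambda>x. g k x ^ Suc n)"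
    "\<And>\<mu> k. \<mu> \<in> \<M> \<Longrightarrow> (\<integral>x. g k x ^ Suc n \<partial>\<mu>) \<le> c"
    using moments[of n] by blast
  have "(\<integral>\<^sup>+x. ennreal (f k x) \<partial>\<mu>) \<le> ennreal (b * (1 + c))" if \<mu>: "\<mu> \<in> \<M>" for \<mu> k
  proof -
    have int: "integrable \<mu> (\<lambda>x. b * (1 + g k x ^ Suc n))"
      by (intro integrable_mult_right Bochner_Integration.integrable_add integrable_const_\<mu>[OF \<mu>] c(1)[OF \<mu>])
    have "(\<integral>\<^sup>+x. ennreal (f k x) \<partial>\<mu>) \<le> (\<integral>\<^sup>+x. ennreal (b * (1 + g k x ^ Suc n)) \<partial>\<mu>)"
      using le by (intro nn_integral_mono ennreal_leI) (simp add: space_\<mu>[OF \<mu>])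
    also have "\<dots> = ennreal (\<integral>x. b * (1 + g k x ^ Suc n) \<partial>\<mu>)"
      using int
    proof (rule nn_integral_eq_integral)
      show "AE x in \<mu>. 0 \<le> b * (1 + g k x ^ Suc n)"
        using g \<open>0 \<le> b\<close> by (intro AE_I2 mult_nonneg_nonneg add_nonneg_nonneg zero_le_power)
          (auto simp: space_\<mu>[OF \<mu>])
    qed
    also have "(\<integral>x. b * (1 + g k x ^ Suc n) \<partial>\<mu>) = b * (1 + (\<integral>x. g k x ^ Suc n \<partial>\<mu>))"
      using c(1)[OF \<mu>, of k] integrable_const_\<mu>[OF \<mu>] by (simp add: total_mass[OF \<mu>] del: power_Suc)
    also have "\<dots> \<le> b * (1 + c)"
      using c(2)[OF \<mu>, of k] \<open>0 \<le> b\<close> by (intro mult_left_mono) auto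
    finally show ?thesis
      using ennreal_leI by blast
  qed
  then have "(SUP \<mu>\<in>\<M>. SUP k. \<integral>\<^sup>+x. ennreal (f k x) \<partial>\<mu>) \<le> ennreal (b * (1 + c))"
    by (intro SUP_least)
  then show ?thesis
    using ennreal_less_top le_less_trans by fastforce
qed

text \<open>Reduces real exponents to the integer moments already bounded; the 1 takes care of bases
  below 1.\<close>

lemma powr_le_Suc_power:
  fixes y Q :: real
  assumes "0 \<le> y" "1 \<le> Q"
  shows "y powr Q \<le> 1 + y ^ Suc (nat \<lceil>Q\<rceil>)"
proof (cases "y \<le> 1")
  case True
  then have "y powr Q \<le> 1 powr Q"
    using assms by (intro powr_mono2) auto
  then show ?thesis
    using assms by (simp add: add_increasing2)
next
  case False
  then have "y powr Q \<le> y powr real (Suc (nat \<lceil>Q\<rceil>))"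
    using assms by (intro powr_mono) (auto simp: le_nat_iff, linarith)
  also have "\<dots> = y ^ Suc (nat \<lceil>Q\<rceil>)"
    using False by (intro powr_realpow) auto
  finally show ?thesis
    by simp
qed

lemma uniform_moments:
  assumes \<Xi>: "K1 * Tr < 1" and \<Theta>: "Jnorm * K3 * ((M2 + M1 * Tr) / (1 - K1 * Tr)) < 1" and Q: "1 \<le> Q"
  shows "(SUP \<mu>\<in>\<M>. SUP k. \<integral>\<^sup>+x. ennreal (\<bar>coercivity iXB F0 k (x k)\<bar> powr Q) \<partial>\<mu>) < \<infinity>"
    "(SUP \<mu>\<in>\<M>. SUP k. \<integral>\<^sup>+x. ennreal (norm (iXB (x k)) powr Q) \<partial>\<mu>) < \<infinity>"
    "(SUP \<mu>\<in>\<M>. SUP k. \<integral>\<^sup>+x. ennreal (S k x powr Q) \<partial>\<mu>) < \<infinity>"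
proof -
  let ?n = "nat \<lceil>Q\<rceil>"
  note ell = uniform_ell_moment[OF \<Xi> \<Theta>] and inter = uniform_interaction_moment[OF \<Xi> \<Theta>]
  have ell0: "0 \<le> ell k x" if "x \<in> configs" for k x
    using ell_ge_1[OF that, of k] by simp
  show "(SUP \<mu>\<in>\<M>. SUP k. \<integral>\<^sup>+x. ennreal (\<bar>coercivity iXB F0 k (x k)\<bar> powr Q) \<partial>\<mu>) < \<infinity>"
  proof (rule sup_moment_finite[OF ell, where b = 1 and n = ?n])
    fix k x assume x: "x \<in> configs"
    have "\<bar>coercivity iXB F0 k (x k)\<bar> powr Q \<le> ell k x powr Q"
      using Q abs_coercivity_le[OF x] by (intro powr_mono2) auto
    also have "\<dots> \<le> 1 + ell k x ^ Suc ?n"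
      by (rule powr_le_Suc_power[OF ell0[OF x] Q])
    finally show "0 \<le> \<bar>coercivity iXB F0 k (x k)\<bar> powr Q \<and>
        \<bar>coercivity iXB F0 k (x k)\<bar> powr Q \<le> 1 * (1 + ell k x ^ Suc ?n)"
      by simp
  qed (use ell0 in auto)
  show "(SUP \<mu>\<in>\<M>. SUP k. \<integral>\<^sup>+x. ennreal (S k x powr Q) \<partial>\<mu>) < \<infinity>"
    by (rule sup_moment_finite[OF inter, where b = 1 and n = ?n])
      (use S_nonneg powr_le_Suc_power[OF S_nonneg Q] in auto)
  show "(SUP \<mu>\<in>\<M>. SUP k. \<integral>\<^sup>+x. ennreal (norm (iXB (x k)) powr Q) \<partial>\<mu>) < \<infinity>"
  proof (rule sup_moment_finite[OF ell, where b = "1 + K3 powr Q" and n = ?n])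
    fix k x assume x: "x \<in> configs"
    let ?y = "norm (iXB (x k))"
    have e: "0 \<le> ell k x ^ Suc ?n"
      using ell0[OF x] by (rule zero_le_power)
    have "?y powr Q \<le> 1 + (K3 * ell k x) powr Q"
    proof (cases "?y \<le> 1")
      case True
      then have "?y powr Q \<le> 1 powr Q"
        using Q by (intro powr_mono2) auto
      then show ?thesis
        by (simp add: add_increasing2)
    next
      case False
      \<comment> \<open>As R is at least 1, a norm larger than 1 is dominated by its R-th power and
        so by \<open>ell\<close>. No lower bound on Q in terms of R is involved.\<close>
      have "?y powr 1 \<le> ?y powr R"
        using False R by (intro powr_mono) auto
      then have "?y \<le> K3 * ell k x"
        using site_power_le[OF x, of k] False by simp
      then have "?y powr Q \<le> (K3 * ell k x) powr Q"
        using Q by (intro powr_mono2) auto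
      then show ?thesis
        by simp
    qed
    also have "\<dots> = 1 + K3 powr Q * ell k x powr Q"
      using pos ell0[OF x] by (simp add: powr_mult)
    also have "\<dots> \<le> 1 + K3 powr Q * (1 + ell k x ^ Suc ?n)"
      by (intro add_left_mono mult_left_mono powr_le_Suc_power ell0[OF x] Q) simp
    also have "\<dots> \<le> (1 + K3 powr Q) * (1 + ell k x ^ Suc ?n)"
      unfolding distrib_right using e by simp
    finally show "0 \<le> ?y powr Q \<and> ?y powr Q \<le> (1 + K3 powr Q) * (1 + ell k x ^ Suc ?n)"
      by simp
  qed (use ell0 in auto)
qed

end

theorem theorem7p1:
  fixes iXB :: "'x::{real_vector, polish_space} \<Rightarrow> 'b::banach"
    and iBH :: "'b \<Rightarrow>\<^sub>L 'h::{real_inner, polish_space}"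
    and D :: "'h set" and A :: "'h \<Rightarrow> 'h"
    and lam :: "nat \<Rightarrow> real" and \<phi> :: "nat \<Rightarrow> 'x"
    and \<gamma> :: "'k::{countable, ab_group_add} \<Rightarrow> real"
    and F0 :: "'k \<Rightarrow> 'x \<Rightarrow> ('b \<Rightarrow>\<^sub>L real)"
    and G :: "'k \<Rightarrow> ('k \<Rightarrow> 'x) \<Rightarrow> ('b \<Rightarrow>\<^sub>L real)"
    and J :: "'k \<Rightarrow> 'k \<Rightarrow> real"
    and R K0 K1 K2 K3 M1 M2 L0 L1 L2 L3 N1 N2 :: real
  defines "\<X> \<equiv> config iXB \<gamma>"
    and "dF0 \<equiv> (\<lambda>k n. partial_deriv (site_line (\<phi> n)) (F0 k))"
    and "dG \<equiv> (\<lambda>k n. partial_deriv (config_line (basis_dir \<phi> k n)) (G k))"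
    and "L \<equiv> coercivity iXB F0"
    and "S \<equiv> interaction_sum iXB R J"
    and "\<M> \<equiv> symmetrizing_measures iXB iBH A \<phi> \<gamma> (full_drift F0 G)"
    and "Tr \<equiv> trace_inv lam"
  assumes setting: "log_gradient iXB iBH D A lam \<phi> \<gamma> F0 G"
    and R: "1 \<le> R"
    and J: "\<And>k j. J k j = J j k" "\<And>k j. 0 \<le> J k j" "interaction_norm_finite \<gamma> R J"
    and pos: "0 < K0" "0 < K1" "0 < K2" "0 < K3" "0 < M1" "0 < M2"
    and nonneg: "0 \<le> L0" "0 \<le> L1" "0 \<le> L2" "0 \<le> L3" "0 \<le> N1" "0 \<le> N2"
    and hF0: "\<And>x k n. x \<in> \<X> \<Longrightarrow>
      norm (dF0 k n (x k)) \<le> K0 * (norm (F0 k (x k)) + norm (iXB (x k)) powr R) + L0"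
    and hG1: "\<And>x k n. x \<in> \<X> \<Longrightarrow>
      \<bar>G k x (iXB (\<phi> n))\<bar> + \<bar>dG k n x (iXB (\<phi> n))\<bar> \<le> M1 * S k x + N1"
    and hG2: "\<And>x k n. x \<in> \<X> \<Longrightarrow>
      norm (G k x) + \<bar>G k x (iXB (x k))\<bar> + \<bar>dG k n x (iXB (x k))\<bar> \<le> M2 * S k x + N2"
    and hL1: "\<And>x k n. x \<in> \<X> \<Longrightarrow>
      \<bar>F0 k (x k) (iXB (\<phi> n))\<bar> + \<bar>dF0 k n (x k) (iXB (\<phi> n))\<bar> \<le> K1 * L k (x k) + L1"
    and hL2: "\<And>x k n. x \<in> \<X> \<Longrightarrow> \<bar>dF0 k n (x k) (iXB (x k))\<bar> \<le> K2 * L k (x k) + L2"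
    and hL3: "\<And>x k. x \<in> \<X> \<Longrightarrow> norm (iXB (x k)) powr R \<le> K3 * L k (x k) + L3"
    and Xi0: "K1 * Tr < 1"
    and Theta0: "interaction_norm \<gamma> R J * K3 * ((M2 + M1 * Tr) / (1 - K1 * Tr)) < 1"
  shows "(SUP \<mu>\<in>\<M>. SUP k. \<integral>\<^sup>+x. ennreal \<bar>L k (x k)\<bar> \<partial>\<mu>) < \<infinity> \<and>
    (\<forall>Q\<ge>1. (SUP \<mu>\<in>\<M>. SUP k. \<integral>\<^sup>+x. ennreal (norm (iXB (x k)) powr Q) \<partial>\<mu>) < \<infinity> \<and>
            (SUP \<mu>\<in>\<M>. SUP k. \<integral>\<^sup>+x. ennreal (S k x powr Q) \<partial>\<mu>) < \<infinity>) \<and>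
    (\<forall>Q\<ge>1. Tr * K1 * (1 + (Q - 1) * K2) < 1 \<longrightarrow>
            (SUP \<mu>\<in>\<M>. SUP k. \<integral>\<^sup>+x. ennreal (\<bar>L k (x k)\<bar> powr Q) \<partial>\<mu>) < \<infinity>)"
proof -
  interpret moment_setting iXB iBH D A lam \<phi> \<gamma> F0 G J R K0 K1 K2 K3 M1 M2 L0 L1 L2 L3 N1 N2
    using R J(2,3) pos nonneg hF0 hG1 hG2 hL1 hL2 hL3
    unfolding \<X>_def dF0_def dG_def L_def S_def
    by (intro moment_setting.intro[OF setting] moment_setting_axioms.intro)
  note moments = uniform_moments[OF Xi0[unfolded Tr_def] Theta0[unfolded Tr_def]]
  \<comment> \<open>The first claim is the case Q = 1 of the coercivity moments, where the real
    power of an absolute value is the absolute value.\<close>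
  show ?thesis
    unfolding \<M>_def L_def S_def
    using moments(1)[of 1] moments by simp
qed

end
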